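(* Consider an energy harvesting sensor with average harvested energy $\bar H \ge E_s$ that employs the CUSUM test $$W_k=\max\{0,\,W_{k-1}+Z_k\},\quad W_0=0,\qquad Z_k=\log\frac{f_1(X_k)}{f_0(X_k)},$$ to detect a change from the density $f_0$ to the density $f_1$ in the observed samples, with detection time $\tau(h)=\inf\{n\ge 1: W_n>h\}$. Assume that under $P_1$ the distribution of $Z_1$ is non-arithmetic, that $\mathcal I_{KL}=E_1[Z_1]$ is positive and finite, and that $\sigma_1^2=E_1[(Z_1-\mathcal I_{KL})^2]<\infty$. Then the average detection delay satisfies, as $h\to\infty$, $$E_1[\tau(h)]=\frac{1}{\mathcal I_{KL}}\left(h+\frac{E_1[S_{T_+}^2]}{E_1[S_{T_+}]}-\frac{E_1[Z_1^2]}{2\,\mathcal I_{KL}}\right)+o(1),$$ an expression that does not depend on $\bar H$.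
   Context: $f_0,f_1$ are probability densities (pre- and post-change), with $f_1$ absolutely continuous with respect to $f_0$. $P_1,E_1$ denote probability and expectation when all samples $X_1,X_2,\dots$ are i.i.d. with density $f_1$. $\mathcal I_{KL}=\int \log\frac{f_1(x)}{f_0(x)}f_1(x)\,dx$. The random walk is $S_n=\sum_{k=1}^n Z_k$, $S_0=0$; its first (strict) ascending ladder epoch is $T_+=\inf\{n\ge1:S_n>0\}$ with ladder height $S_{T_+}$. Energy model: the battery level evolves as $B_{k+1}=B_k+H_k-1_{(B_k>E_s)}E_s$, where $E_s>0$ is the energy needed to sense and process one sample and $\{H_k\}$ are the nonnegative harvested energies, i.i.d. with an absolutely continuous distribution of finite mean $\bar H$, independent of $\{X_k\}$. *)

theory Defs
  imports "HOL-Probability.Probability" "HOL-Library.Landau_Symbols"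
begin

text \<open>Time is numbered from 1: the value of a sequence at index 0 is never used.\<close>

definition is_density :: "(real \<Rightarrow> real) \<Rightarrow> bool" where
  "is_density f \<longleftrightarrow> f \<in> borel_measurable borel \<and> (\<forall>x. 0 \<le> f x) \<and>
     (\<integral>\<^sup>+ x. ennreal (f x) \<partial>lborel) = 1"

definition llr :: "(real \<Rightarrow> real) \<Rightarrow> (real \<Rightarrow> real) \<Rightarrow> real \<Rightarrow> real" where
  "llr f0 f1 x = ln (f1 x / f0 x)"

definition KL_info :: "(real \<Rightarrow> real) \<Rightarrow> (real \<Rightarrow> real) \<Rightarrow> real" where
  "KL_info f0 f1 = (\<integral>x. ln (f1 x / f0 x) * f1 x \<partial>lborel)"

text \<open>The law of the sample sequence when all samples are i.i.d. with density \<open>f\<close>.\<close>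

definition iid_law :: "(real \<Rightarrow> real) \<Rightarrow> (nat \<Rightarrow> real) measure" where
  "iid_law f = PiM {1..} (\<lambda>_. density lborel (\<lambda>x. ennreal (f x)))"

text \<open>Non-arithmetic: not concentrated on a set \<open>d\<int>\<close> with \<open>d > 0\<close> (no shift allowed).\<close>

definition non_arithmetic :: "real measure \<Rightarrow> bool" where
  "non_arithmetic D \<longleftrightarrow> \<not> (\<exists>d>0. AE x in D. \<exists>n::int. x = d * of_int n)"

definition random_walk :: "(nat \<Rightarrow> real) \<Rightarrow> nat \<Rightarrow> real" where
  "random_walk z n = (\<Sum>k=1..n. z k)"

definition ladder_epoch :: "(nat \<Rightarrow> real) \<Rightarrow> enat" where
  "ladder_epoch z = (INF n\<in>{n. 1 \<le> n \<and> 0 < random_walk z n}. enat n)"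

definition ladder_height :: "(nat \<Rightarrow> real) \<Rightarrow> real" where
  "ladder_height z = (case ladder_epoch z of enat n \<Rightarrow> random_walk z n | \<infinity> \<Rightarrow> 0)"

primrec cusum :: "(nat \<Rightarrow> real) \<Rightarrow> nat \<Rightarrow> real" where
  "cusum z 0 = 0"
| "cusum z (Suc k) = max 0 (cusum z k + z (Suc k))"

definition detection_time :: "(nat \<Rightarrow> real) \<Rightarrow> real \<Rightarrow> enat" where
  "detection_time z h = (INF n\<in>{n. 1 \<le> n \<and> h < cusum z n}. enat n)"

text \<open>
  Battery level in slot \<open>k \<ge> 1\<close>, for sensing energy \<open>Es\<close>, initial level \<open>b\<close> (the level in
  slot 1) and harvested energies \<open>\<eta> 1, \<eta> 2, \<dots>\<close>.
\<close>

fun battery :: "real \<Rightarrow> real \<Rightarrow> (nat \<Rightarrow> real) \<Rightarrow> nat \<Rightarrow> real" where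
  "battery Es b \<eta> 0 = b"
| "battery Es b \<eta> (Suc 0) = b"
| "battery Es b \<eta> (Suc (Suc k)) = battery Es b \<eta> (Suc k) + \<eta> (Suc k)
     - (if battery Es b \<eta> (Suc k) > Es then Es else 0)"

definition sensing_slots :: "real \<Rightarrow> real \<Rightarrow> (nat \<Rightarrow> real) \<Rightarrow> nat set" where
  "sensing_slots Es b \<eta> = {k. 1 \<le> k \<and> Es < battery Es b \<eta> k}"

text \<open>
  The \<open>n\<close>-th sample (\<open>n \<ge> 1\<close>) that the sensor takes when \<open>x k\<close> is the sample available in
  slot \<open>k\<close>.  \<^const>\<open>enumerate\<close> counts from 0.
\<close>

definition observed :: "real \<Rightarrow> real \<Rightarrow> (nat \<Rightarrow> real) \<Rightarrow> (nat \<Rightarrow> real) \<Rightarrow> nat \<Rightarrow> real" where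
  "observed Es b \<eta> x n = x (enumerate (sensing_slots Es b \<eta>) (n - 1))"

text \<open>
  The asymptotic expression for the average detection delay.  Its arguments involve neither the
  energy process nor its mean.
\<close>

definition delay_expansion :: "(real \<Rightarrow> real) \<Rightarrow> (real \<Rightarrow> real) \<Rightarrow> real \<Rightarrow> real" where
  "delay_expansion f0 f1 h =
     1 / KL_info f0 f1 *
       (h + (\<integral>x. (ladder_height (\<lambda>k. llr f0 f1 (x k)))\<^sup>2 \<partial>iid_law f1) /
            (\<integral>x. ladder_height (\<lambda>k. llr f0 f1 (x k)) \<partial>iid_law f1)
          - (\<integral>x. (llr f0 f1 (x 1))\<^sup>2 \<partial>iid_law f1) / (2 * KL_info f0 f1))"

end

theory Submission imports Defs begin

text \<open>
  Let \<open>V\<close> be the occupation measure of the walk \<open>S\<close> before \<open>T\<^sub>+\<close>, a finite measure on \<open>(-\<infinity>, 0]\<close>, and \<open>\<eta>\<close>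
  the law of the ladder height.  The Markov property at each step gives Dynkin's identity
  \<open>\<integral> V(dv) E f(v + Z) + f 0 = \<integral> f dV + \<integral> f d\<eta>\<close>, from which everything is derived:

  \<^item> \<open>f(u) = (u + n)\<^sup>+\<close> and \<open>f(u) = ((u + n)\<^sup>+)\<^sup>2\<close> with \<open>n \<rightarrow> \<infinity>\<close> give \<open>E S\<^sub>T = I |V|\<close> and
    \<open>E S\<^sub>T\<^sup>2 = 2 I \<integral> v dV + |V| E Z\<^sup>2\<close>.
  \<^item> \<open>A(x) = V[-x, 0]\<close> is harmonic for the walk killed below 0, and its integral \<open>B\<close>, normalised by
    \<open>E S\<^sub>T\<close>, satisfies \<open>E B(w + Z) = B w + 1\<close> for \<open>w \<ge> 0\<close> and \<open>B = 0\<close> on \<open>(-\<infinity>, 0]\<close>.  So \<open>B\<close> does not notice the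
    reflection of \<open>W\<close> at 0, and \<open>E \<tau> = E B(W\<^sub>\<tau>) = (E W\<^sub>\<tau> + \<integral> v dV / |V|) / I + o(1)\<close>.
  \<^item> The mean overshoot \<open>r(x)\<close> of the walk over \<open>x\<close> satisfies \<open>r(x) = E r(x - Z)\<close> for \<open>x \<ge> 0\<close> and tends
    to \<open>\<kappa> = E S\<^sub>T\<^sup>2 / (2 E S\<^sub>T)\<close>; here the non-arithmetic law enters.
  \<^item> Since the expected number of resets of \<open>W\<close> to 0 is bounded by \<open>|V|\<close>, Dynkin's identity for \<open>W\<close> and
    \<open>w \<mapsto> r(h - w)\<close> shows \<open>E W\<^sub>\<tau> - h - r(h) \<rightarrow> 0\<close>.

  The slots in which the sensor is active depend only on the harvested energies, which are independent
  of the samples.  Hence the observed samples are again i.i.d., and the delay has the same law as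
  without energy constraints.
\<close>

section \<open>Occupation measures of driven Markov chains\<close>

text \<open>The limit of \<open>r\<close> is a renewal theorem in disguise, and it shapes the middle
  of the proof. Harmonicity for steps \<open>Z\<close> yields, by a Choquet-Deny argument, that
  averages of \<open>r\<close> over windows become translation invariant; windows are used because
  the argument asks for a Lipschitz function, while \<open>r\<close> is only known to satisfy
  \<open>r x \<le> r y + (y - x)\<close> for \<open>x \<le> y\<close>. Flatness gives neither
  existence nor value of the limit. Both come from a second equation, in which \<open>r\<close> is
  harmonic for the ladder heights as steps: these are positive, so integrating it over
  \<open>[0, x]\<close> leaves no boundary term, and its source integrates to
  \<open>E S_T^2 / 2\<close> in the limit. The one-sided bound then leads back from averages to
  \<open>r\<close>.

  The constant has two halves: \<open>\<kappa>\<close> is one half of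
  \<open>E S_T^2 / E S_T\<close>, and the moment identities turn
  \<open>\<integral> v dV / |V|\<close> into the other half minus \<open>E Z^2 / (2 I)\<close>.

  Dynkin's identity is stated in \<open>[0, \<infinity>]\<close>, where it holds without
  integrability; in exchange each term to be cancelled must first be shown finite.\<close>

lemma (in prob_space) nn_integral_indep_var:
  assumes indep: "indep_var S X T Y"
    and f[measurable]: "f \<in> borel_measurable (S \<Otimes>\<^sub>M T)"
  shows "(\<integral>\<^sup>+\<omega>. f (X \<omega>, Y \<omega>) \<partial>M) = (\<integral>\<^sup>+\<omega>. (\<integral>\<^sup>+y. f (X \<omega>, y) \<partial>distr M T Y) \<partial>M)"
proof -
  have [measurable]: "X \<in> measurable M S" "Y \<in> measurable M T"
    and eq: "distr M S X \<Otimes>\<^sub>M distr M T Y = distr M (S \<Otimes>\<^sub>M T) (\<lambda>x. (X x, Y x))"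
    using indep unfolding indep_var_distribution_eq by auto
  interpret Y: prob_space "distr M T Y" by (rule prob_space_distr) simp
  have [measurable]: "(\<lambda>x. \<integral>\<^sup>+y. f (x, y) \<partial>distr M T Y) \<in> borel_measurable S"
    by measurable
  have "(\<integral>\<^sup>+\<omega>. f (X \<omega>, Y \<omega>) \<partial>M) = (\<integral>\<^sup>+p. f p \<partial>distr M (S \<Otimes>\<^sub>M T) (\<lambda>x. (X x, Y x)))"
    by (simp add: nn_integral_distr)
  also have "\<dots> = (\<integral>\<^sup>+x. \<integral>\<^sup>+y. f (x, y) \<partial>distr M T Y \<partial>distr M S X)"
    unfolding eq[symmetric] by (subst Y.nn_integral_fst[symmetric]) auto
  also have "\<dots> = (\<integral>\<^sup>+\<omega>. (\<integral>\<^sup>+y. f (X \<omega>, y) \<partial>distr M T Y) \<partial>M)"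
    by (subst nn_integral_distr) auto
  finally show ?thesis .
qed

text \<open>Serves both the law of \<open>Z\<close> and the harvested energy. If \<open>f\<close>
  exceeded each level \<open>1 / Suc n\<close> on a null set only, it would be nonpositive almost
  everywhere.\<close>

lemma (in finite_measure) integral_pos_imp_level:
  fixes f :: "'a \<Rightarrow> real"
  assumes [measurable]: "f \<in> borel_measurable M" and pos: "0 < (\<integral>x. f x \<partial>M)"
  shows "\<exists>\<epsilon>>0. 0 < measure M {x\<in>space M. \<epsilon> < f x}"
proof (rule ccontr)
  assume no: "\<not> ?thesis"
  have "AE x in M. \<not> 1 / real (Suc n) < f x" for n
  proof -
    have "\<not> 0 < measure M {x\<in>space M. 1 / real (Suc n) < f x}"
      using no of_nat_0_less_iff[of "Suc n"] zero_less_divide_1_iff by blast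
    then have "measure M {x\<in>space M. 1 / real (Suc n) < f x} = 0" by (simp add: zero_less_measure_iff)
    then show ?thesis by (subst AE_iff_measurable[OF _ refl]) (auto simp: emeasure_eq_measure)
  qed
  then have "AE x in M. \<forall>n. \<not> 1 / real (Suc n) < f x" by (simp add: AE_all_countable)
  then have "AE x in M. f x \<le> 0"
  proof eventually_elim
    fix x assume "\<forall>n. \<not> 1 / real (Suc n) < f x"
    then show "f x \<le> 0" using reals_Archimedean[of "f x"] by (metis inverse_eq_divide not_less)
  qed
  then have "0 \<le> (\<integral>x. - f x \<partial>M)" by (intro integral_nonneg_AE) auto
  then show False using pos by simp
qed

lemma tendsto_at_top_const:
  fixes f :: "'a::linorder \<Rightarrow> 'b::topological_space"
  shows "(\<And>x. N \<le> x \<Longrightarrow> f x = l) \<Longrightarrow> (f \<longlongrightarrow> l) at_top"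
  by (rule tendsto_eventually) (rule eventually_at_top_linorderI)

text \<open>Covers the walk, with \<open>F = (+)\<close>, and the CUSUM recursion, with
  \<open>F w z = max 0 (w + z)\<close>, so that occupation measures are treated once for
  both.\<close>

primrec chain :: "(real \<Rightarrow> real \<Rightarrow> real) \<Rightarrow> real \<Rightarrow> (nat \<Rightarrow> real) \<Rightarrow> nat \<Rightarrow> real" where
  "chain F w z 0 = w"
| "chain F w z (Suc n) = F (chain F w z n) (z (Suc n))"

lemma chain_cong: "(\<And>k. k \<in> {1..n} \<Longrightarrow> z k = z' k) \<Longrightarrow> chain F w z n = chain F w z' n"
  by (induction n) auto

locale driven_chain = prob_space M for M :: "'a measure" +
  fixes Z :: "nat \<Rightarrow> 'a \<Rightarrow> real" and \<nu> :: "real measure"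
    and F :: "real \<Rightarrow> real \<Rightarrow> real" and w0 :: real and D :: "real set"
  assumes indep: "indep_vars (\<lambda>_. borel) Z {1..}"
    and distr_Z: "\<And>k. 1 \<le> k \<Longrightarrow> distr M borel (Z k) = \<nu>"
    and F_measurable: "(\<lambda>p. F (fst p) (snd p)) \<in> borel_measurable (borel \<Otimes>\<^sub>M borel)"
    and D_sets: "D \<in> sets borel"
begin

definition W :: "nat \<Rightarrow> 'a \<Rightarrow> real" where
  "W n \<omega> = chain F w0 (\<lambda>k. Z k \<omega>) n"

text \<open>Survival is tested from time 1 on, because both stopping times are infima over
  \<open>n \<ge> 1\<close>; \<open>alive n\<close> is the event that the exit time exceeds
  \<open>n\<close>.\<close>

definition alive :: "nat \<Rightarrow> 'a set" where
  "alive n = {\<omega>\<in>space M. \<forall>k\<in>{1..n}. W k \<omega> \<in> D}"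

text \<open>The sum over \<open>n\<close> of the laws of \<open>W (n + k)\<close> on the events
  \<open>E n\<close>. Taking the image of a density on time times probability space makes it a
  measure by construction.\<close>

definition path_law :: "nat \<Rightarrow> (nat \<Rightarrow> 'a set) \<Rightarrow> real measure" where
  "path_law k E = distr (density (count_space UNIV \<Otimes>\<^sub>M M) (\<lambda>p. indicator (E (fst p)) (snd p)))
     borel (\<lambda>p. W (fst p + k) (snd p))"

definition occ :: "real measure" where "occ = path_law 0 alive"
definition exit_law :: "real measure" where "exit_law = path_law 1 (\<lambda>n. alive n - alive (Suc n))"

lemma W_0 [simp]: "W 0 \<omega> = w0" and W_Suc: "W (Suc n) \<omega> = F (W n \<omega>) (Z (Suc n) \<omega>)"
  by (simp_all add: W_def)

lemma Z_measurable [measurable]: "Z (Suc k) \<in> borel_measurable M"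
  using indep unfolding indep_vars_def2 by auto

lemma prob_space_\<nu>: "prob_space \<nu>" and sets_\<nu> [simp, measurable_cong]: "sets \<nu> = sets borel"
  and space_\<nu> [simp]: "space \<nu> = UNIV"
  using prob_space_distr[OF Z_measurable[of 0]] distr_Z[of 1] by (auto simp flip: distr_Z[of 1])

lemma F_comp_measurable [measurable (raw)]:
  assumes [measurable]: "u \<in> borel_measurable N" "v \<in> borel_measurable N"
  shows "(\<lambda>x. F (u x) (v x)) \<in> borel_measurable N"
proof -
  have "(\<lambda>x. F (fst (u x, v x)) (snd (u x, v x))) \<in> borel_measurable N"
    by (rule measurable_compose[OF _ F_measurable]) simp
  then show ?thesis by simp
qed

lemma W_measurable [measurable]: "W n \<in> borel_measurable M"
proof (induction n)
  case 0
  have "W 0 = (\<lambda>_. w0)" by auto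
  then show ?case by simp
qed (simp add: W_Suc[abs_def])

lemma alive_sets [measurable]: "alive n \<in> sets M"
  using D_sets unfolding alive_def by measurable

lemma alive_0: "alive 0 = space M"
  and alive_Suc: "alive (Suc n) = {\<omega>\<in>alive n. W (Suc n) \<omega> \<in> D}"
  by (auto simp: alive_def atLeastAtMostSuc_conv)

lemma nn_integral_path_law:
  assumes [measurable]: "f \<in> borel_measurable borel" "\<And>n. E n \<in> sets M"
  shows "(\<integral>\<^sup>+w. f w \<partial>path_law k E) = (\<Sum>n. \<integral>\<^sup>+\<omega>. indicator (E n) \<omega> * f (W (n + k) \<omega>) \<partial>M)"
proof -
  have [measurable]: "(\<lambda>p. W (fst p + k) (snd p)) \<in> borel_measurable (count_space UNIV \<Otimes>\<^sub>M M)"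
    "(\<lambda>p. indicator (E (fst p)) (snd p) :: ennreal) \<in> borel_measurable (count_space UNIV \<Otimes>\<^sub>M M)"
    by (rule measurable_pair_measure_countable1; auto)+
  have "(\<integral>\<^sup>+w. f w \<partial>path_law k E) =
      (\<integral>\<^sup>+p. indicator (E (fst p)) (snd p) * f (W (fst p + k) (snd p)) \<partial>(count_space UNIV \<Otimes>\<^sub>M M))"
    unfolding path_law_def by (simp add: nn_integral_distr nn_integral_density)
  also have "\<dots> = (\<integral>\<^sup>+n. \<integral>\<^sup>+\<omega>. indicator (E n) \<omega> * f (W (n + k) \<omega>) \<partial>M \<partial>count_space UNIV)"
    by (subst nn_integral_fst[symmetric]) auto
  finally show ?thesis by (simp add: nn_integral_count_space_nat)
qed

lemma nn_integral_occ:
  "f \<in> borel_measurable borel \<Longrightarrow>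
    (\<integral>\<^sup>+w. f w \<partial>occ) = (\<Sum>n. \<integral>\<^sup>+\<omega>. indicator (alive n) \<omega> * f (W n \<omega>) \<partial>M)"
  unfolding occ_def by (subst nn_integral_path_law) auto

lemma nn_integral_exit_law:
  "f \<in> borel_measurable borel \<Longrightarrow> (\<integral>\<^sup>+w. f w \<partial>exit_law) =
    (\<Sum>n. \<integral>\<^sup>+\<omega>. indicator (alive n - alive (Suc n)) \<omega> * f (W (Suc n) \<omega>) \<partial>M)"
  unfolding exit_law_def by (subst nn_integral_path_law) auto

lemma sets_occ [simp, measurable_cong]: "sets occ = sets borel"
  and sets_exit_law [simp, measurable_cong]: "sets exit_law = sets borel"
  by (simp_all add: occ_def exit_law_def path_law_def)

lemma space_occ [simp]: "space occ = UNIV" and space_exit_law [simp]: "space exit_law = UNIV"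
  by (simp_all add: occ_def exit_law_def path_law_def)

text \<open>The Markov property at time \<open>n\<close>: survival and \<open>W n\<close> are
  functions of the first \<open>n\<close> inputs, which are independent of \<open>Z (Suc n)\<close>.
  Most of the proof rewrites them as functions of the restricted tuple, on which
  \<open>nn_integral_indep_var\<close> can act.\<close>

lemma nn_integral_step:
  assumes [measurable]: "f \<in> borel_measurable borel"
  shows "(\<integral>\<^sup>+\<omega>. indicator (alive n) \<omega> * f (W (Suc n) \<omega>) \<partial>M) =
    (\<integral>\<^sup>+\<omega>. indicator (alive n) \<omega> * (\<integral>\<^sup>+z. f (F (W n \<omega>) z) \<partial>\<nu>) \<partial>M)"
proof -
  interpret \<nu>: prob_space \<nu> by (rule prob_space_\<nu>)
  let ?P = "PiM {1..n} (\<lambda>_. borel :: real measure)"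
  let ?A = "\<lambda>\<omega>. restrict (\<lambda>i. Z i \<omega>) {1..n}"
  have c[measurable]: "(\<lambda>a. chain F w0 a k) \<in> borel_measurable ?P" if "k \<le> n" for k
    using that
  proof (induction k)
    case (Suc k)
    have "(\<lambda>a. a (Suc k)) \<in> borel_measurable ?P"
      by (rule measurable_component_singleton) (use Suc in auto)
    then show ?case using Suc by (auto intro!: F_comp_measurable)
  qed simp
  have [measurable]: "{a\<in>space ?P. \<forall>k\<in>{1..n}. chain F w0 a k \<in> D} \<in> sets ?P"
  proof (rule sets.sets_Collect_finite_All)
    fix k assume "k \<in> {1..n}"
    then have "(\<lambda>a. chain F w0 a k) -` D \<inter> space ?P \<in> sets ?P"
      by (intro measurable_sets[OF c D_sets]) auto
    moreover have "(\<lambda>a. chain F w0 a k) -` D \<inter> space ?P = {a\<in>space ?P. chain F w0 a k \<in> D}"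
      by auto
    ultimately show "{a\<in>space ?P. chain F w0 a k \<in> D} \<in> sets ?P" by simp
  qed simp
  let ?I = "\<lambda>a. indicator {a\<in>space ?P. \<forall>k\<in>{1..n}. chain F w0 a k \<in> D} a :: ennreal"
  let ?g = "\<lambda>p. ?I (fst p) * f (F (chain F w0 (fst p) n) (snd p))"
  have "(\<lambda>p. F (chain F w0 (fst p) n) (snd p)) \<in> borel_measurable (?P \<Otimes>\<^sub>M borel)"
    by (rule F_comp_measurable[OF measurable_compose[OF measurable_fst c[OF order_refl]] measurable_snd])
  then have [measurable]: "?g \<in> borel_measurable (?P \<Otimes>\<^sub>M borel)" by measurable
  have ch: "chain F w0 (?A \<omega>) k = W k \<omega>" if "k \<le> n" for k \<omega>
    unfolding W_def by (rule chain_cong) (use that in auto)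
  have I: "?I (?A \<omega>) = indicator (alive n) \<omega>" if "\<omega> \<in> space M" for \<omega>
    using that ch by (auto simp: alive_def indicator_def space_PiM)
  let ?Q = "PiM {Suc n} (\<lambda>_. borel :: real measure)"
  let ?B = "\<lambda>\<omega>. restrict (\<lambda>i. Z i \<omega>) {Suc n}"
  have ind: "indep_var ?P ?A ?Q ?B"
    by (rule indep_var_restrict[OF indep]) auto
  have [measurable]: "?B \<in> measurable M ?Q"
    using ind by (rule indep_var_rv2)
  have [measurable]: "(\<lambda>b. b (Suc n)) \<in> borel_measurable ?Q"
    by (rule measurable_component_singleton) simp
  have g': "(\<lambda>p. ?g (fst p, snd p (Suc n))) \<in> borel_measurable (?P \<Otimes>\<^sub>M ?Q)"
    by measurable
  have "(\<integral>\<^sup>+\<omega>. ?g (?A \<omega>, Z (Suc n) \<omega>) \<partial>M) = (\<integral>\<^sup>+\<omega>. (\<integral>\<^sup>+b. ?g (?A \<omega>, b (Suc n)) \<partial>distr M ?Q ?B) \<partial>M)"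
    using nn_integral_indep_var[OF ind g'] by simp
  also have "\<dots> = (\<integral>\<^sup>+\<omega>. (\<integral>\<^sup>+y. ?g (?A \<omega>, y) \<partial>\<nu>) \<partial>M)"
  proof (rule nn_integral_cong)
    fix \<omega> assume "\<omega> \<in> space M"
    then have "?A \<omega> \<in> space ?P" by (auto simp: space_PiM)
    then have g: "(\<lambda>y. ?g (?A \<omega>, y)) \<in> borel_measurable borel" by measurable
    define h where "h y = ?g (?A \<omega>, y)" for y
    have [measurable]: "h \<in> borel_measurable borel" using g by (simp only: h_def[abs_def])
    have "(\<integral>\<^sup>+b. h (b (Suc n)) \<partial>distr M ?Q ?B) = (\<integral>\<^sup>+\<omega>. h (Z (Suc n) \<omega>) \<partial>M)"
      by (simp add: nn_integral_distr)
    also have "\<dots> = (\<integral>\<^sup>+y. h y \<partial>distr M borel (Z (Suc n)))"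
      by (simp add: nn_integral_distr)
    finally show "(\<integral>\<^sup>+b. ?g (?A \<omega>, b (Suc n)) \<partial>distr M ?Q ?B) = (\<integral>\<^sup>+y. ?g (?A \<omega>, y) \<partial>\<nu>)"
      by (simp only: h_def distr_Z le_add1 plus_1_eq_Suc[symmetric])
  qed
  finally have "(\<integral>\<^sup>+\<omega>. ?g (?A \<omega>, Z (Suc n) \<omega>) \<partial>M) = (\<integral>\<^sup>+\<omega>. (\<integral>\<^sup>+y. ?g (?A \<omega>, y) \<partial>\<nu>) \<partial>M)" .
  moreover have "(\<integral>\<^sup>+\<omega>. ?g (?A \<omega>, Z (Suc n) \<omega>) \<partial>M) = (\<integral>\<^sup>+\<omega>. indicator (alive n) \<omega> * f (W (Suc n) \<omega>) \<partial>M)"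
    by (rule nn_integral_cong) (simp only: fst_conv snd_conv I ch W_Suc order_refl)
  moreover have "(\<integral>\<^sup>+\<omega>. (\<integral>\<^sup>+y. ?g (?A \<omega>, y) \<partial>\<nu>) \<partial>M) =
      (\<integral>\<^sup>+\<omega>. indicator (alive n) \<omega> * (\<integral>\<^sup>+z. f (F (W n \<omega>) z) \<partial>\<nu>) \<partial>M)"
  proof (rule nn_integral_cong)
    fix \<omega> assume w: "\<omega> \<in> space M"
    show "(\<integral>\<^sup>+y. ?g (?A \<omega>, y) \<partial>\<nu>) = indicator (alive n) \<omega> * (\<integral>\<^sup>+z. f (F (W n \<omega>) z) \<partial>\<nu>)"
      by (simp only: fst_conv snd_conv I[OF w] ch order_refl)
        (cases "\<omega> \<in> alive n"; simp)
  qed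
  ultimately show ?thesis by simp
qed

lemma nn_integral_alive_0: "(\<integral>\<^sup>+\<omega>. indicator (alive 0) \<omega> * f (W 0 \<omega>) \<partial>M) = f w0"
proof -
  have "(\<integral>\<^sup>+\<omega>. indicator (alive 0) \<omega> * f (W 0 \<omega>) \<partial>M) = (\<integral>\<^sup>+\<omega>. f w0 \<partial>M)"
    by (rule nn_integral_cong) (simp add: alive_0)
  then show ?thesis by (simp add: emeasure_space_1)
qed

text \<open>A step from \<open>alive n\<close> either survives or exits. Summed over
  \<open>n\<close>, this gives the occupation measure without its term at time 0, plus the exit law;
  adding \<open>f w0\<close> restores that term. Nothing is subtracted, so infinite integrals are
  allowed.\<close>

lemma dynkin:
  assumes [measurable]: "f \<in> borel_measurable borel"
  shows "(\<integral>\<^sup>+w. (\<integral>\<^sup>+z. f (F w z) \<partial>\<nu>) \<partial>occ) + f w0 = (\<integral>\<^sup>+w. f w \<partial>occ) + (\<integral>\<^sup>+w. f w \<partial>exit_law)"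
proof -
  interpret \<nu>: prob_space \<nu> by (rule prob_space_\<nu>)
  let ?a = "\<lambda>n. \<integral>\<^sup>+\<omega>. indicator (alive n) \<omega> * f (W n \<omega>) \<partial>M"
  let ?b = "\<lambda>n. \<integral>\<^sup>+\<omega>. indicator (alive n - alive (Suc n)) \<omega> * f (W (Suc n) \<omega>) \<partial>M"
  let ?c = "\<lambda>n. \<integral>\<^sup>+\<omega>. indicator (alive n) \<omega> * (\<integral>\<^sup>+z. f (F (W n \<omega>) z) \<partial>\<nu>) \<partial>M"
  have step: "?c n = ?a (Suc n) + ?b n" for n
  proof -
    have "?a (Suc n) + ?b n = (\<integral>\<^sup>+\<omega>. indicator (alive (Suc n)) \<omega> * f (W (Suc n) \<omega>) +
        indicator (alive n - alive (Suc n)) \<omega> * f (W (Suc n) \<omega>) \<partial>M)"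
      by (rule nn_integral_add[symmetric]) measurable
    also have "\<dots> = (\<integral>\<^sup>+\<omega>. indicator (alive n) \<omega> * f (W (Suc n) \<omega>) \<partial>M)"
      by (rule nn_integral_cong) (auto simp: alive_Suc indicator_def)
    finally show ?thesis using nn_integral_step[of f n] by simp
  qed
  have a0: "?a 0 = f w0" by (rule nn_integral_alive_0)
  define a b where "a n = ?a n" and "b n = ?b n" for n
  have "(\<integral>\<^sup>+w. (\<integral>\<^sup>+z. f (F w z) \<partial>\<nu>) \<partial>occ) = (\<Sum>n. ?c n)"
    by (rule nn_integral_occ) measurable
  also have "\<dots> = (\<Sum>n. a (Suc n) + b n)"
    by (simp only: step a_def b_def)
  also have "\<dots> = (\<Sum>n. a (Suc n)) + (\<Sum>n. b n)"
    by (rule suminf_add[OF summableI summableI, symmetric])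
  also have "\<dots> + f w0 = ((\<Sum>n. a (Suc n)) + a 0) + (\<Sum>n. b n)"
    using a0 by (simp only: a_def[of 0] ac_simps)
  also have "(\<Sum>n. a (Suc n)) + a 0 = (\<Sum>n. a n)"
    using sums_Suc[OF summable_sums[OF summableI, of "\<lambda>n. a (Suc n)"]] by (rule sums_unique)
  finally show ?thesis by (simp add: nn_integral_occ nn_integral_exit_law a_def b_def)
qed

text \<open>The Foster-Lyapunov criterion, with \<open>emeasure occ UNIV\<close> as mean exit time:
  each step spends at least \<open>\<delta>\<close> of the initial budget \<open>f w0\<close>. The
  premise \<open>w0 \<in> D\<close> makes the drift condition available at time 0, which
  \<open>alive\<close> does not test.\<close>

lemma emeasure_occ_le_Lyapunov:
  fixes f :: "real \<Rightarrow> ennreal"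
  assumes [measurable]: "f \<in> borel_measurable borel" and w0: "w0 \<in> D"
    and drift: "\<And>w. w \<in> D \<Longrightarrow> (\<integral>\<^sup>+z. f (F w z) \<partial>\<nu>) + \<delta> \<le> f w"
  shows "\<delta> * emeasure occ UNIV \<le> f w0"
proof -
  interpret \<nu>: prob_space \<nu> by (rule prob_space_\<nu>)
  let ?a = "\<lambda>n. \<integral>\<^sup>+\<omega>. indicator (alive n) \<omega> * f (W n \<omega>) \<partial>M"
  have WD: "W n \<omega> \<in> D" if "\<omega> \<in> alive n" for n \<omega>
    using that w0 by (cases n) (auto simp: alive_def)
  have step: "?a (Suc n) + \<delta> * emeasure M (alive n) \<le> ?a n" for n
  proof -
    have "?a (Suc n) \<le> (\<integral>\<^sup>+\<omega>. indicator (alive n) \<omega> * f (W (Suc n) \<omega>) \<partial>M)"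
      by (rule nn_integral_mono) (auto simp: alive_Suc indicator_def)
    also have "\<dots> = (\<integral>\<^sup>+\<omega>. indicator (alive n) \<omega> * (\<integral>\<^sup>+z. f (F (W n \<omega>) z) \<partial>\<nu>) \<partial>M)"
      by (rule nn_integral_step) measurable
    finally have "?a (Suc n) + \<delta> * emeasure M (alive n) \<le> \<dots> + (\<integral>\<^sup>+\<omega>. \<delta> * indicator (alive n) \<omega> \<partial>M)"
      by (subst nn_integral_cmult_indicator) (auto intro: add_right_mono)
    also have "\<dots> = (\<integral>\<^sup>+\<omega>. indicator (alive n) \<omega> * (\<integral>\<^sup>+z. f (F (W n \<omega>) z) \<partial>\<nu>) + \<delta> * indicator (alive n) \<omega> \<partial>M)"
      by (rule nn_integral_add[symmetric]) measurable
    also have "\<dots> \<le> ?a n"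
      by (rule nn_integral_mono) (use drift[OF WD] in \<open>auto simp: indicator_def\<close>)
    finally show ?thesis .
  qed
  have a0: "?a 0 = f w0" by (rule nn_integral_alive_0)
  have "?a n + (\<Sum>k<n. \<delta> * emeasure M (alive k)) \<le> f w0" for n
  proof (induction n)
    case (Suc n)
    have "?a (Suc n) + (\<Sum>k<Suc n. \<delta> * emeasure M (alive k)) =
        (?a (Suc n) + \<delta> * emeasure M (alive n)) + (\<Sum>k<n. \<delta> * emeasure M (alive k))"
      by (simp add: ac_simps)
    also have "\<dots> \<le> f w0" using add_right_mono[OF step] Suc by (rule order_trans)
    finally show ?case .
  qed (use a0 in simp)
  then have "(\<Sum>k<n. \<delta> * emeasure M (alive k)) \<le> f w0" for n
    by (rule order_trans[OF add_increasing[OF zero_le order_refl]])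
  then have "(\<Sum>k. \<delta> * emeasure M (alive k)) \<le> f w0"
    by (intro suminf_le_const) auto
  moreover have "emeasure occ UNIV = (\<Sum>k. emeasure M (alive k))"
    using nn_integral_occ[of "\<lambda>_. 1"] by simp
  ultimately show ?thesis by simp
qed

end

section \<open>Moments of the ladder height\<close>

lemma (in pair_sigma_finite) has_bochner_integral_times:
  fixes g :: "'a \<Rightarrow> real" and h :: "'b \<Rightarrow> real"
  assumes g: "integrable M1 g" and h: "integrable M2 h"
  shows "has_bochner_integral (M1 \<Otimes>\<^sub>M M2) (\<lambda>p. g (fst p) * h (snd p)) ((\<integral>x. g x \<partial>M1) * (\<integral>x. h x \<partial>M2))"
proof -
  have [measurable]: "g \<in> borel_measurable M1" "h \<in> borel_measurable M2" using g h by auto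
  have i: "integrable (M1 \<Otimes>\<^sub>M M2) (\<lambda>p. g (fst p) * h (snd p))"
    by (rule Fubini_integrable) (use g h in \<open>auto simp: abs_mult\<close>)
  have "(\<integral>p. g (fst p) * h (snd p) \<partial>(M1 \<Otimes>\<^sub>M M2)) = (\<integral>x. \<integral>y. g x * h y \<partial>M2 \<partial>M1)"
    using integral_fst'[OF i] by simp
  then show ?thesis using i by (simp add: has_bochner_integral_iff)
qed

definition pos2 :: "real \<Rightarrow> real" where "pos2 x = (max 0 x)\<^sup>2"

lemma pos2_measurable [measurable]: "pos2 \<in> borel_measurable borel"
  unfolding pos2_def[abs_def] by measurable

lemma pos2_nonneg [simp]: "0 \<le> pos2 x" and pos2_le: "pos2 x \<le> x\<^sup>2"
  by (auto simp: pos2_def max_def)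

lemma pos2_add_le: "pos2 (x + z) \<le> pos2 x + 2 * max 0 x * z + z\<^sup>2"
proof -
  have "max 0 (x + z) \<le> \<bar>max 0 x + z\<bar>" by (auto simp: max_def)
  then have "pos2 (x + z) \<le> (max 0 x + z)\<^sup>2"
    unfolding pos2_def by (metis abs_ge_zero max.cobounded1 power_mono power2_abs)
  then show ?thesis by (simp add: pos2_def power2_eq_square algebra_simps)
qed

text \<open>Apart from the non-arithmetic law, all that the analysis uses of the walk. In terms of
  convolution the last assumption reads \<open>V * \<nu> + \<delta>_0 = V + \<eta>\<close>, a
  Wiener-Hopf factorisation: \<open>V\<close> lives on the nonpositive and \<open>\<eta>\<close> on
  the positive half-line.\<close>

locale ladder_factor = \<nu>: prob_space \<nu> + V: finite_measure V
  for \<nu> V :: "real measure" +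
  fixes \<eta> :: "real measure"
  assumes sets_\<nu> [simp, measurable_cong]: "sets \<nu> = sets borel"
    and sets_V [simp, measurable_cong]: "sets V = sets borel"
    and sets_\<eta> [simp, measurable_cong]: "sets \<eta> = sets borel"
    and square_integrable: "integrable \<nu> (\<lambda>z. z\<^sup>2)"
    and drift_pos: "0 < (\<integral>z. z \<partial>\<nu>)"
    and V_nonpos: "AE v in V. v \<le> 0"
    and \<eta>_pos: "AE y in \<eta>. 0 < y"
    and dynkin: "\<And>f :: real \<Rightarrow> ennreal. f \<in> borel_measurable borel \<Longrightarrow>
      (\<integral>\<^sup>+v. (\<integral>\<^sup>+z. f (v + z) \<partial>\<nu>) \<partial>V) + f 0 = (\<integral>\<^sup>+v. f v \<partial>V) + (\<integral>\<^sup>+y. f y \<partial>\<eta>)"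
begin

definition I :: real where "I = (\<integral>z. z \<partial>\<nu>)"
definition c :: real where "c = measure V UNIV"

lemma I_pos: "0 < I" using drift_pos by (simp add: I_def)

sublocale pair_sigma_finite V \<nu> ..

lemma space_simps [simp]: "space \<nu> = UNIV" "space V = UNIV" "space \<eta> = UNIV"
  using sets_eq_imp_space_eq[OF sets_\<nu>] sets_eq_imp_space_eq[OF sets_V] sets_eq_imp_space_eq[OF sets_\<eta>] by auto

lemma borel_measurable_cong [simp]: "borel_measurable \<nu> = borel_measurable borel"
  "borel_measurable V = borel_measurable borel" "borel_measurable \<eta> = borel_measurable borel"
  by (auto intro!: measurable_cong_sets)

lemma integrable_\<nu> [simp]: "integrable \<nu> (\<lambda>z. z)"
  by (rule \<nu>.square_integrable_imp_integrable) (use square_integrable in auto)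

lemma emeasure_V: "emeasure V UNIV = ennreal c"
  by (simp add: c_def V.emeasure_eq_measure)

sublocale \<eta>: prob_space \<eta>
proof
  have "ennreal c + 1 = ennreal c + emeasure \<eta> (space \<eta>)"
    using dynkin[of "\<lambda>_. 1"] \<nu>.emeasure_space_1 by (simp add: emeasure_V)
  then show "emeasure \<eta> (space \<eta>) = 1"
    by (simp add: ennreal_add_left_cancel)
qed

text \<open>The visit at time 0, extracted by the indicator of \<open>{0}\<close>, which
  \<open>\<eta>\<close> does not charge.\<close>

lemma measure_V_0: "1 \<le> measure V {0}"
proof -
  have "(\<integral>\<^sup>+y. indicator {0} y \<partial>\<eta>) = 0"
    by (subst nn_integral_0_iff_AE) (use \<eta>_pos in auto)
  then have "(\<integral>\<^sup>+v. (\<integral>\<^sup>+z. indicator {0} (v + z) \<partial>\<nu>) \<partial>V) + 1 = emeasure V {0}"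
    using dynkin[of "indicator {0}"] by simp
  then have "1 \<le> emeasure V {0}" by (metis add_increasing zero_le order_refl)
  then show ?thesis by (simp add: V.emeasure_eq_measure)
qed

lemma c_ge_1: "1 \<le> c"
  unfolding c_def by (rule order_trans[OF measure_V_0]) (rule V.finite_measure_mono, auto)

section \<open>Wald's two identities by truncation\<close>

abbreviation "VN \<equiv> V \<Otimes>\<^sub>M \<nu>"

text \<open>Dynkin's identity in subtracted form. As a single integral of increments it admits
  dominated convergence for truncations of \<open>u\<close> and \<open>u^2\<close>, whose increments
  stay under control while the functions themselves grow.\<close>

lemma wald:
  fixes f :: "real \<Rightarrow> real"
  assumes [measurable]: "f \<in> borel_measurable borel" and f0: "\<And>x. 0 \<le> f x"
    and V: "integrable V f" and \<eta>: "integrable \<eta> f"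
  shows "integrable VN (\<lambda>p. f (fst p + snd p))"
    and "integrable VN (\<lambda>p. f (fst p))"
    and "(\<integral>p. f (fst p + snd p) - f (fst p) \<partial>VN) = (\<integral>y. f y \<partial>\<eta>) - f 0"
proof -
  have eq: "(\<integral>\<^sup>+p. ennreal (f (fst p + snd p)) \<partial>VN) + ennreal (f 0) =
      ennreal (\<integral>v. f v \<partial>V) + ennreal (\<integral>y. f y \<partial>\<eta>)"
    using dynkin[of "\<lambda>x. ennreal (f x)"] f0
    by (subst \<nu>.nn_integral_fst[symmetric]) (auto simp: nn_integral_eq_integral[OF V] nn_integral_eq_integral[OF \<eta>])
  have fin: "(\<integral>\<^sup>+p. ennreal (f (fst p + snd p)) \<partial>VN) < \<infinity>"
  proof -
    have "(\<integral>\<^sup>+p. ennreal (f (fst p + snd p)) \<partial>VN) \<le> ennreal (\<integral>v. f v \<partial>V) + ennreal (\<integral>y. f y \<partial>\<eta>)"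
      unfolding eq[symmetric] by simp
    also have "\<dots> < \<infinity>" by simp
    finally show ?thesis .
  qed
  show i1: "integrable VN (\<lambda>p. f (fst p + snd p))"
    by (rule integrableI_nonneg) (use f0 fin in auto)
  have h: "has_bochner_integral VN (\<lambda>p. f (fst p)) (\<integral>v. f v \<partial>V)"
    using has_bochner_integral_times[OF V, of "\<lambda>_. 1"] \<nu>.prob_space by simp
  then show i2: "integrable VN (\<lambda>p. f (fst p))" by (simp add: has_bochner_integral_iff)
  have "ennreal (\<integral>p. f (fst p + snd p) \<partial>VN) + ennreal (f 0) =
      ennreal (\<integral>v. f v \<partial>V) + ennreal (\<integral>y. f y \<partial>\<eta>)"
    using eq f0 by (subst (asm) nn_integral_eq_integral[OF i1]) auto
  then have "(\<integral>p. f (fst p + snd p) \<partial>VN) + f 0 = (\<integral>v. f v \<partial>V) + (\<integral>y. f y \<partial>\<eta>)"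
    using f0 by (simp flip: ennreal_plus add: integral_nonneg_AE ennreal_inj del: ennreal_plus)
  then show "(\<integral>p. f (fst p + snd p) - f (fst p) \<partial>VN) = (\<integral>y. f y \<partial>\<eta>) - f 0"
    using h i1 i2 by (simp add: has_bochner_integral_iff)
qed

lemma has_bochner_integral_snd_\<nu>:
  assumes "integrable \<nu> (h :: real \<Rightarrow> real)"
  shows "has_bochner_integral VN (\<lambda>p. h (snd p)) (c * (\<integral>z. h z \<partial>\<nu>))"
  using has_bochner_integral_times[of "\<lambda>_. 1", OF _ assms] by (simp add: c_def)

text \<open>From \<open>v \<le> 0\<close> a step \<open>z\<close> lands at height at most
  \<open>\<bar>z\<bar>\<close>, so the finite mass of \<open>V\<close> bounds the second moment of
  the ladder height by a multiple of that of \<open>Z\<close>.\<close>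

lemma integrable_\<eta>_square: "integrable \<eta> (\<lambda>y. y\<^sup>2)"
proof -
  have "(\<integral>\<^sup>+y. ennreal (pos2 y) \<partial>\<eta>) \<le> (\<integral>\<^sup>+v. ennreal (pos2 v) \<partial>V) + (\<integral>\<^sup>+y. ennreal (pos2 y) \<partial>\<eta>)"
    by simp
  also have "\<dots> = (\<integral>\<^sup>+v. (\<integral>\<^sup>+z. ennreal (pos2 (v + z)) \<partial>\<nu>) \<partial>V)"
    using dynkin[of "\<lambda>x. ennreal (pos2 x)"] by (simp add: pos2_def)
  also have "\<dots> \<le> (\<integral>\<^sup>+v. (\<integral>\<^sup>+z. ennreal (z\<^sup>2) \<partial>\<nu>) \<partial>V)"
  proof (rule nn_integral_mono_AE)
    show "AE v in V. (\<integral>\<^sup>+z. ennreal (pos2 (v + z)) \<partial>\<nu>) \<le> (\<integral>\<^sup>+z. ennreal (z\<^sup>2) \<partial>\<nu>)"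
      using V_nonpos
    proof eventually_elim
      fix v :: real assume "v \<le> 0"
      then have "pos2 (v + z) \<le> z\<^sup>2" for z
        using power_mono[of "max 0 (v + z)" "\<bar>z\<bar>" 2] by (auto simp: pos2_def max_def)
      then show "(\<integral>\<^sup>+z. ennreal (pos2 (v + z)) \<partial>\<nu>) \<le> (\<integral>\<^sup>+z. ennreal (z\<^sup>2) \<partial>\<nu>)"
        by (intro nn_integral_mono) (auto intro: ennreal_leI)
    qed
  qed
  also have "\<dots> < \<infinity>"
    by (simp add: emeasure_V nn_integral_eq_integral[OF square_integrable] ennreal_mult_less_top)
  finally have fin: "(\<integral>\<^sup>+y. ennreal (pos2 y) \<partial>\<eta>) < \<infinity>" .
  have "integrable \<eta> pos2"
    by (rule integrableI_nonneg) (use fin in auto)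
  then show ?thesis
    by (rule Bochner_Integration.integrable_bound) (use \<eta>_pos in \<open>auto simp: pos2_def\<close>)
qed

lemma integrable_\<eta> [simp]: "integrable \<eta> (\<lambda>y. y)"
  by (rule \<eta>.square_integrable_imp_integrable) (use integrable_\<eta>_square in auto)

definition m1 :: real where "m1 = (\<integral>y. y \<partial>\<eta>)"
definition m2 :: real where "m2 = (\<integral>y. y\<^sup>2 \<partial>\<eta>)"
definition E2 :: real where "E2 = (\<integral>z. z\<^sup>2 \<partial>\<nu>)"

lemma integrable_V_bounded:
  assumes "f \<in> borel_measurable borel" "\<And>v. v \<le> 0 \<Longrightarrow> \<bar>f v\<bar> \<le> (K::real)"
  shows "integrable V f"
  by (rule V.integrable_const_bound[where B = K]) (use V_nonpos assms in auto)

text \<open>Wald's first identity. The test function \<open>u\<close> is not admissible, since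
  \<open>V\<close> is not yet known to have a first moment; the increments of
  \<open>max 0 (u + n)\<close> are at most \<open>\<bar>z\<bar>\<close> in size and eventually equal
  to \<open>z\<close>.\<close>

lemma m1_eq: "m1 = I * c"
proof -
  let ?f = "\<lambda>n u. max 0 (u + real n)"
  have w: "integrable VN (\<lambda>p. ?f n (fst p + snd p))" "integrable VN (\<lambda>p. ?f n (fst p))"
    "(\<integral>p. ?f n (fst p + snd p) - ?f n (fst p) \<partial>VN) = m1" for n
  proof -
    have V: "integrable V (?f n)"
      by (rule integrable_V_bounded[where K = n]) auto
    have E: "AE y in \<eta>. ?f n y = y + n" using \<eta>_pos by eventually_elim simp
    have \<eta>: "integrable \<eta> (?f n)"
      by (rule integrable_cong_AE_imp[of \<eta> "\<lambda>y. y + n"]) (use E in auto)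
    have "(\<integral>y. ?f n y \<partial>\<eta>) = (\<integral>y. y + n \<partial>\<eta>)"
      by (rule integral_cong_AE) (use E in auto)
    then have e: "(\<integral>y. ?f n y \<partial>\<eta>) = m1 + n" by (simp add: m1_def \<eta>.prob_space[simplified])
    show "integrable VN (\<lambda>p. ?f n (fst p + snd p))" "integrable VN (\<lambda>p. ?f n (fst p))"
      "(\<integral>p. ?f n (fst p + snd p) - ?f n (fst p) \<partial>VN) = m1"
      using wald[of "?f n", OF _ _ V \<eta>] e by auto
  qed
  have h: "has_bochner_integral VN (\<lambda>p. \<bar>snd p\<bar>) (c * (\<integral>z. \<bar>z\<bar> \<partial>\<nu>))"
    and h': "has_bochner_integral VN (\<lambda>p. snd p) (c * I)"
    unfolding I_def by (rule has_bochner_integral_snd_\<nu>; simp)+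
  have "(\<lambda>n. \<integral>p. ?f n (fst p + snd p) - ?f n (fst p) \<partial>VN) \<longlonglongrightarrow> (\<integral>p. snd p \<partial>VN)"
  proof (rule integral_dominated_convergence[where w = "\<lambda>p. \<bar>snd p\<bar>"])
    show "AE p in VN. (\<lambda>n. ?f n (fst p + snd p) - ?f n (fst p)) \<longlonglongrightarrow> snd p"
    proof (rule AE_I2)
      fix p :: "real \<times> real"
      obtain N where N: "real N > \<bar>fst p\<bar> + \<bar>snd p\<bar>" using reals_Archimedean2 by blast
      show "(\<lambda>n. ?f n (fst p + snd p) - ?f n (fst p)) \<longlonglongrightarrow> snd p"
        by (rule tendsto_at_top_const[where N = N]) (use N in auto)
    qed
  qed (use h in \<open>auto simp: has_bochner_integral_iff max_def\<close>)
  then have "(\<lambda>n. m1) \<longlonglongrightarrow> c * I" unfolding w using h' by (simp add: has_bochner_integral_iff)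
  then show ?thesis by (simp add: LIMSEQ_const_iff)
qed

lemma m1_pos: "0 < m1"
  using I_pos c_ge_1 by (simp add: m1_eq)

text \<open>On \<open>\<eta>\<close> the truncation is invisible, so \<open>n\<close> enters the
  value only through \<open>2 * n * m1\<close>, which \<open>m1_eq\<close> balances against the
  drift.\<close>

lemma wald_square:
  fixes n :: nat
  defines "f \<equiv> \<lambda>u. pos2 (u + real n)"
  shows "integrable VN (\<lambda>p. f (fst p + snd p))" "integrable VN (\<lambda>p. f (fst p))"
    "(\<integral>p. f (fst p + snd p) - f (fst p) \<partial>VN) = m2 + 2 * n * m1"
proof -
  have [measurable]: "f \<in> borel_measurable borel" unfolding f_def by measurable
  have V: "integrable V f"
  proof (rule integrable_V_bounded[where K = "(real n)\<^sup>2"])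
    fix v :: real assume "v \<le> 0"
    then show "\<bar>f v\<bar> \<le> (real n)\<^sup>2"
      unfolding f_def pos2_def by (auto simp: max_def intro: power_mono)
  qed simp
  have E: "AE y in \<eta>. f y = y\<^sup>2 + (2 * n * y + n\<^sup>2)"
    using \<eta>_pos by eventually_elim (simp add: f_def pos2_def power2_eq_square algebra_simps)
  have \<eta>: "integrable \<eta> f"
    by (rule integrable_cong_AE_imp[of \<eta> "\<lambda>y. y\<^sup>2 + (2 * n * y + n\<^sup>2)"]) (use E integrable_\<eta>_square in auto)
  have "(\<integral>y. f y \<partial>\<eta>) = (\<integral>y. y\<^sup>2 + (2 * n * y + n\<^sup>2) \<partial>\<eta>)"
    by (rule integral_cong_AE) (use E in auto)
  also have "\<dots> = m2 + 2 * n * m1 + n\<^sup>2"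
    using integrable_\<eta>_square by (simp add: m1_def m2_def \<eta>.prob_space[simplified])
  finally have e: "(\<integral>y. f y \<partial>\<eta>) = m2 + 2 * n * m1 + n\<^sup>2" .
  show "integrable VN (\<lambda>p. f (fst p + snd p))" "integrable VN (\<lambda>p. f (fst p))"
    by (rule wald[of f, OF _ _ V \<eta>]; simp add: f_def)+
  have "(\<integral>p. f (fst p + snd p) - f (fst p) \<partial>VN) = (\<integral>y. f y \<partial>\<eta>) - f 0"
    by (rule wald[of f, OF _ _ V \<eta>]; simp add: f_def)
  then show "(\<integral>p. f (fst p + snd p) - f (fst p) \<partial>VN) = m2 + 2 * n * m1"
    unfolding e by (simp add: f_def pos2_def)
qed

lemma m2_nonneg: "0 \<le> m2"
  by (simp add: m2_def)

text \<open>The first moment of \<open>V\<close> comes out of the quadratic identity: bounding the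
  increment of \<open>pos2\<close> by \<open>pos2_add_le\<close> and cancelling with
  \<open>m1_eq\<close> leaves \<open>2 I \<integral> (n - max 0 (v + n)) dV \<le> c E2\<close>, and
  the integrand increases to \<open>- v\<close>.\<close>

lemma integrable_V [simp]: "integrable V (\<lambda>v. v)"
proof -
  let ?K = "c * E2 / (2 * I)"
  let ?g = "\<lambda>n v. max 0 (v + real n)"
  have g: "integrable V (?g n)" for n
    by (rule integrable_V_bounded[where K = n]) auto
  have b: "(\<integral>v. real n - ?g n v \<partial>V) \<le> ?K" for n
  proof -
    let ?f = "\<lambda>u. pos2 (u + real n)"
    have h1: "has_bochner_integral VN (\<lambda>p. 2 * ?g n (fst p) * snd p) ((\<integral>v. 2 * ?g n v \<partial>V) * I)"
      using has_bochner_integral_times[of "\<lambda>v. 2 * ?g n v" "\<lambda>z. z"] g[of n] by (simp add: I_def)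
    have h2: "has_bochner_integral VN (\<lambda>p. (snd p)\<^sup>2) (c * E2)"
      unfolding E2_def by (rule has_bochner_integral_snd_\<nu>[OF square_integrable])
    have "m2 + 2 * n * m1 \<le> (\<integral>p. 2 * ?g n (fst p) * snd p + (snd p)\<^sup>2 \<partial>VN)"
      unfolding wald_square(3)[symmetric]
    proof (rule integral_mono)
      show "?f (fst p + snd p) - ?f (fst p) \<le> 2 * ?g n (fst p) * snd p + (snd p)\<^sup>2" for p
        using pos2_add_le[of "fst p + n" "snd p"] by (simp add: algebra_simps)
    qed (use wald_square[of n] h1 h2 in \<open>auto simp: has_bochner_integral_iff\<close>)
    also have "\<dots> = (\<integral>v. 2 * ?g n v \<partial>V) * I + c * E2"
      using has_bochner_integral_add[OF h1 h2] by (simp add: has_bochner_integral_iff)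
    finally have "2 * n * (I * c) \<le> 2 * (\<integral>v. ?g n v \<partial>V) * I + c * E2"
      using m2_nonneg by (simp add: m1_eq)
    then have "2 * I * (n * c - (\<integral>v. ?g n v \<partial>V)) \<le> c * E2" by (simp add: algebra_simps)
    then have "n * c - (\<integral>v. ?g n v \<partial>V) \<le> ?K" using I_pos by (simp add: field_simps)
    then show ?thesis using g[of n] by (simp add: c_def mult.commute)
  qed
  have "(\<integral>\<^sup>+v. ennreal (- v) \<partial>V) \<le> ennreal ?K"
  proof -
    have "(\<integral>\<^sup>+v. ennreal (- v) \<partial>V) = (\<integral>\<^sup>+v. (SUP n. ennreal (real n - ?g n v)) \<partial>V)"
    proof (rule nn_integral_cong_AE)
      show "AE v in V. ennreal (- v) = (SUP n. ennreal (real n - ?g n v))"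
        using V_nonpos
      proof eventually_elim
        fix v :: real assume v: "v \<le> 0"
        show "ennreal (- v) = (SUP n. ennreal (real n - ?g n v))"
        proof (rule antisym)
          obtain N where "real N > - v" using reals_Archimedean2 by blast
          then show "ennreal (- v) \<le> (SUP n. ennreal (real n - ?g n v))"
            by (intro SUP_upper2[of N]) (auto simp: max_def)
        qed (auto intro!: SUP_least ennreal_leI simp: max_def)
      qed
    qed
    also have "\<dots> = (SUP n. \<integral>\<^sup>+v. ennreal (real n - ?g n v) \<partial>V)"
      by (rule nn_integral_monotone_convergence_SUP_AE)
        (use V_nonpos in \<open>auto intro!: ennreal_leI simp: max_def\<close>)
    also have "\<dots> \<le> ennreal ?K"
    proof (rule SUP_least)
      fix n
      have "(\<integral>\<^sup>+v. ennreal (real n - ?g n v) \<partial>V) = ennreal (\<integral>v. real n - ?g n v \<partial>V)"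
        by (rule nn_integral_eq_integral) (use g V_nonpos in \<open>auto simp: max_def\<close>)
      also have "\<dots> \<le> ennreal ?K" using b by (rule ennreal_leI)
      finally show "(\<integral>\<^sup>+v. ennreal (real n - ?g n v) \<partial>V) \<le> ennreal ?K" .
    qed
    finally show ?thesis .
  qed
  then have "integrable V (\<lambda>v. - v)"
    by (intro integrableI_nonneg) (use V_nonpos in \<open>auto intro: le_less_trans\<close>)
  then show ?thesis by simp
qed

text \<open>A majorant independent of \<open>n\<close> for the limit in \<open>m2_eq\<close>. In
  \<open>pos2 u = u^2 - pos2 (- u)\<close> the square is treated exactly, and the increment of the
  last term factors as \<open>(m' - m) * (m' + m)\<close>.\<close>

lemma pos2_increment_bound:
  assumes "v \<le> 0" "0 \<le> n"
  shows "\<bar>pos2 (v + z + n) - pos2 (v + n) - 2 * n * z\<bar> \<le> 4 * (\<bar>v\<bar> * \<bar>z\<bar>) + 2 * z\<^sup>2"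
proof -
  define x where "x = v + n"
  have p: "pos2 u = u\<^sup>2 - pos2 (- u)" for u by (auto simp: pos2_def max_def)
  define m m' where "m = max 0 (- x)" and "m' = max 0 (- x - z)"
  have "m \<le> \<bar>v\<bar>" "0 \<le> m" "0 \<le> m'" using assms by (auto simp: x_def m_def m'_def)
  moreover have mz: "\<bar>m' - m\<bar> \<le> \<bar>z\<bar>" by (auto simp: m_def m'_def max_def)
  ultimately have "\<bar>m' + m\<bar> \<le> 2 * \<bar>v\<bar> + \<bar>z\<bar>" by linarith
  with mz have "\<bar>(m' - m) * (m' + m)\<bar> \<le> \<bar>z\<bar> * (2 * \<bar>v\<bar> + \<bar>z\<bar>)"
    unfolding abs_mult by (intro mult_mono) auto
  moreover have "pos2 (- x - z) - pos2 (- x) = (m' - m) * (m' + m)"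
    by (simp add: pos2_def m_def m'_def power2_eq_square algebra_simps)
  moreover have "\<bar>z\<bar> * (2 * \<bar>v\<bar> + \<bar>z\<bar>) = 2 * (\<bar>v\<bar> * \<bar>z\<bar>) + z\<^sup>2"
    by (simp add: power2_eq_square algebra_simps)
  ultimately have 1: "\<bar>pos2 (- x - z) - pos2 (- x)\<bar> \<le> 2 * (\<bar>v\<bar> * \<bar>z\<bar>) + z\<^sup>2" by simp
  have "pos2 (v + z + n) - pos2 (v + n) - 2 * n * z = 2 * (v * z) + z\<^sup>2 - (pos2 (- x - z) - pos2 (- x))"
    using p[of "x + z"] p[of x] by (simp add: x_def power2_eq_square algebra_simps)
  moreover have "v * z \<le> \<bar>v\<bar> * \<bar>z\<bar>" "- (v * z) \<le> \<bar>v\<bar> * \<bar>z\<bar>"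
    unfolding abs_mult[symmetric] by simp_all
  ultimately show ?thesis using 1 zero_le_power2[of z] by linarith
qed

definition mV :: real where "mV = (\<integral>v. v \<partial>V)"

text \<open>Wald's second identity. Subtracting \<open>2 n z\<close>, which integrates to
  \<open>2 n m1\<close>, removes the part that grows with \<open>n\<close>; the rest converges to
  \<open>2 v z + z^2\<close>.\<close>

lemma m2_eq: "m2 = 2 * I * mV + c * E2"
proof -
  let ?f = "\<lambda>n u. pos2 (u + real n)"
  let ?s = "\<lambda>n p. ?f n (fst p + snd p) - ?f n (fst p) - 2 * real n * snd p"
  let ?w = "\<lambda>p. 4 * (\<bar>fst p\<bar> * \<bar>snd p\<bar>) + 2 * (snd p)\<^sup>2"
  have hz: "has_bochner_integral VN (\<lambda>p. snd p) (c * I)"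
    unfolding I_def by (rule has_bochner_integral_snd_\<nu>) simp
  have h2: "has_bochner_integral VN (\<lambda>p. (snd p)\<^sup>2) (c * E2)"
    unfolding E2_def by (rule has_bochner_integral_snd_\<nu>[OF square_integrable])
  have h1: "has_bochner_integral VN (\<lambda>p. fst p * snd p) (mV * I)"
    unfolding I_def mV_def by (rule has_bochner_integral_times) simp_all
  have h3: "integrable VN (\<lambda>p. \<bar>fst p\<bar> * \<bar>snd p\<bar>)"
    using has_bochner_integral_times[of "\<lambda>v. \<bar>v\<bar>" "\<lambda>z. \<bar>z\<bar>"] by (simp add: has_bochner_integral_iff)
  have s: "(\<integral>p. ?s n p \<partial>VN) = m2" for n
    using wald_square[of n] hz by (simp add: has_bochner_integral_iff m1_eq)
  have V': "AE p in VN. fst p \<le> 0"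
  proof (rule AE_pair_measure)
    show "{p \<in> space VN. fst p \<le> 0} \<in> sets VN" by measurable
  qed (use V_nonpos in auto)
  have "(\<lambda>n. \<integral>p. ?s n p \<partial>VN) \<longlonglongrightarrow> (\<integral>p. 2 * (fst p * snd p) + (snd p)\<^sup>2 \<partial>VN)"
  proof (rule integral_dominated_convergence[where w = ?w])
    show "AE p in VN. (\<lambda>n. ?s n p) \<longlonglongrightarrow> 2 * (fst p * snd p) + (snd p)\<^sup>2"
    proof (rule AE_I2)
      fix p :: "real \<times> real"
      obtain N where N: "real N > \<bar>fst p\<bar> + \<bar>snd p\<bar>" using reals_Archimedean2 by blast
      show "(\<lambda>n. ?s n p) \<longlonglongrightarrow> 2 * (fst p * snd p) + (snd p)\<^sup>2"
      proof (rule tendsto_at_top_const)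
        fix n assume "N \<le> n"
        then have "0 \<le> fst p + n" "0 \<le> fst p + snd p + n" using N by linarith+
        then show "?s n p = 2 * (fst p * snd p) + (snd p)\<^sup>2"
          by (simp add: pos2_def max_def power2_eq_square algebra_simps)
      qed
    qed
    show "AE p in VN. norm (?s n p) \<le> ?w p" for n
      using V' by eventually_elim (use pos2_increment_bound[of _ "real n"] in auto)
  qed (use h1 h2 h3 in \<open>auto simp: has_bochner_integral_iff\<close>)
  then have "(\<lambda>n. m2) \<longlonglongrightarrow> 2 * (mV * I) + c * E2"
    unfolding s using h1 h2 by (simp add: has_bochner_integral_iff)
  then show ?thesis by (simp add: LIMSEQ_const_iff)
qed

end

section \<open>Harmonic functions of the walk\<close>

context ladder_factor begin

definition A :: "real \<Rightarrow> real" where "A x = measure V {- x..}"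

lemma mono_A: "mono A"
  unfolding A_def by (intro monoI V.finite_measure_mono) auto

lemma A_measurable [measurable]: "A \<in> borel_measurable borel"
  by (rule borel_measurable_mono[OF mono_A])

lemma A_nonneg [simp]: "0 \<le> A x"
  by (simp add: A_def)

lemma A_le_c: "A x \<le> c"
  unfolding A_def c_def by (rule V.finite_measure_mono) auto

lemma A_neg:
  assumes "x < 0" shows "A x = 0"
proof -
  have "emeasure V {v\<in>space V. - x \<le> v} = 0"
    by (rule emeasure_eq_0_AE) (use V_nonpos assms in \<open>auto elim!: eventually_mono\<close>)
  moreover have "{v\<in>space V. - x \<le> v} = {- x..}" by auto
  ultimately show ?thesis by (simp add: A_def V.emeasure_eq_measure)
qed

lemma A_ge_1: "0 \<le> x \<Longrightarrow> 1 \<le> A x"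
  unfolding A_def by (rule order_trans[OF measure_V_0]) (rule V.finite_measure_mono, auto)

text \<open>For the indicator of \<open>{- x..}\<close> the start and the exit contribute 1 each and
  cancel. Exchanging the integrals then moves the shift by \<open>z\<close> from the walk onto the
  level.\<close>

lemma A_harmonic:
  assumes x: "0 \<le> x"
  shows "(\<integral>\<^sup>+z. ennreal (A (x + z)) \<partial>\<nu>) = ennreal (A x)"
proof -
  have "emeasure \<eta> {- x..} = 1"
    using \<eta>.prob_space[simplified] \<eta>_pos x
    by (subst \<eta>.emeasure_eq_1_AE) (auto elim!: eventually_mono)
  then have "(\<integral>\<^sup>+v. (\<integral>\<^sup>+z. indicator {- x..} (v + z) \<partial>\<nu>) \<partial>V) + 1 = emeasure V {- x..} + 1"
    using dynkin[of "indicator {- x..}"] x by simp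
  then have "(\<integral>\<^sup>+v. (\<integral>\<^sup>+z. indicator {- x..} (v + z) \<partial>\<nu>) \<partial>V) = ennreal (A x)"
    by (simp add: A_def V.emeasure_eq_measure ennreal_add_left_cancel add.commute[of _ 1])
  moreover have "(\<integral>\<^sup>+v. (\<integral>\<^sup>+z. indicator {- x..} (v + z) \<partial>\<nu>) \<partial>V) =
      (\<integral>\<^sup>+z. (\<integral>\<^sup>+v. indicator {- x..} (v + z) \<partial>V) \<partial>\<nu>)"
    by (rule Fubini'[symmetric]) measurable
  moreover have "(\<integral>\<^sup>+v. indicator {- x..} (v + z) \<partial>V) = ennreal (A (x + z))" for z
  proof -
    have "(\<integral>\<^sup>+v. indicator {- x..} (v + z) \<partial>V) = (\<integral>\<^sup>+v. indicator {- (x + z)..} v \<partial>V)"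
      by (rule nn_integral_cong) (auto simp: indicator_def)
    then show ?thesis by (simp add: A_def V.emeasure_eq_measure)
  qed
  ultimately show ?thesis by simp
qed

lemma integrable_\<nu>_bounded:
  assumes "f \<in> borel_measurable borel" "\<And>z. \<bar>f z\<bar> \<le> (K::real)"
  shows "integrable \<nu> f"
  by (rule \<nu>.integrable_const_bound[where B = K]) (use assms in auto)

lemma integrable_A [simp]: "integrable \<nu> (\<lambda>z. A (x + z))"
  by (rule integrable_\<nu>_bounded[where K = c]) (use A_le_c in auto)

lemma integral_A:
  assumes "0 \<le> x" shows "(\<integral>z. A (x + z) \<partial>\<nu>) = A x"
  using A_harmonic[OF assms] by (simp add: nn_integral_eq_integral integral_nonneg_AE)

text \<open>Of interest for \<open>x < 0\<close>, where \<open>A x = 0\<close>: a jump of at least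
  \<open>- x\<close> leads back to where \<open>A \<ge> 1\<close>.\<close>

lemma integral_A_neg: "measure \<nu> {- x..} \<le> (\<integral>z. A (x + z) \<partial>\<nu>)"
proof -
  have "(\<integral>z. indicator {- x..} z \<partial>\<nu>) \<le> (\<integral>z. A (x + z) \<partial>\<nu>)"
    by (rule integral_mono[OF integrable_\<nu>_bounded[where K = 1]]) (auto simp: A_ge_1 split: split_indicator)
  then show ?thesis by simp
qed

section \<open>The integral of \<open>A\<close> and its linear asymptote\<close>

definition B :: "real \<Rightarrow> real" where "B w = (\<integral>v. max 0 (w + v) \<partial>V) / m1"

lemma B_measurable [measurable]: "B \<in> borel_measurable borel"
  unfolding B_def[abs_def] by measurable

lemma integrable_ramp [simp]: "integrable V (\<lambda>v. max 0 (w + v))"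
  by (rule Bochner_Integration.integrable_bound[of V "\<lambda>v. \<bar>w\<bar> + \<bar>v\<bar>"]) auto

lemma B_nonneg [simp]: "0 \<le> B w"
  using m1_pos by (simp add: B_def)

lemma B_nonpos: "w \<le> 0 \<Longrightarrow> B w = 0"
  unfolding B_def by (subst integral_eq_zero_AE) (use V_nonpos in \<open>auto elim!: eventually_mono\<close>)

lemma ennreal_B: "ennreal m1 * ennreal (B w) = (\<integral>\<^sup>+v. ennreal (max 0 (w + v)) \<partial>V)"
  using m1_pos by (subst nn_integral_eq_integral) (auto simp: B_def ennreal_mult[symmetric])

text \<open>The ramp \<open>u \<mapsto> max 0 (w + u)\<close> is linear on the ladder heights, so
  the exit contributes \<open>w + m1\<close> against \<open>w\<close> from the start. The
  normalisation by \<open>m1\<close> turns the surplus into 1, so that \<open>B\<close> counts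
  steps.\<close>

lemma B_step:
  assumes w: "0 \<le> w"
  shows "(\<integral>\<^sup>+z. ennreal (B (w + z)) \<partial>\<nu>) = ennreal (B w + 1)"
proof -
  have "ennreal m1 * (\<integral>\<^sup>+z. ennreal (B (w + z)) \<partial>\<nu>) = (\<integral>\<^sup>+z. (\<integral>\<^sup>+v. ennreal (max 0 (w + (v + z))) \<partial>V) \<partial>\<nu>)"
    by (subst nn_integral_cmult[symmetric]) (auto simp: ennreal_B ac_simps)
  also have "\<dots> = (\<integral>\<^sup>+v. (\<integral>\<^sup>+z. ennreal (max 0 (w + (v + z))) \<partial>\<nu>) \<partial>V)"
    by (rule Fubini') measurable
  finally have "ennreal w + ennreal m1 * (\<integral>\<^sup>+z. ennreal (B (w + z)) \<partial>\<nu>) =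
      ennreal m1 * ennreal (B w) + (\<integral>\<^sup>+y. ennreal (max 0 (w + y)) \<partial>\<eta>)"
    using dynkin[of "\<lambda>u. ennreal (max 0 (w + u))"] w by (simp add: ennreal_B add.commute)
  also have "(\<integral>\<^sup>+y. ennreal (max 0 (w + y)) \<partial>\<eta>) = (\<integral>\<^sup>+y. ennreal (w + y) \<partial>\<eta>)"
    by (rule nn_integral_cong_AE) (use \<eta>_pos w in \<open>auto elim!: eventually_mono\<close>)
  also have "\<dots> = ennreal (w + m1)"
    using \<eta>_pos w by (subst nn_integral_eq_integral)
      (auto simp: m1_def \<eta>.prob_space[simplified] elim!: eventually_mono)
  also have "ennreal m1 * ennreal (B w) + ennreal (w + m1) = ennreal w + ennreal m1 * ennreal (B w + 1)"
    using w m1_pos by (simp add: ennreal_mult[symmetric] ennreal_plus[symmetric] algebra_simps del: ennreal_plus)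
  finally have "ennreal m1 * (\<integral>\<^sup>+z. ennreal (B (w + z)) \<partial>\<nu>) = ennreal m1 * ennreal (B w + 1)"
    by (simp add: ennreal_add_left_cancel)
  then show ?thesis using m1_pos by (simp add: ennreal_mult_cancel_left)
qed

text \<open>The distance of \<open>m1 * B\<close> from its asymptote, see \<open>B_eq\<close>; only
  the mass of \<open>V\<close> below \<open>- h\<close> contributes.\<close>

definition \<delta> :: "real \<Rightarrow> real" where "\<delta> h = (\<integral>v. max 0 (- h - v) \<partial>V)"

lemma integrable_ramp' [simp]: "integrable V (\<lambda>v. max 0 (- h - v))"
  by (rule Bochner_Integration.integrable_bound[of V "\<lambda>v. \<bar>h\<bar> + \<bar>v\<bar>"]) auto

lemma \<delta>_antimono: "h \<le> w \<Longrightarrow> \<delta> w \<le> \<delta> h"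
  unfolding \<delta>_def by (rule integral_mono) auto

lemma B_eq: "m1 * B w = c * w + mV + \<delta> w"
proof -
  have "(\<integral>v. max 0 (w + v) \<partial>V) = (\<integral>v. w + v + max 0 (- w - v) \<partial>V)"
    by (rule Bochner_Integration.integral_cong) auto
  also have "\<dots> = c * w + mV + \<delta> w"
    by (simp add: \<delta>_def c_def mV_def)
  finally show ?thesis using m1_pos by (simp add: B_def)
qed

lemma \<delta>_tendsto: "(\<delta> \<longlongrightarrow> 0) at_top"
proof -
  have "((\<lambda>h. \<integral>v. max 0 (- h - v) \<partial>V) \<longlongrightarrow> (\<integral>v. 0 \<partial>V)) at_top"
  proof (rule integral_dominated_convergence_at_top[where w = "\<lambda>v. \<bar>v\<bar>"])
    show "AE v in V. ((\<lambda>h. max 0 (- h - v)) \<longlongrightarrow> 0) at_top"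
    proof (rule AE_I2)
      show "((\<lambda>h. max 0 (- h - v)) \<longlongrightarrow> 0) at_top" for v :: real
        by (rule tendsto_at_top_const[where N = "- v"]) simp
    qed
    show "\<forall>\<^sub>F h in at_top. AE v in V. norm (max 0 (- h - v)) \<le> \<bar>v\<bar>"
      using eventually_ge_at_top[of 0] by eventually_elim auto
  qed auto
  then show ?thesis by (simp add: \<delta>_def[abs_def])
qed

lemma \<delta>_nonneg: "0 \<le> \<delta> h" by (simp add: \<delta>_def)

text \<open>The mean overshoot over \<open>y\<close> in a single step from 0; it becomes the source
  term of the renewal equation for \<open>r\<close>.\<close>

definition \<psi> :: "real \<Rightarrow> real" where "\<psi> y = (\<integral>z. max 0 (z - y) \<partial>\<nu>)"

lemma integrable_\<psi> [simp]: "integrable \<nu> (\<lambda>z. max 0 (z - y))"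
  by (rule Bochner_Integration.integrable_bound[of \<nu> "\<lambda>z. \<bar>z\<bar> + \<bar>y\<bar>"]) auto

lemma \<psi>_nonneg [simp]: "0 \<le> \<psi> y" by (simp add: \<psi>_def)

lemma \<psi>_antimono: "x \<le> y \<Longrightarrow> \<psi> y \<le> \<psi> x"
  unfolding \<psi>_def by (rule integral_mono) auto

lemma ennreal_\<psi>: "(\<integral>\<^sup>+z. ennreal (z - y) \<partial>\<nu>) = ennreal (\<psi> y)"
proof -
  have "(\<integral>\<^sup>+z. ennreal (z - y) \<partial>\<nu>) = (\<integral>\<^sup>+z. ennreal (max 0 (z - y)) \<partial>\<nu>)"
    by (rule nn_integral_cong) (auto simp: max_def ennreal_neg)
  also have "\<dots> = ennreal (\<psi> y)"
    unfolding \<psi>_def by (rule nn_integral_eq_integral) auto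
  finally show ?thesis .
qed

lemma \<psi>_tendsto: "(\<psi> \<longlongrightarrow> 0) at_top"
proof -
  have "((\<lambda>h. \<integral>z. max 0 (z - h) \<partial>\<nu>) \<longlongrightarrow> (\<integral>z. 0 \<partial>\<nu>)) at_top"
  proof (rule integral_dominated_convergence_at_top[where w = "\<lambda>v. \<bar>v\<bar>"])
    show "AE z in \<nu>. ((\<lambda>h. max 0 (z - h)) \<longlongrightarrow> 0) at_top"
    proof (rule AE_I2)
      show "((\<lambda>h. max 0 (z - h)) \<longlongrightarrow> 0) at_top" for z :: real
        by (rule tendsto_at_top_const[where N = z]) simp
    qed
    show "\<forall>\<^sub>F h in at_top. AE z in \<nu>. norm (max 0 (z - h)) \<le> \<bar>z\<bar>"
      using eventually_ge_at_top[of 0] by eventually_elim auto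
  qed auto
  then show ?thesis by (simp add: \<psi>_def[abs_def])
qed

section \<open>A uniform bound for the mean overshoot\<close>

lemma jump_up: "\<exists>\<epsilon>>0. 0 < measure \<nu> {\<epsilon>..}"
proof -
  obtain \<epsilon> where \<epsilon>: "0 < \<epsilon>" "0 < measure \<nu> {z\<in>space \<nu>. \<epsilon> < z}"
    using \<nu>.integral_pos_imp_level[OF _ drift_pos] by auto
  note \<epsilon>(2)
  also have "measure \<nu> {z\<in>space \<nu>. \<epsilon> < z} \<le> measure \<nu> {\<epsilon>..}"
    by (rule \<nu>.finite_measure_mono) auto
  finally show ?thesis using \<epsilon>(1) by blast
qed

definition \<epsilon> :: real where "\<epsilon> = (SOME \<epsilon>. \<epsilon> > 0 \<and> 0 < measure \<nu> {\<epsilon>..})"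
definition p0 :: real where "p0 = measure \<nu> {\<epsilon>..}"

lemma \<epsilon>_pos: "0 < \<epsilon>" and p0_pos: "0 < p0"
  using someI_ex[OF jump_up] unfolding \<epsilon>_def p0_def by auto

text \<open>Left end points of the cells \<open>(grid j, grid j + \<epsilon>]\<close>. Starting at
  \<open>- \<epsilon>\<close> puts the point 0 into a cell, and since \<open>\<psi>\<close>
  decreases, \<open>\<psi> (grid j)\<close> bounds it on the whole cell.\<close>

definition grid :: "nat \<Rightarrow> real" where "grid j = (real j - 1) * \<epsilon>"

text \<open>The derivative of \<open>pos2\<close> is \<open>2 * max 0 a\<close>, so a Riemann sum of
  the ramp telescopes against \<open>pos2\<close>. In this way the second moment of \<open>Z\<close>
  makes \<open>\<psi>\<close> summable along the grid.\<close>

lemma sum_ramp_le: "\<epsilon> * (\<Sum>j<n. max 0 (z - grid j)) \<le> (z + 2 * \<epsilon>)\<^sup>2"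
proof -
  have step: "\<epsilon> * max 0 a \<le> pos2 (a + \<epsilon>) - pos2 a" for a
  proof (cases "a \<ge> 0")
    case True
    then have "0 \<le> \<epsilon> * a" "0 \<le> \<epsilon>\<^sup>2" using \<epsilon>_pos by auto
    then show ?thesis using True \<epsilon>_pos by (simp add: pos2_def power2_eq_square algebra_simps)
  next
    case False
    then show ?thesis by (simp add: pos2_def max_def)
  qed
  have "\<epsilon> * (\<Sum>j<n. max 0 (z - grid j)) \<le> pos2 (z + 2 * \<epsilon>) - pos2 (z - grid n + \<epsilon>)"
  proof (induction n)
    case 0
    then show ?case by (simp add: grid_def algebra_simps)
  next
    case (Suc n)
    have "grid (Suc n) = grid n + \<epsilon>" by (simp add: grid_def algebra_simps)
    then show ?case using Suc step[of "z - grid n"] by (simp add: algebra_simps)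
  qed
  also have "\<dots> \<le> (z + 2 * \<epsilon>)\<^sup>2" using pos2_le[of "z + 2 * \<epsilon>"] pos2_nonneg[of "z - grid n + \<epsilon>"] by linarith
  finally show ?thesis .
qed

lemma summable_\<psi>_grid: "summable (\<lambda>j. \<psi> (grid j))"
proof (rule bounded_imp_summable)
  fix n
  have i: "integrable \<nu> (\<lambda>z. (z + 2 * \<epsilon>)\<^sup>2)"
    using square_integrable by (simp add: power2_sum)
  have "\<epsilon> * (\<Sum>j<Suc n. \<psi> (grid j)) = (\<integral>z. \<epsilon> * (\<Sum>j<Suc n. max 0 (z - grid j)) \<partial>\<nu>)"
    unfolding \<psi>_def by (simp add: Bochner_Integration.integral_sum del: sum.lessThan_Suc)
  also have "\<dots> \<le> (\<integral>z. (z + 2 * \<epsilon>)\<^sup>2 \<partial>\<nu>)"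
    by (rule integral_mono) (use i sum_ramp_le[where n = "Suc n"] in auto)
  finally show "(\<Sum>j\<le>n. \<psi> (grid j)) \<le> (\<integral>z. (z + 2 * \<epsilon>)\<^sup>2 \<partial>\<nu>) / \<epsilon>"
    using \<epsilon>_pos by (simp add: lessThan_Suc_atMost field_simps)
qed simp

text \<open>A superharmonic majorant of \<open>\<psi>\<close>: \<open>c - A\<close> drops by at least \<open>p0\<close> in one step from \<open>[-\<epsilon>, 0)\<close>,
  so the translates of it bound the expected number of visits to the cells of the grid.\<close>

definition pot :: "real \<Rightarrow> ennreal" where
  "pot x = (\<Sum>j. ennreal (\<psi> (grid j) / p0 * (c - A (grid j - x))))"

definition Cr :: real where "Cr = (\<Sum>j. \<psi> (grid j)) / p0 * c"

lemma pot_measurable [measurable]: "pot \<in> borel_measurable borel"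
  unfolding pot_def[abs_def] by measurable

lemma pot_le: "pot x \<le> ennreal Cr"
proof -
  have "pot x \<le> (\<Sum>j. ennreal (\<psi> (grid j) / p0 * c))"
    unfolding pot_def using p0_pos by (intro suminf_le summableI ennreal_leI mult_left_mono) auto
  also have "\<dots> = ennreal (\<Sum>j. \<psi> (grid j) / p0 * c)"
    using p0_pos c_ge_1 summable_\<psi>_grid
    by (intro suminf_ennreal2) (auto intro!: summable_mult2 summable_divide)
  also have "(\<Sum>j. \<psi> (grid j) / p0 * c) = Cr"
    unfolding Cr_def suminf_divide[OF summable_\<psi>_grid, symmetric]
    by (rule suminf_mult2[OF summable_divide[OF summable_\<psi>_grid], symmetric])
  finally show ?thesis .
qed

lemma Cr_nonneg: "0 \<le> Cr"
  unfolding Cr_def using p0_pos c_ge_1 summable_\<psi>_grid by (auto intro!: mult_nonneg_nonneg divide_nonneg_nonneg suminf_nonneg)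

text \<open>In terms of \<open>u = grid j - x\<close> a step adds \<open>z\<close> to
  \<open>u\<close>. For \<open>u \<ge> 0\<close> harmonicity of \<open>A\<close> preserves the
  summand; for \<open>u < 0\<close> its factor \<open>c - A u\<close> is already maximal; and in the
  cell containing \<open>x\<close> the summand loses at least \<open>\<psi> (grid j)\<close>, which
  is why \<open>pot\<close> divides by \<open>p0\<close>.\<close>

lemma pot_drift:
  assumes x: "0 \<le> x"
  shows "(\<integral>\<^sup>+z. pot (x - z) \<partial>\<nu>) + ennreal (\<psi> x) \<le> pot x"
proof -
  let ?t = "\<lambda>j x. \<psi> (grid j) / p0 * (c - A (grid j - x))"
  let ?d = "\<lambda>j. ennreal (\<psi> (grid j) / p0 * (\<integral>z. c - A (grid j - x + z) \<partial>\<nu>))"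
  let ?i = "\<lambda>j. ennreal (\<psi> (grid j) * indicator {- \<epsilon>..<0} (grid j - x))"
  have t_nonneg: "0 \<le> ?t j y" for j y using p0_pos A_le_c[of "grid j - y"] by auto
  have step: "(\<integral>z. c - A (u + z) \<partial>\<nu>) + p0 * indicator {- \<epsilon>..<0} u \<le> c - A u" for u
  proof (cases "0 \<le> u")
    case True
    then show ?thesis by (simp add: integral_A \<nu>.prob_space[simplified])
  next
    case False
    have "p0 \<le> (\<integral>z. A (u + z) \<partial>\<nu>)" if "- \<epsilon> \<le> u"
      by (rule order_trans[OF _ integral_A_neg]) (use that in \<open>auto simp: p0_def intro!: \<nu>.finite_measure_mono\<close>)
    moreover have "0 \<le> (\<integral>z. A (u + z) \<partial>\<nu>)" by simp
    ultimately show ?thesis using False by (auto simp: A_neg \<nu>.prob_space[simplified] indicator_def)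
  qed
  have "(\<integral>\<^sup>+z. pot (x - z) \<partial>\<nu>) = (\<Sum>j. \<integral>\<^sup>+z. ennreal (?t j (x - z)) \<partial>\<nu>)"
    unfolding pot_def by (rule nn_integral_suminf) measurable
  also have "(\<lambda>j. \<integral>\<^sup>+z. ennreal (?t j (x - z)) \<partial>\<nu>) =
      ?d"
  proof
    fix j
    have "(\<integral>\<^sup>+z. ennreal (?t j (x - z)) \<partial>\<nu>) = ennreal (\<integral>z. ?t j (x - z) \<partial>\<nu>)"
      by (rule nn_integral_eq_integral[OF _ AE_I2[OF t_nonneg]])
        (use integrable_A[of "grid j - x"] in \<open>auto simp: algebra_simps\<close>)
    moreover have "(\<integral>z. ?t j (x - z) \<partial>\<nu>) = (\<integral>z. \<psi> (grid j) / p0 * (c - A (grid j - x + z)) \<partial>\<nu>)"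
      by (simp add: algebra_simps)
    ultimately show "(\<integral>\<^sup>+z. ennreal (?t j (x - z)) \<partial>\<nu>) = ?d j"
      by (simp only: integral_mult_right_zero)
  qed
  finally have pint: "(\<integral>\<^sup>+z. pot (x - z) \<partial>\<nu>) = (\<Sum>j. ?d j)" .
  have "ennreal (\<psi> x) \<le> (\<Sum>j. ?i j)"
  proof -
    \<comment> \<open>The cell with \<open>grid k < x \<le> grid k + \<epsilon>\<close>; the ceiling
      fits the half-open shape of the cells and the offset of \<open>grid\<close>.\<close>
    define k where "k = nat \<lceil>x / \<epsilon>\<rceil>"
    have k: "real k = of_int \<lceil>x / \<epsilon>\<rceil>" using x \<epsilon>_pos by (simp add: k_def)
    have "x / \<epsilon> \<le> real k" "real k < x / \<epsilon> + 1" unfolding k by linarith+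
    then have "x \<le> real k * \<epsilon>" "(real k - 1) * \<epsilon> < x" using \<epsilon>_pos by (auto simp: field_simps)
    then have g: "grid k - x \<in> {- \<epsilon>..<0}" by (auto simp: grid_def algebra_simps)
    define t where "t = ?i"
    have "ennreal (\<psi> x) \<le> t k"
      unfolding t_def using g by (auto intro!: ennreal_leI \<psi>_antimono)
    also have "t k = sum t {k}" by simp
    also have "\<dots> \<le> suminf t" by (rule sum_le_suminf[OF summableI]) auto
    finally show ?thesis unfolding t_def .
  qed
  then have "(\<integral>\<^sup>+z. pot (x - z) \<partial>\<nu>) + ennreal (\<psi> x) \<le>
      (\<Sum>j. ?d j) +
      (\<Sum>j. ?i j)"
    unfolding pint by (rule add_left_mono)
  also have "\<dots> = (\<Sum>j. ?d j +
      ?i j)"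
    by (rule suminf_add[OF summableI summableI])
  also have "\<dots> \<le> pot x"
    unfolding pot_def
  proof (rule suminf_le[OF _ summableI summableI])
    fix j
    let ?u = "grid j - x"
    have i: "0 \<le> (\<integral>z. c - A (?u + z) \<partial>\<nu>)" using A_le_c by (intro integral_nonneg_AE) auto
    have "?d j + ?i j =
        ennreal (\<psi> (grid j) / p0 * ((\<integral>z. c - A (?u + z) \<partial>\<nu>) + p0 * indicator {- \<epsilon>..<0} ?u))"
      using i p0_pos by (subst ennreal_plus[symmetric]) (auto simp: field_simps)
    also have "\<dots> \<le> ennreal (?t j x)"
      using step[of ?u] p0_pos by (intro ennreal_leI mult_left_mono) auto
    finally show "?d j + ?i j \<le> ennreal (?t j x)" .
  qed
  finally show ?thesis .
qed

text \<open>\<open>rn n x\<close> is the expected overshoot of the walk over the level \<open>x\<close>, counted only if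
  the level is passed within \<open>n\<close> steps.\<close>

primrec rn :: "nat \<Rightarrow> real \<Rightarrow> ennreal" where
  "rn 0 x = ennreal (- x)"
| "rn (Suc n) x = (if x < 0 then ennreal (- x) else \<integral>\<^sup>+z. rn n (x - z) \<partial>\<nu>)"

lemma rn_measurable [measurable]: "rn n \<in> borel_measurable borel"
proof (induction n)
  case (Suc n)
  note [measurable] = Suc
  have "(\<lambda>x. if x < 0 then ennreal (- x) else \<integral>\<^sup>+z. rn n (x - z) \<partial>\<nu>) \<in> borel_measurable borel"
    by measurable
  then show ?case by (simp add: fun_eq_iff[symmetric] cong: measurable_cong)
qed (simp add: measurable_compose[OF _ measurable_ennreal])

lemma rn_neg: "x < 0 \<Longrightarrow> rn n x = ennreal (- x)"
  by (cases n) auto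

lemma rn_mono_Suc: "rn n x \<le> rn (Suc n) x"
proof (induction n arbitrary: x)
  case 0
  then show ?case by (auto simp: ennreal_neg)
next
  case (Suc n)
  then show ?case by (auto intro!: nn_integral_mono simp del: rn.simps(2) simp: rn.simps(2)[of "Suc n"] rn.simps(2)[of n x])
qed

text \<open>By \<open>pot_drift\<close> the right-hand side is a supersolution of the recursion for
  \<open>rn\<close>.\<close>

lemma rn_le: "rn n x \<le> ennreal (- x) + pot x"
proof (induction n arbitrary: x)
  case (Suc n)
  show ?case
  proof (cases "x < 0")
    case False
    then have "rn (Suc n) x \<le> (\<integral>\<^sup>+z. ennreal (z - x) + pot (x - z) \<partial>\<nu>)"
      using Suc[of "x - _"] by (auto intro!: nn_integral_mono)
    also have "\<dots> = ennreal (\<psi> x) + (\<integral>\<^sup>+z. pot (x - z) \<partial>\<nu>)"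
      by (subst nn_integral_add) (auto simp: ennreal_\<psi>)
    also have "\<dots> \<le> pot x" using pot_drift[of x] False by (simp add: add.commute)
    finally show ?thesis using False by (simp add: ennreal_neg)
  qed simp
qed simp

text \<open>A coupling with the same increments: when the walk passes \<open>x\<close> it is either
  beyond \<open>y\<close> too, and the overshoots differ by \<open>y - x\<close>, or it is still at
  most at \<open>y\<close>, and the overshoot over \<open>x\<close> is at most \<open>y - x\<close>.
  The induction on \<open>n\<close> carries this out without paths.\<close>

lemma rn_shift: "x \<le> y \<Longrightarrow> rn n x \<le> rn n y + ennreal (y - x)"
proof (induction n arbitrary: x y)
  case 0
  then show ?case by (cases "y \<le> 0") (auto simp: ennreal_plus[symmetric] ennreal_neg intro!: ennreal_leI simp del: ennreal_plus)
next
  case (Suc n)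
  consider "y < 0" | "x < 0" "0 \<le> y" | "0 \<le> x" using Suc.prems by linarith
  then show ?case
  proof cases
    case 1
    then show ?thesis using Suc.prems by (simp add: ennreal_plus[symmetric] del: ennreal_plus)
  next
    case 2
    then have "rn (Suc n) x \<le> ennreal (y - x)" by (auto intro!: ennreal_leI)
    then show ?thesis by (rule order_trans) simp
  next
    case 3
    have "(\<integral>\<^sup>+z. rn n (x - z) \<partial>\<nu>) \<le> (\<integral>\<^sup>+z. rn n (y - z) + ennreal (y - x) \<partial>\<nu>)"
      using Suc.IH[of "x - z" "y - z" for z] Suc.prems by (intro nn_integral_mono) auto
    also have "\<dots> = (\<integral>\<^sup>+z. rn n (y - z) \<partial>\<nu>) + ennreal (y - x)"
      by (subst nn_integral_add) (auto simp: \<nu>.emeasure_space_1[simplified])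
    finally show ?thesis using 3 Suc.prems by simp
  qed
qed

definition r :: "real \<Rightarrow> real" where "r x = enn2real (SUP n. rn n x)"

lemma SUP_rn_le: "(SUP n. rn n x) \<le> ennreal (- x) + ennreal Cr"
  by (rule SUP_least) (rule order_trans[OF rn_le add_left_mono[OF pot_le]])

lemma ennreal_r: "ennreal (r x) = (SUP n. rn n x)"
proof -
  have "(SUP n. rn n x) < top"
    by (rule le_less_trans[OF SUP_rn_le]) simp
  then show ?thesis by (simp add: r_def)
qed

lemma r_nonneg [simp]: "0 \<le> r x" by (simp add: r_def)

lemma r_measurable [measurable]: "r \<in> borel_measurable borel"
  unfolding r_def[abs_def] by measurable

lemma r_neg: "x < 0 \<Longrightarrow> r x = - x"
  by (simp add: r_def rn_neg)

lemma r_le: "0 \<le> x \<Longrightarrow> r x \<le> Cr"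
proof -
  assume "0 \<le> x"
  then have "ennreal (r x) \<le> ennreal Cr" unfolding ennreal_r using SUP_rn_le[of x] by (simp add: ennreal_neg)
  then show "r x \<le> Cr" using Cr_nonneg by (simp add: ennreal_le_iff)
qed

lemma r_harmonic:
  assumes "0 \<le> x"
  shows "(\<integral>\<^sup>+z. ennreal (r (x - z)) \<partial>\<nu>) = ennreal (r x)"
proof -
  have inc: "incseq (\<lambda>n z. rn n (x - z))"
    by (intro incseq_SucI le_funI) (rule rn_mono_Suc)
  have "(\<integral>\<^sup>+z. ennreal (r (x - z)) \<partial>\<nu>) = (SUP n. \<integral>\<^sup>+z. rn n (x - z) \<partial>\<nu>)"
    unfolding ennreal_r by (rule nn_integral_monotone_convergence_SUP[OF inc]) measurable
  also have "\<dots> = (SUP n. rn (Suc n) x)" using assms by simp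
  also have "\<dots> = (SUP n. rn n x)"
  proof (rule antisym)
    show "(SUP n. rn (Suc n) x) \<le> (SUP n. rn n x)" 
    proof (rule SUP_mono)
      show "\<exists>m\<in>UNIV. rn (Suc n) x \<le> rn m x" for n by (rule bexI[of _ "Suc n"]) simp_all
    qed
    show "(SUP n. rn n x) \<le> (SUP n. rn (Suc n) x)" 
    proof (rule SUP_mono)
      show "\<exists>m\<in>UNIV. rn n x \<le> rn (Suc m) x" for n by (rule bexI[of _ n, OF rn_mono_Suc UNIV_I])
    qed
  qed
  finally show ?thesis by (simp add: ennreal_r)
qed

text \<open>This one-sided modulus takes the place of continuity when \<open>r_tendsto\<close>
  passes from averages to values.\<close>

lemma r_shift: "x \<le> y \<Longrightarrow> r x \<le> r y + (y - x)"
proof -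
  assume xy: "x \<le> y"
  have "ennreal (r x) \<le> ennreal (r y) + ennreal (y - x)"
    unfolding ennreal_r by (rule SUP_least) (rule order_trans[OF rn_shift[OF xy]], auto intro: add_right_mono SUP_upper)
  then show ?thesis using xy by (simp add: ennreal_plus[symmetric] ennreal_le_iff del: ennreal_plus)
qed

end

section \<open>Nearly harmonic functions\<close>

locale convolution = prob_space \<nu> for \<nu> :: "real measure" +
  assumes sets_eq_borel [simp, measurable_cong]: "sets \<nu> = sets borel"
begin

lemma space_eq_UNIV [simp]: "space \<nu> = UNIV"
  using sets_eq_imp_space_eq[OF sets_eq_borel] by simp

text \<open>Bounded Borel functions, for which integrability against translates of
  \<open>\<nu>\<close> is automatic.\<close>

definition bm :: "(real \<Rightarrow> real) \<Rightarrow> bool" where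
  "bm f \<longleftrightarrow> f \<in> borel_measurable borel \<and> (\<exists>K. \<forall>x. \<bar>f x\<bar> \<le> K)"

definition conv :: "(real \<Rightarrow> real) \<Rightarrow> real \<Rightarrow> real" where
  "conv f x = (\<integral>z. f (x - z) \<partial>\<nu>)"

lemma bmD [measurable_dest]: "bm f \<Longrightarrow> f \<in> borel_measurable borel" by (simp add: bm_def)

lemma bm_integrable:
  assumes "bm f" shows "integrable \<nu> (\<lambda>z. f (x - z))"
proof -
  note [measurable] = bmD[OF assms]
  obtain K where "\<And>x. \<bar>f x\<bar> \<le> K" using assms by (auto simp: bm_def)
  then show ?thesis by (intro integrable_const_bound[where B = K]) auto
qed

lemma conv_abs_le:
  assumes "bm f" "\<And>x. \<bar>f x\<bar> \<le> K" shows "\<bar>conv f x\<bar> \<le> K"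
proof -
  have "\<bar>conv f x\<bar> \<le> (\<integral>z. \<bar>f (x - z)\<bar> \<partial>\<nu>)" unfolding conv_def by (rule integral_abs_bound)
  also have "\<dots> \<le> (\<integral>z. K \<partial>\<nu>)"
    by (rule integral_mono) (use assms bm_integrable[OF assms(1)] in auto)
  finally show ?thesis using prob_space by simp
qed

lemma bm_conv: assumes "bm f" shows "bm (conv f)"
proof -
  note [measurable] = bmD[OF assms]
  have "conv f \<in> borel_measurable borel" unfolding conv_def[abs_def] by measurable
  then show ?thesis using conv_abs_le[OF assms] assms unfolding bm_def by blast
qed

lemma bm_simps:
  "bm f \<Longrightarrow> bm g \<Longrightarrow> bm (\<lambda>x. f x + g x)"
  "bm f \<Longrightarrow> bm g \<Longrightarrow> bm (\<lambda>x. f x - g x)"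
  "bm f \<Longrightarrow> bm g \<Longrightarrow> bm (\<lambda>x. f x * g x)"
  "bm f \<Longrightarrow> bm (\<lambda>x. \<bar>f x\<bar>)"
  "bm (\<lambda>x. k)"
proof -
  show "bm (\<lambda>x. f x + g x)" "bm (\<lambda>x. f x - g x)" "bm (\<lambda>x. f x * g x)" if f: "bm f" and g: "bm g"
  proof -
    obtain K where K: "\<And>x. \<bar>f x\<bar> \<le> K" using f by (auto simp: bm_def)
    obtain L where L: "\<And>x. \<bar>g x\<bar> \<le> L" using g by (auto simp: bm_def)
    note [measurable] = bmD[OF f] bmD[OF g]
    have "\<bar>f x + g x\<bar> \<le> K + L" "\<bar>f x - g x\<bar> \<le> K + L" for x using K[of x] L[of x] by linarith+
    moreover have "\<bar>f x * g x\<bar> \<le> K * L" for x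
      unfolding abs_mult using K[of x] L[of x] by (intro mult_mono) auto
    ultimately show "bm (\<lambda>x. f x + g x)" "bm (\<lambda>x. f x - g x)" "bm (\<lambda>x. f x * g x)"
      by (auto simp: bm_def)
  qed
qed (auto simp: bm_def)

lemma conv_mono: "bm f \<Longrightarrow> bm g \<Longrightarrow> (\<And>x. f x \<le> g x) \<Longrightarrow> conv f x \<le> conv g x"
  unfolding conv_def by (rule integral_mono) (auto intro: bm_integrable)

lemma conv_add: "bm f \<Longrightarrow> bm g \<Longrightarrow> conv (\<lambda>x. f x + g x) x = conv f x + conv g x"
  and conv_diff: "bm f \<Longrightarrow> bm g \<Longrightarrow> conv (\<lambda>x. f x - g x) x = conv f x - conv g x"
  and conv_cmult: "conv (\<lambda>x. k * f x) x = k * conv f x"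
  unfolding conv_def by (simp_all add: bm_integrable)

lemma conv_tendsto_0:
  assumes f: "bm f" and lim: "(f \<longlongrightarrow> 0) at_top"
  shows "(conv f \<longlongrightarrow> 0) at_top"
proof -
  note [measurable] = bmD[OF f]
  obtain K where K: "\<And>x. \<bar>f x\<bar> \<le> K" using f by (auto simp: bm_def)
  have "((\<lambda>x. \<integral>z. f (x - z) \<partial>\<nu>) \<longlongrightarrow> (\<integral>z. 0 \<partial>\<nu>)) at_top"
  proof (rule integral_dominated_convergence_at_top[where w = "\<lambda>_. K"])
    have "filterlim (\<lambda>x::real. x - z) at_top at_top" for z
      using filterlim_tendsto_add_at_top[OF tendsto_const[of "- z"] filterlim_ident] by simp
    then show "AE z in \<nu>. ((\<lambda>x. f (x - z)) \<longlongrightarrow> 0) at_top"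
      by (intro AE_I2 filterlim_compose[OF lim])
  qed (use K in auto)
  then show ?thesis by (simp add: conv_def[abs_def])
qed

text \<open>A quantitative Choquet--Deny argument: if \<open>\<rho>\<close> is nearly harmonic, then its quadratic
  variation \<open>\<phi>\<close> is nearly subharmonic by Jensen's inequality, while
  \<open>conv (\<rho>\<^sup>2) - \<rho>\<^sup>2\<close> is nearly \<open>\<phi>\<close>; telescoping bounds \<open>n \<cdot> \<phi>\<close> by \<open>C\<^sup>2 + o(1)\<close> for every \<open>n\<close>.\<close>

lemma quadratic_variation_tendsto_0:
  assumes bm: "bm \<rho>" and C: "\<And>x. \<bar>\<rho> x\<bar> \<le> C"
    and e: "((\<lambda>x. \<rho> x - conv \<rho> x) \<longlongrightarrow> 0) at_top"
  shows "((\<lambda>x. \<integral>z. (\<rho> (x - z) - \<rho> x)\<^sup>2 \<partial>\<nu>) \<longlongrightarrow> 0) at_top"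
proof -
  let ?u = "\<lambda>x. (\<rho> x)\<^sup>2"
  note [measurable] = bmD[OF bm]
  define e where "e x = \<rho> x - conv \<rho> x" for x
  define \<phi> where "\<phi> x = (\<integral>z. (\<rho> (x - z) - \<rho> x)\<^sup>2 \<partial>\<nu>)" for x
  have C0: "0 \<le> C" using C[of 0] by linarith
  have bme: "bm e" unfolding e_def[abs_def] by (intro bm_simps bm bm_conv)
  note [measurable] = bmD[OF bme]
  have bmu: "bm ?u" unfolding power2_eq_square by (intro bm_simps bm)
  have e_le: "\<bar>e x\<bar> \<le> 2 * C" for x
    using C[of x] conv_abs_le[OF bm C, of x] unfolding e_def by linarith
  have \<phi>_eq: "\<phi> x = conv ?u x - (\<rho> x)\<^sup>2 + 2 * \<rho> x * e x" for x
  proof -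
    have "\<phi> x = (\<integral>z. ((\<rho> (x - z))\<^sup>2 - 2 * \<rho> x * \<rho> (x - z)) + (\<rho> x)\<^sup>2 \<partial>\<nu>)"
      unfolding \<phi>_def by (rule Bochner_Integration.integral_cong) (auto simp: power2_diff)
    also have "\<dots> = conv ?u x - 2 * \<rho> x * conv \<rho> x + (\<rho> x)\<^sup>2"
      using bm_integrable[OF bmu, of x] bm_integrable[OF bm, of x] prob_space
      by (simp add: conv_def)
    finally show ?thesis by (simp add: e_def power2_eq_square algebra_simps)
  qed
  have bm\<phi>: "bm \<phi>"
    unfolding \<phi>_eq[abs_def] by (intro bm_simps bmu bme bm bm_conv)
  note [measurable] = bmD[OF bm\<phi>]
  \<comment> \<open>The factor \<open>8 * C\<close> bounds \<open>\<bar>2 * a + b\<bar>\<close> in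
    the estimate \<open>pt\<close> below.\<close>
  define \<epsilon> where "\<epsilon> x = 8 * C * (conv (\<lambda>x. \<bar>e x\<bar>) x + \<bar>e x\<bar>)" for x
  have bm\<epsilon>: "bm \<epsilon>" unfolding \<epsilon>_def[abs_def] by (intro bm_simps bme bm_conv)
  have lim_e: "(e \<longlongrightarrow> 0) at_top" using e by (simp add: e_def[abs_def])
  then have lim_ae: "((\<lambda>x. \<bar>e x\<bar>) \<longlongrightarrow> 0) at_top" by (rule tendsto_rabs_zero)
  have "((\<lambda>x. 8 * C * (conv (\<lambda>x. \<bar>e x\<bar>) x + \<bar>e x\<bar>)) \<longlongrightarrow> 8 * C * (0 + 0)) at_top"
    by (intro tendsto_intros conv_tendsto_0 lim_ae bm_simps bme)
  then have lim_\<epsilon>: "(\<epsilon> \<longlongrightarrow> 0) at_top" by (simp add: \<epsilon>_def[abs_def])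
  interpret P: pair_prob_space \<nu> \<nu> ..
  have sub: "\<phi> x \<le> conv \<phi> x + \<epsilon> x" for x
  proof -
    let ?d = "\<lambda>z w. \<rho> (x - z - w) - \<rho> (x - w)"
    have dC: "\<bar>?d z w\<bar> \<le> 2 * C" for z w using C[of "x - z - w"] C[of "x - w"] by linarith
    have dC2: "(?d z w)\<^sup>2 \<le> (2 * C)\<^sup>2" for z w
      using dC[of z w] C0 by (metis abs_ge_zero power_mono power2_abs)
    have i1: "integrable \<nu> (\<lambda>w. ?d z w)" for z
      by (rule integrable_const_bound[where B = "2 * C"]) (use dC in auto)
    have i2: "integrable \<nu> (\<lambda>w. (?d z w)\<^sup>2)" for z
      by (rule integrable_const_bound[where B = "(2 * C)\<^sup>2"]) (use dC2 in auto)
    \<comment> \<open>By near harmonicity the increment of \<open>\<rho>\<close> is the mean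
      \<open>a\<close> over \<open>w\<close> of the translated increments \<open>?d z w\<close>, up
      to the error \<open>b\<close>. Jensen's inequality treats \<open>a\<close>; the remaining
      terms cost at most a multiple of \<open>\<bar>b\<bar>\<close>.\<close>
    have pt: "(\<rho> (x - z) - \<rho> x)\<^sup>2 \<le> (\<integral>w. (?d z w)\<^sup>2 \<partial>\<nu>) + 8 * C * (\<bar>e (x - z)\<bar> + \<bar>e x\<bar>)" for z
    proof -
      define a where "a = (\<integral>w. ?d z w \<partial>\<nu>)"
      define b where "b = e (x - z) - e x"
      have a: "a = conv \<rho> (x - z) - conv \<rho> x"
        unfolding a_def conv_def by (simp add: bm_integrable[OF bm])
      have eq: "\<rho> (x - z) - \<rho> x = a + b" by (simp add: a b_def e_def)
      have "0 \<le> (\<integral>w. (?d z w - a)\<^sup>2 \<partial>\<nu>)" by simp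
      also have "\<dots> = (\<integral>w. ((?d z w)\<^sup>2 - 2 * a * ?d z w) + a\<^sup>2 \<partial>\<nu>)"
        by (rule Bochner_Integration.integral_cong) (auto simp: power2_eq_square algebra_simps)
      also have "\<dots> = (\<integral>w. (?d z w)\<^sup>2 \<partial>\<nu>) - 2 * a * a + a\<^sup>2"
        using i1[of z] i2[of z] prob_space by (simp add: a_def)
      finally have jensen: "a\<^sup>2 \<le> (\<integral>w. (?d z w)\<^sup>2 \<partial>\<nu>)" by (simp add: power2_eq_square)
      have aC: "\<bar>a\<bar> \<le> 2 * C" using conv_abs_le[OF bm C, of "x - z"] conv_abs_le[OF bm C, of x] a by linarith
      have bC: "\<bar>b\<bar> \<le> 4 * C" using e_le[of "x - z"] e_le[of x] b_def by linarith
      have "2 * a * b + b\<^sup>2 = (2 * a + b) * b" by (simp add: power2_eq_square algebra_simps)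
      also have "\<dots> \<le> \<bar>2 * a + b\<bar> * \<bar>b\<bar>" by (metis abs_ge_self abs_mult)
      also have "\<dots> \<le> (8 * C) * \<bar>b\<bar>" by (rule mult_right_mono) (use aC bC in linarith, simp)
      also have "\<dots> \<le> (8 * C) * (\<bar>e (x - z)\<bar> + \<bar>e x\<bar>)"
        using C0 by (intro mult_left_mono) (auto simp: b_def)
      finally show ?thesis using jensen unfolding eq power2_sum by linarith
    qed
    have m2: "(\<lambda>p. (?d (fst p) (snd p))\<^sup>2) \<in> borel_measurable (\<nu> \<Otimes>\<^sub>M \<nu>)" by measurable
    have ip: "integrable (\<nu> \<Otimes>\<^sub>M \<nu>) (\<lambda>(z, w). (?d z w)\<^sup>2)"
      by (rule P.P.integrable_const_bound[where B = "(2 * C)\<^sup>2"]) (use dC2 m2 in \<open>auto simp: case_prod_beta\<close>)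
    have iz: "integrable \<nu> (\<lambda>z. \<integral>w. (?d z w)\<^sup>2 \<partial>\<nu>)"
      using P.integrable_fst[OF ip] by simp
    have iae: "integrable \<nu> (\<lambda>z. \<bar>e (x - z)\<bar>)"
      by (rule bm_integrable[of "\<lambda>y. \<bar>e y\<bar>"]) (intro bm_simps bme)
    have "\<phi> x \<le> (\<integral>z. (\<integral>w. (?d z w)\<^sup>2 \<partial>\<nu>) + 8 * C * (\<bar>e (x - z)\<bar> + \<bar>e x\<bar>) \<partial>\<nu>)"
      unfolding \<phi>_def
    proof (rule integral_mono)
      show "integrable \<nu> (\<lambda>z. (\<rho> (x - z) - \<rho> x)\<^sup>2)"
        by (rule bm_integrable[of "\<lambda>y. (\<rho> y - \<rho> x)\<^sup>2"]) (unfold power2_eq_square, intro bm_simps bm)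
    qed (use pt iz iae in auto)
    also have "\<dots> = (\<integral>z. \<integral>w. (?d z w)\<^sup>2 \<partial>\<nu> \<partial>\<nu>) + \<epsilon> x"
      using iz iae prob_space by (simp add: \<epsilon>_def conv_def)
    \<comment> \<open>After the exchange, the inner integral for fixed \<open>w\<close> is
      \<open>\<phi> (x - w)\<close>.\<close>
    also have "(\<integral>z. \<integral>w. (?d z w)\<^sup>2 \<partial>\<nu> \<partial>\<nu>) = (\<integral>w. \<integral>z. (?d z w)\<^sup>2 \<partial>\<nu> \<partial>\<nu>)"
      by (rule P.Fubini_integral[OF ip, symmetric])
    also have "\<dots> = conv \<phi> x"
      unfolding conv_def \<phi>_def by (simp add: algebra_simps)
    finally show ?thesis .
  qed
  \<comment> \<open>The witness \<open>U\<close> is the \<open>n\<close>-fold convolution of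
    \<open>\<rho>^2\<close>, hence bounded by \<open>C^2\<close> for every \<open>n\<close>, and
    \<open>\<delta>\<close> collects the errors. Convolving the inequality for \<open>n\<close> uses
    \<open>sub\<close> on its left side, and \<open>\<phi>_eq\<close> supplies one more
    \<open>\<phi>\<close>.\<close>
  have claim: "\<exists>U \<delta>. bm U \<and> bm \<delta> \<and> (\<forall>x. \<bar>U x\<bar> \<le> C\<^sup>2) \<and> (\<delta> \<longlongrightarrow> 0) at_top \<and>
      (\<forall>x. real n * \<phi> x \<le> U x - (\<rho> x)\<^sup>2 + \<delta> x)" for n
  proof (induction n)
    case 0
    have "\<bar>(\<rho> x)\<^sup>2\<bar> \<le> C\<^sup>2" for x using C[of x] by (metis abs_ge_zero power_mono power2_abs abs_power2)
    then show ?case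
      by (intro exI[of _ ?u] exI[of _ "\<lambda>_. 0"]) (auto intro: bmu bm_simps)
  next
    case (Suc n)
    then obtain U \<delta> where U: "bm U" "bm \<delta>" "\<And>x. \<bar>U x\<bar> \<le> C\<^sup>2" "(\<delta> \<longlongrightarrow> 0) at_top"
      and le: "\<And>x. real n * \<phi> x \<le> U x - (\<rho> x)\<^sup>2 + \<delta> x" by blast
    let ?\<delta> = "\<lambda>x. conv \<delta> x + real n * \<epsilon> x + 2 * \<rho> x * e x"
    have b\<delta>: "bm ?\<delta>" by (intro bm_simps bm_conv U bm\<epsilon> bm bme)
    have "((\<lambda>x. \<rho> x * e x) \<longlongrightarrow> 0) at_top"
    proof (rule Lim_null_comparison)
      show "\<forall>\<^sub>F x in at_top. norm (\<rho> x * e x) \<le> C * \<bar>e x\<bar>"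
        using C by (auto simp: abs_mult intro!: always_eventually mult_right_mono)
      show "((\<lambda>x. C * \<bar>e x\<bar>) \<longlongrightarrow> 0) at_top" using tendsto_mult_right_zero[OF lim_ae] by simp
    qed
    then have "((\<lambda>x. conv \<delta> x + real n * \<epsilon> x + 2 * (\<rho> x * e x)) \<longlongrightarrow> 0 + real n * 0 + 2 * 0) at_top"
      by (intro tendsto_intros conv_tendsto_0 U lim_\<epsilon>)
    then have l\<delta>: "(?\<delta> \<longlongrightarrow> 0) at_top" by (simp add: mult.assoc)
    have "real (Suc n) * \<phi> x \<le> conv U x - (\<rho> x)\<^sup>2 + ?\<delta> x" for x
    proof -
      have "real n * \<phi> x \<le> real n * (conv \<phi> x + \<epsilon> x)" by (intro mult_left_mono sub) simp
      then have "real n * \<phi> x \<le> real n * conv \<phi> x + real n * \<epsilon> x" by (simp only: distrib_left)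
      moreover have "real (Suc n) * \<phi> x = real n * \<phi> x + \<phi> x" by (simp add: algebra_simps)
      moreover have "real n * conv \<phi> x \<le> conv U x - conv ?u x + conv \<delta> x"
        unfolding conv_cmult[symmetric] using U bmu bm\<phi>
        by (subst conv_diff[symmetric], simp, simp, subst conv_add[symmetric])
          (auto intro!: conv_mono bm_simps le)
      ultimately show ?thesis using \<phi>_eq[of x] by linarith
    qed
    then show ?case using bm_conv[OF U(1)] b\<delta> l\<delta> conv_abs_le[OF U(1,3)] by blast
  qed
  have \<phi>_nonneg: "0 \<le> \<phi> x" for x by (simp add: \<phi>_def)
  have "(\<phi> \<longlongrightarrow> 0) at_top"
  proof (rule tendstoI)
    fix \<eta> :: real assume \<eta>: "0 < \<eta>"
    \<comment> \<open>The summand 1 absorbs \<open>\<delta> x\<close>; \<open>n\<close> is fixed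
      before \<open>x\<close> tends to infinity, since \<open>\<delta>\<close> depends on
      it.\<close>
    obtain n where n: "real n > (C\<^sup>2 + 1) / \<eta>" using reals_Archimedean2 by blast
    then have n0: "0 < real n" using \<eta> by (smt (verit) divide_nonneg_pos zero_le_power2)
    from claim[of n] obtain U \<delta> where U: "\<And>x. \<bar>U x\<bar> \<le> C\<^sup>2" "(\<delta> \<longlongrightarrow> 0) at_top"
      "\<And>x. real n * \<phi> x \<le> U x - (\<rho> x)\<^sup>2 + \<delta> x" by blast
    have "\<forall>\<^sub>F x in at_top. \<delta> x < 1" by (rule order_tendstoD(2)[OF U(2)]) simp
    then show "\<forall>\<^sub>F x in at_top. dist (\<phi> x) 0 < \<eta>"
    proof eventually_elim
      fix x assume "\<delta> x < 1"
      then have "real n * \<phi> x < C\<^sup>2 + 1"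
        using U(1)[of x] U(3)[of x] zero_le_power2[of "\<rho> x"] by linarith
      also have "\<dots> < real n * \<eta>" using n \<eta> by (simp add: field_simps)
      finally show "dist (\<phi> x) 0 < \<eta>" using \<phi>_nonneg n0 by simp
    qed
  qed
  then show ?thesis by (simp add: \<phi>_def[abs_def])
qed

end

section \<open>Asymptotic periods of nearly harmonic functions\<close>

lemma filterlim_minus_const_at_top: "filterlim (\<lambda>x::real. x - s) at_top at_top"
  using filterlim_tendsto_add_at_top[OF tendsto_const[of "- s"] filterlim_ident] by simp

text \<open>If positive elements come arbitrarily close to 0, their multiples approach every real,
  and closedness gives everything. Otherwise a least positive element exists and generates the
  group; the trivial group goes into this case with \<open>d = 1\<close>.\<close>

lemma closed_subgroup_real_cases:
  fixes G :: "real set"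
  assumes zero: "0 \<in> G" and add: "\<And>x y. x \<in> G \<Longrightarrow> y \<in> G \<Longrightarrow> x + y \<in> G"
    and neg: "\<And>x. x \<in> G \<Longrightarrow> - x \<in> G"
    and closed: "\<And>x. (\<And>\<epsilon>. \<epsilon> > 0 \<Longrightarrow> \<exists>y\<in>G. \<bar>x - y\<bar> < \<epsilon>) \<Longrightarrow> x \<in> G"
  obtains "G = UNIV" | d where "d > 0" "\<And>x. x \<in> G \<Longrightarrow> \<exists>n::int. x = d * of_int n"
proof -
  have nat_mult: "real n * g \<in> G" if "g \<in> G" for g n
    by (induction n) (use that in \<open>auto simp: zero algebra_simps intro: add\<close>)
  have int_mult: "of_int n * g \<in> G" if "g \<in> G" for g n
  proof (cases "n \<ge> 0")
    case True
    then show ?thesis using nat_mult[OF that, of "nat n"] by simp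
  next
    case False
    then show ?thesis using neg[OF nat_mult[OF that, of "nat (- n)"]] by simp
  qed
  have diff: "x - y \<in> G" if "x \<in> G" "y \<in> G" for x y using add[OF that(1) neg[OF that(2)]] by simp
  have frac: "0 \<le> x - of_int \<lfloor>x / g\<rfloor> * g \<and> x - of_int \<lfloor>x / g\<rfloor> * g < g" if "g > 0" for x g
    using that floor_divide_lower[OF that, of x] floor_divide_upper[OF that, of x] by (auto simp: algebra_simps)
  show thesis
  proof (cases "\<forall>\<epsilon>>0. \<exists>g\<in>G. 0 < g \<and> g < \<epsilon>")
    case True
    have "x \<in> G" for x
    proof (rule closed)
      fix \<epsilon> :: real assume "\<epsilon> > 0"
      then obtain g where g: "g \<in> G" "0 < g" "g < \<epsilon>" using True by blast
      have "\<bar>x - of_int \<lfloor>x / g\<rfloor> * g\<bar> < \<epsilon>" using frac[OF g(2), of x] g by linarith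
      then show "\<exists>y\<in>G. \<bar>x - y\<bar> < \<epsilon>" using int_mult[OF g(1)] by blast
    qed
    then have "G = UNIV" by auto
    then show thesis by (rule that(1))
  next
    case False
    then obtain \<epsilon> where \<epsilon>: "\<epsilon> > 0" "\<And>g. g \<in> G \<Longrightarrow> 0 < g \<Longrightarrow> \<epsilon> \<le> g" by (meson not_less)
    show thesis
    proof (cases "\<exists>g\<in>G. 0 < g")
      case ex: True
      define S where "S = {g\<in>G. 0 < g}"
      define d where "d = Inf S"
      have ne: "S \<noteq> {}" using ex by (auto simp: S_def)
      have bdd: "bdd_below S" by (rule bdd_belowI[of _ 0]) (auto simp: S_def)
      have d\<epsilon>: "\<epsilon> \<le> d" unfolding d_def by (rule cInf_greatest[OF ne]) (auto simp: S_def \<epsilon>)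
      obtain g where g: "g \<in> S" "g < d + \<epsilon>" using cInf_lessD[OF ne, of "d + \<epsilon>"] \<epsilon>(1) d_def by auto
      have dg: "d \<le> g" unfolding d_def by (rule cInf_lower[OF g(1) bdd])
      \<comment> \<open>The infimum is attained: another element of \<open>S\<close> below
        \<open>g\<close> would differ from \<open>g\<close> by less than \<open>\<epsilon>\<close>,
        but the difference is a positive element of \<open>G\<close>.\<close>
      have "d = g"
      proof (rule ccontr)
        assume "d \<noteq> g"
        then obtain g' where g': "g' \<in> S" "g' < g" using cInf_lessD[OF ne, of g] dg d_def by auto
        have "d \<le> g'" unfolding d_def by (rule cInf_lower[OF g'(1) bdd])
        moreover have "\<epsilon> \<le> g - g'" using \<epsilon>(2)[OF diff, of g g'] g g' by (auto simp: S_def)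
        ultimately show False using g by linarith
      qed
      then have d: "d \<in> G" "0 < d" using g by (auto simp: S_def)
      have "\<exists>n::int. x = d * of_int n" if "x \<in> G" for x
      proof -
        let ?y = "x - of_int \<lfloor>x / d\<rfloor> * d"
        have "?y \<in> G" by (intro diff that int_mult d)
        moreover have "?y \<notin> S" using frac[OF d(2), of x] cInf_lower[OF _ bdd, of ?y] unfolding d_def[symmetric] by linarith
        ultimately have "?y = 0" using frac[OF d(2), of x] by (auto simp: S_def)
        then show ?thesis by (intro exI[of _ "\<lfloor>x / d\<rfloor>"]) (simp add: algebra_simps)
      qed
      then show thesis using d(2) by (rule that(2)[rotated])
    next
      case none: False
      have "x = 0" if "x \<in> G" for x using none that neg[OF that] by (metis linorder_neqE neg_0_less_iff_less)
      then show thesis by (intro that(2)[of 1]) (auto intro: exI[of _ 0])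
    qed
  qed
qed

text \<open>The complement of the support is covered by the countably many null intervals with
  rational end points.\<close>

lemma (in convolution) AE_support:
  "AE z in \<nu>. \<forall>\<epsilon>>0. 0 < measure \<nu> {z - \<epsilon><..<z + \<epsilon>}"
proof -
  have "AE z in \<nu>. \<forall>p::rat. \<forall>q::rat. measure \<nu> {of_rat p<..<of_rat q} = 0 \<longrightarrow> z \<notin> {of_rat p<..<of_rat q::real}"
    unfolding AE_all_countable
  proof (intro allI)
    fix p q :: rat
    show "AE z in \<nu>. measure \<nu> {of_rat p<..<of_rat q} = 0 \<longrightarrow> z \<notin> {of_rat p<..<of_rat q::real}"
    proof (cases "measure \<nu> {of_rat p<..<of_rat q} = 0")
      case True
      then show ?thesis
        by (intro AE_I[where N = "{of_rat p<..<of_rat q}"]) (auto simp: emeasure_eq_measure)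
    qed simp
  qed
  then show ?thesis
  proof eventually_elim
    fix z :: real
    assume z: "\<forall>p::rat. \<forall>q::rat. measure \<nu> {of_rat p<..<of_rat q} = 0 \<longrightarrow> z \<notin> {of_rat p<..<of_rat q::real}"
    show "\<forall>\<epsilon>>0. 0 < measure \<nu> {z - \<epsilon><..<z + \<epsilon>}"
    proof (intro allI impI)
      fix \<epsilon> :: real assume "0 < \<epsilon>"
      obtain p where p: "z - \<epsilon> < of_rat p" "of_rat p < z" using of_rat_dense[of "z - \<epsilon>" z] \<open>0 < \<epsilon>\<close> by auto
      obtain q where q: "z < of_rat q" "of_rat q < z + \<epsilon>" using of_rat_dense[of z "z + \<epsilon>"] \<open>0 < \<epsilon>\<close> by auto
      have "0 < measure \<nu> {of_rat p<..<of_rat q}"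
        using z p q measure_nonneg[of \<nu> "{of_rat p<..<of_rat q}"] by (metis greaterThanLessThan_iff order_le_less)
      also have "\<dots> \<le> measure \<nu> {z - \<epsilon><..<z + \<epsilon>}"
        using p q by (intro finite_measure_mono) auto
      finally show "0 < measure \<nu> {z - \<epsilon><..<z + \<epsilon>}" .
    qed
  qed
qed

text \<open>The asymptotic periods of \<open>\<rho>\<close> form a group \<open>G\<close>, closed
  because \<open>\<rho>\<close> is Lipschitz. Vanishing quadratic variation puts the support of
  \<open>\<nu>\<close> into \<open>G\<close>, and a non-arithmetic law does not fit into any
  \<open>d * of_int n\<close>, so \<open>G\<close> is everything.\<close>

lemma (in convolution) shift_difference_tendsto_0:
  assumes na: "non_arithmetic \<nu>" and bm: "bm \<rho>"
    and lip: "\<And>x y. \<bar>\<rho> x - \<rho> y\<bar> \<le> L * \<bar>x - y\<bar>"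
    and e: "((\<lambda>x. \<rho> x - conv \<rho> x) \<longlongrightarrow> 0) at_top"
  shows "((\<lambda>x. \<rho> (x - s) - \<rho> x) \<longlongrightarrow> 0) at_top"
proof -
  note [measurable] = bmD[OF bm]
  define \<phi> where "\<phi> x = (\<integral>z. (\<rho> (x - z) - \<rho> x)\<^sup>2 \<partial>\<nu>)" for x
  define G where "G = {s. ((\<lambda>x. \<rho> (x - s) - \<rho> x) \<longlongrightarrow> 0) at_top}"
  obtain C where C: "\<And>x. \<bar>\<rho> x\<bar> \<le> C" using bm by (auto simp: bm_def)
  have lim: "(\<phi> \<longlongrightarrow> 0) at_top"
    using quadratic_variation_tendsto_0[OF bm C e] by (simp add: \<phi>_def[abs_def])
  have L0: "0 \<le> L" using order_trans[OF abs_ge_zero lip[of 0 1]] by simp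
  have zero: "0 \<in> G" by (simp add: G_def)
  have add: "s + t \<in> G" if "s \<in> G" "t \<in> G" for s t
  proof -
    have "((\<lambda>x. (\<rho> (x - s - t) - \<rho> (x - s)) + (\<rho> (x - s) - \<rho> x)) \<longlongrightarrow> 0 + 0) at_top"
      using that unfolding G_def
      by (intro tendsto_add filterlim_compose[OF _ filterlim_minus_const_at_top, of "\<lambda>x. \<rho> (x - t) - \<rho> x"]) auto
    then show ?thesis by (simp add: G_def algebra_simps)
  qed
  have neg: "- s \<in> G" if "s \<in> G" for s
  proof -
    have "((\<lambda>x. - (\<rho> (x - (- s) - s) - \<rho> (x - (- s)))) \<longlongrightarrow> - 0) at_top"
      using that unfolding G_def
      by (intro tendsto_minus filterlim_compose[OF _ filterlim_minus_const_at_top, of "\<lambda>x. \<rho> (x - s) - \<rho> x"]) auto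
    then show ?thesis by (simp add: G_def)
  qed
  have closed: "s \<in> G" if cl: "\<And>\<epsilon>. \<epsilon> > 0 \<Longrightarrow> \<exists>t\<in>G. \<bar>s - t\<bar> < \<epsilon>" for s
    unfolding G_def mem_Collect_eq
  proof (rule tendstoI)
    fix \<eta> :: real assume \<eta>: "0 < \<eta>"
    \<comment> \<open>Dividing by \<open>L + 1\<close> instead of \<open>L\<close> covers
      \<open>L = 0\<close>.\<close>
    obtain t where t: "t \<in> G" "\<bar>s - t\<bar> < \<eta> / (2 * (L + 1))"
      using cl[of "\<eta> / (2 * (L + 1))"] \<eta> L0 by auto
    have Lt: "L * \<bar>s - t\<bar> \<le> \<eta> / 2"
    proof -
      have "L * \<bar>s - t\<bar> \<le> (L + 1) * (\<eta> / (2 * (L + 1)))"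
        using L0 t(2) by (intro mult_mono) auto
      also have "\<dots> = \<eta> / 2" using L0 by (simp add: field_simps)
      finally show ?thesis .
    qed
    have "\<forall>\<^sub>F x in at_top. dist (\<rho> (x - t) - \<rho> x) 0 < \<eta> / 2"
      using t(1) \<eta> unfolding G_def by (intro tendstoD) auto
    then show "\<forall>\<^sub>F x in at_top. dist (\<rho> (x - s) - \<rho> x) 0 < \<eta>"
    proof eventually_elim
      fix x assume "dist (\<rho> (x - t) - \<rho> x) 0 < \<eta> / 2"
      then show "dist (\<rho> (x - s) - \<rho> x) 0 < \<eta>"
        using lip[of "x - s" "x - t"] Lt abs_triangle_ineq[of "\<rho> (x - s) - \<rho> (x - t)" "\<rho> (x - t) - \<rho> x"]
        by (simp add: abs_minus_commute)
    qed
  qed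
  have supp: "s \<in> G" if pos: "\<forall>\<epsilon>>0. 0 < measure \<nu> {s - \<epsilon><..<s + \<epsilon>}" for s
    unfolding G_def mem_Collect_eq
  proof (rule tendstoI)
    fix \<eta> :: real assume \<eta>: "0 < \<eta>"
    define \<epsilon> where "\<epsilon> = \<eta> / (2 * (L + 1))"
    have \<epsilon>: "0 < \<epsilon>" "L * \<epsilon> \<le> \<eta> / 2"
      using \<eta> L0 by (auto simp: \<epsilon>_def field_simps mult_left_mono)
    define p where "p = measure \<nu> {s - \<epsilon><..<s + \<epsilon>}"
    have p: "0 < p" using pos \<epsilon>(1) by (simp add: p_def)
    have "\<forall>\<^sub>F x in at_top. \<phi> x < p * (\<eta> / 2)\<^sup>2"
      by (rule order_tendstoD(2)[OF lim]) (use p \<eta> in auto)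
    then show "\<forall>\<^sub>F x in at_top. dist (\<rho> (x - s) - \<rho> x) 0 < \<eta>"
    proof eventually_elim
      fix x assume small: "\<phi> x < p * (\<eta> / 2)\<^sup>2"
      show "dist (\<rho> (x - s) - \<rho> x) 0 < \<eta>"
      proof (rule ccontr)
        assume "\<not> ?thesis"
        then have big: "\<eta> \<le> \<bar>\<rho> (x - s) - \<rho> x\<bar>" by simp
        \<comment> \<open>A large increment at \<open>s\<close> stays above
          \<open>\<eta> / 2\<close> for all \<open>z\<close> within \<open>\<epsilon>\<close> of
          \<open>s\<close>, by the Lipschitz bound; this set has mass \<open>p\<close>, so
          \<open>\<phi> x\<close> cannot be small.\<close>
        have "(\<integral>z. (\<eta> / 2)\<^sup>2 * indicator {s - \<epsilon><..<s + \<epsilon>} z \<partial>\<nu>) \<le> \<phi> x"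
          unfolding \<phi>_def
        proof (rule integral_mono)
          show "integrable \<nu> (\<lambda>z. (\<rho> (x - z) - \<rho> x)\<^sup>2)"
            by (rule bm_integrable[of "\<lambda>y. (\<rho> y - \<rho> x)\<^sup>2"]) (unfold power2_eq_square, intro bm_simps bm)
          show "(\<eta> / 2)\<^sup>2 * indicator {s - \<epsilon><..<s + \<epsilon>} z \<le> (\<rho> (x - z) - \<rho> x)\<^sup>2" for z
          proof (cases "z \<in> {s - \<epsilon><..<s + \<epsilon>}")
            case True
            then have "\<bar>z - s\<bar> \<le> \<epsilon>" by auto
            then have "L * \<bar>z - s\<bar> \<le> \<eta> / 2" using mult_left_mono[OF _ L0] \<epsilon>(2) by (meson order_trans)
            then have "\<eta> / 2 \<le> \<bar>\<rho> (x - z) - \<rho> x\<bar>"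
              using lip[of "x - s" "x - z"] big abs_triangle_ineq[of "\<rho> (x - s) - \<rho> (x - z)" "\<rho> (x - z) - \<rho> x"]
              by simp
            then have "(\<eta> / 2)\<^sup>2 \<le> \<bar>\<rho> (x - z) - \<rho> x\<bar>\<^sup>2" using \<eta> by (intro power_mono) auto
            then show ?thesis using True by simp
          qed simp
          show "integrable \<nu> (\<lambda>z. (\<eta> / 2)\<^sup>2 * indicator {s - \<epsilon><..<s + \<epsilon>} z)"
            by (intro integrable_mult_right integrable_real_indicator) (auto simp: emeasure_eq_measure)
        qed
        then show False using small by (simp add: p_def mult.commute)
      qed
    qed
  qed
  from zero add neg closed have "G = UNIV"
  proof (rule closed_subgroup_real_cases)
    fix d :: real assume d: "d > 0" "\<And>x. x \<in> G \<Longrightarrow> \<exists>n::int. x = d * of_int n"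
    have "AE z in \<nu>. \<exists>n::int. z = d * of_int n"
      using AE_support by eventually_elim (intro d supp)
    then show "G = UNIV" using na d(1) by (auto simp: non_arithmetic_def)
  qed
  then show ?thesis unfolding G_def by blast
qed

section \<open>The limiting mean overshoot\<close>

lemma integrable_indicator_Ico: "integrable lborel (indicator {x..<y::real} :: real \<Rightarrow> real)"
  by (cases "x \<le> y") (auto simp: integrable_indicator_iff)

lemma integrable_interval_bounded:
  fixes g :: "real \<Rightarrow> real"
  assumes [measurable]: "g \<in> borel_measurable borel" and K: "\<And>t. t \<in> {x..<y} \<Longrightarrow> \<bar>g t\<bar> \<le> K"
  shows "integrable lborel (\<lambda>t. indicator {x..<y} t * g t)"
proof (rule Bochner_Integration.integrable_bound)
  show "integrable lborel (\<lambda>t. K * indicator {x..<y} t)"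
    by (intro integrable_mult_right integrable_indicator_Ico)
qed (use K in \<open>auto simp: indicator_def intro: order_trans[OF _ abs_ge_self]\<close>)

context ladder_factor begin

sublocale cv: convolution \<nu> by unfold_locales simp

text \<open>Below 0 the function \<open>r\<close> is unbounded. Cutting it off there makes it
  bounded and turns harmonicity into a renewal equation with source
  \<open>max 0 (z - x)\<close>.\<close>

definition rt :: "real \<Rightarrow> real" where "rt x = (if x < 0 then 0 else r x)"

lemma rt_measurable [measurable]: "rt \<in> borel_measurable borel"
  unfolding rt_def[abs_def] by measurable

lemma rt_nonneg [simp]: "0 \<le> rt x" and rt_le: "rt x \<le> Cr"
  by (auto simp: rt_def r_le Cr_nonneg)

lemma r_eq_rt: "r x = rt x + max 0 (- x)"
  by (simp add: rt_def r_neg)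

text \<open>Integration supplies the regularity that \<open>rt\<close> may lack: \<open>R\<close> is
  Lipschitz with constant \<open>Cr\<close>, which is what \<open>shift_difference_tendsto_0\<close>
  requires of window integrals.\<close>

definition J :: "real \<Rightarrow> real \<Rightarrow> real" where "J x y = (\<integral>t. indicator {x..<y} t * rt t \<partial>lborel)"
definition R :: "real \<Rightarrow> real" where "R x = J 0 x"

lemma integrable_J [simp]: "integrable lborel (\<lambda>t. indicator {x..<y} t * rt t)"
  by (rule integrable_interval_bounded[where K = Cr]) (auto simp: rt_le)

lemma J_bounds:
  assumes "x \<le> y"
    and lo: "\<And>t. t \<in> {x..<y} \<Longrightarrow> l \<le> rt t" and up: "\<And>t. t \<in> {x..<y} \<Longrightarrow> rt t \<le> u"
  shows "l * (y - x) \<le> J x y" "J x y \<le> u * (y - x)"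
proof -
  have i: "integrable lborel (\<lambda>t. k * indicator {x..<y} t :: real)" for k
    by (intro integrable_mult_right integrable_indicator_Ico)
  have e: "(\<integral>t. k * indicator {x..<y} t \<partial>lborel) = k * (y - x)" for k :: real
    using assms(1) by simp
  show "l * (y - x) \<le> J x y"
    unfolding J_def e[symmetric] by (rule integral_mono[OF i integrable_J]) (auto simp: indicator_def lo)
  show "J x y \<le> u * (y - x)"
    unfolding J_def e[symmetric] by (rule integral_mono[OF integrable_J i]) (auto simp: indicator_def up)
qed

lemma J_nonneg: "x \<le> y \<Longrightarrow> 0 \<le> J x y" and J_le: "x \<le> y \<Longrightarrow> J x y \<le> Cr * (y - x)"
  using J_bounds[of x y 0 Cr] rt_le by auto

lemma J_split:
  assumes "x \<le> y" "y \<le> z" shows "J x z = J x y + J y z"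
proof -
  have "indicator {x..<z} t * rt t = indicator {x..<y} t * rt t + indicator {y..<z} t * rt t" for t
    using assms by (auto simp: indicator_def)
  then show ?thesis unfolding J_def by simp
qed

lemma J_nonpos: "y \<le> 0 \<Longrightarrow> J x y = 0"
proof -
  assume "y \<le> 0"
  then have "(\<lambda>t. indicator {x..<y} t * rt t) = (\<lambda>t. 0)" by (auto simp: indicator_def rt_def)
  then show ?thesis by (simp add: J_def)
qed

lemma R_nonpos: "x \<le> 0 \<Longrightarrow> R x = 0"
  by (simp add: R_def J_nonpos)

lemma R_diff: "x \<le> y \<Longrightarrow> R y - R x = J x y"
proof -
  assume xy: "x \<le> y"
  consider "0 \<le> x" | "x < 0" "y \<le> 0" | "x < 0" "0 < y" by linarith
  then show ?thesis
  proof cases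
    case 1
    then show ?thesis using J_split[of 0 x y] xy by (simp add: R_def)
  next
    case 2
    then show ?thesis by (simp add: R_nonpos J_nonpos)
  next
    case 3
    then show ?thesis using J_split[of x 0 y] by (simp add: R_nonpos J_nonpos R_def)
  qed
qed

lemma R_mono: "x \<le> y \<Longrightarrow> R x \<le> R y"
  using R_diff[of x y] J_nonneg[of x y] by linarith

lemma R_nonneg: "0 \<le> R x"
  using R_mono[of "min 0 x" x] R_nonpos[of "min 0 x"] by simp

lemma R_lipschitz: "\<bar>R x - R y\<bar> \<le> Cr * \<bar>x - y\<bar>"
proof -
  have *: "\<bar>R x - R y\<bar> \<le> Cr * \<bar>x - y\<bar>" if "x \<le> y" for x y
    using R_diff[OF that] J_nonneg[OF that] J_le[OF that] that by simp
  show ?thesis using *[of x y] *[of y x] by (cases "x \<le> y") (auto simp: abs_minus_commute)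
qed

lemma R_measurable [measurable]: "R \<in> borel_measurable borel"
  by (intro borel_measurable_mono monoI R_mono)

text \<open>Stated for a general law \<open>\<mu>\<close> because it is used twice: with
  \<open>\<nu>\<close> for translation invariance and with \<open>\<eta>\<close> for the value of
  the limit. The premise \<open>0 \<le> x\<close> keeps the whole window where the renewal equation
  holds.\<close>

lemma renewal_increment:
  fixes \<mu> :: "real measure"
  assumes \<mu>: "prob_space \<mu>" and [simp, measurable_cong]: "sets \<mu> = sets borel"
    and int: "integrable \<mu> (\<lambda>z. z)"
    and eq: "\<And>x. 0 \<le> x \<Longrightarrow> rt x = (\<integral>z. rt (x - z) \<partial>\<mu>) + (\<integral>z. max 0 (z - x) \<partial>\<mu>)"
    and x: "0 \<le> x"
  shows "J x y = (\<integral>z. J (x - z) (y - z) \<partial>\<mu>) + (\<integral>t. indicator {x..<y} t * (\<integral>z. max 0 (z - t) \<partial>\<mu>) \<partial>lborel)"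
    (is "_ = _ + ?m")
    and "(\<integral>t. indicator {x..<y} t * (\<integral>z. max 0 (z - t) \<partial>\<mu>) \<partial>lborel) =
      (\<integral>z. (\<integral>t. indicator {x..<y} t * max 0 (z - t) \<partial>lborel) \<partial>\<mu>)"
proof -
  interpret \<mu>: prob_space \<mu> by fact
  interpret P: pair_sigma_finite lborel \<mu> ..
  have sp [simp]: "space \<mu> = UNIV" using sets_eq_imp_space_eq[of \<mu> borel] by simp
  have bmc [simp]: "borel_measurable \<mu> = borel_measurable borel" by (auto intro!: measurable_cong_sets)
  have ind: "integrable lborel (indicator {x..<y} :: real \<Rightarrow> real)"
    by (rule integrable_indicator_Ico)
  have h1: "integrable (lborel \<Otimes>\<^sub>M \<mu>) (\<lambda>p. indicator {x..<y} (fst p) * Cr)"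
    using P.has_bochner_integral_times[OF ind, of "\<lambda>_. Cr"] by (simp add: has_bochner_integral_iff)
  have h2: "integrable (lborel \<Otimes>\<^sub>M \<mu>) (\<lambda>p. indicator {x..<y} (fst p) * \<bar>snd p\<bar>)"
    using P.has_bochner_integral_times[OF ind integrable_abs[OF int]] by (simp add: has_bochner_integral_iff)
  have i1: "integrable (lborel \<Otimes>\<^sub>M \<mu>) (\<lambda>(t, z). indicator {x..<y} t * rt (t - z))"
    unfolding case_prod_beta
    by (rule Bochner_Integration.integrable_bound[OF h1]) (auto simp: indicator_def Cr_nonneg rt_le)
  have i2: "integrable (lborel \<Otimes>\<^sub>M \<mu>) (\<lambda>(t, z). indicator {x..<y} t * max 0 (z - t))"
    unfolding case_prod_beta
    by (rule Bochner_Integration.integrable_bound[OF h2]) (use x in \<open>auto simp: indicator_def\<close>)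
  have i1': "integrable lborel (\<lambda>t. indicator {x..<y} t * (\<integral>z. rt (t - z) \<partial>\<mu>))"
    using P.integrable_fst[OF i1] by simp
  have i2': "integrable lborel (\<lambda>t. indicator {x..<y} t * (\<integral>z. max 0 (z - t) \<partial>\<mu>))"
    using P.integrable_fst[OF i2] by simp
  show "?m =
      (\<integral>z. (\<integral>t. indicator {x..<y} t * max 0 (z - t) \<partial>lborel) \<partial>\<mu>)"
    using P.Fubini_integral[OF i2] by simp
  have "J x y = (\<integral>t. indicator {x..<y} t * (\<integral>z. rt (t - z) \<partial>\<mu>) +
      indicator {x..<y} t * (\<integral>z. max 0 (z - t) \<partial>\<mu>) \<partial>lborel)"
    unfolding J_def
  proof (rule Bochner_Integration.integral_cong[OF refl])
    fix t :: real
    show "indicator {x..<y} t * rt t = indicator {x..<y} t * (\<integral>z. rt (t - z) \<partial>\<mu>) +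
      indicator {x..<y} t * (\<integral>z. max 0 (z - t) \<partial>\<mu>)"
      using eq[of t] x by (auto simp: indicator_def)
  qed
  also have "\<dots> = (\<integral>t. indicator {x..<y} t * (\<integral>z. rt (t - z) \<partial>\<mu>) \<partial>lborel) +
      ?m"
    by (rule Bochner_Integration.integral_add[OF i1' i2'])
  also have "(\<integral>t. indicator {x..<y} t * (\<integral>z. rt (t - z) \<partial>\<mu>) \<partial>lborel) =
      (\<integral>z. (\<integral>t. indicator {x..<y} t * rt (t - z) \<partial>lborel) \<partial>\<mu>)"
    using P.Fubini_integral[OF i1] by simp
  also have "(\<lambda>z. \<integral>t. indicator {x..<y} t * rt (t - z) \<partial>lborel) = (\<lambda>z. J (x - z) (y - z))"
  proof
    fix z
    show "(\<integral>t. indicator {x..<y} t * rt (t - z) \<partial>lborel) = J (x - z) (y - z)"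
      unfolding J_def
      by (subst lborel_integral_real_affine[where c = 1 and t = z])
        (auto intro!: Bochner_Integration.integral_cong simp: indicator_def)
  qed
  finally show "J x y = (\<integral>z. J (x - z) (y - z) \<partial>\<mu>) + ?m" .
qed

lemma r_renewal_imp_rt:
  fixes \<mu> :: "real measure"
  assumes \<mu>: "prob_space \<mu>" and [simp, measurable_cong]: "sets \<mu> = sets borel"
    and int: "integrable \<mu> (\<lambda>z. z)"
    and eq: "(\<integral>\<^sup>+z. ennreal (r (x - z)) \<partial>\<mu>) = ennreal (r x)" and x: "0 \<le> x"
  shows "rt x = (\<integral>z. rt (x - z) \<partial>\<mu>) + (\<integral>z. max 0 (z - x) \<partial>\<mu>)"
proof -
  interpret \<mu>: prob_space \<mu> by fact
  have [simp]: "borel_measurable \<mu> = borel_measurable borel" by (auto intro!: measurable_cong_sets)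
  have i1: "integrable \<mu> (\<lambda>z. rt (x - z))"
    by (rule \<mu>.integrable_const_bound[where B = Cr]) (auto simp: rt_le)
  have i2: "integrable \<mu> (\<lambda>z. max 0 (z - x))"
    by (rule Bochner_Integration.integrable_bound[OF integrable_abs[OF int]]) (use x in auto)
  have "ennreal (r x) = (\<integral>\<^sup>+z. ennreal (rt (x - z) + max 0 (z - x)) \<partial>\<mu>)"
    unfolding eq[symmetric] by (simp add: r_eq_rt)
  also have "\<dots> = ennreal (\<integral>z. rt (x - z) + max 0 (z - x) \<partial>\<mu>)"
    by (rule nn_integral_eq_integral) (use i1 i2 in auto)
  finally have "r x = (\<integral>z. rt (x - z) + max 0 (z - x) \<partial>\<mu>)"
    by (simp add: ennreal_inj integral_nonneg_AE)
  then show ?thesis using i1 i2 x by (simp add: rt_def)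
qed

text \<open>Dynkin's identity for \<open>u \<mapsto> r (x - u)\<close>: for \<open>v \<le> 0\<close>
  the point \<open>x - v\<close> is nonnegative, so averaging over \<open>z\<close> reproduces
  \<open>r (x - v)\<close>. The two integrals over \<open>V\<close> then agree, and they are finite
  since \<open>r \<le> Cr\<close> there.\<close>

lemma r_harmonic_ladder:
  assumes x: "0 \<le> x"
  shows "(\<integral>\<^sup>+y. ennreal (r (x - y)) \<partial>\<eta>) = ennreal (r x)"
proof -
  have "(\<integral>\<^sup>+v. (\<integral>\<^sup>+z. ennreal (r (x - (v + z))) \<partial>\<nu>) \<partial>V) = (\<integral>\<^sup>+v. ennreal (r (x - v)) \<partial>V)"
  proof (rule nn_integral_cong_AE)
    show "AE v in V. (\<integral>\<^sup>+z. ennreal (r (x - (v + z))) \<partial>\<nu>) = ennreal (r (x - v))"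
      using V_nonpos by eventually_elim (use r_harmonic x in \<open>simp add: diff_diff_eq[symmetric]\<close>)
  qed
  moreover have "(\<integral>\<^sup>+v. ennreal (r (x - v)) \<partial>V) \<noteq> top"
  proof -
    have "(\<integral>\<^sup>+v. ennreal (r (x - v)) \<partial>V) \<le> (\<integral>\<^sup>+v. ennreal Cr \<partial>V)"
      by (rule nn_integral_mono_AE) (use V_nonpos x in \<open>auto elim!: eventually_mono intro!: ennreal_leI r_le\<close>)
    also have "\<dots> < top" by (simp add: emeasure_V ennreal_mult_less_top)
    finally show ?thesis by simp
  qed
  ultimately show ?thesis
    using dynkin[of "\<lambda>u. ennreal (r (x - u))"] by (simp add: ennreal_add_left_cancel)
qed

section \<open>Asymptotic linearity of the integrated overshoot\<close>

definition T :: "real \<Rightarrow> real \<Rightarrow> real" where "T x s = R x - R (x - s)"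

lemma T_le: "\<bar>T x s\<bar> \<le> Cr * \<bar>s\<bar>"
  unfolding T_def using R_lipschitz[of x "x - s"] by simp

text \<open>The window integral \<open>D\<close> meets the conditions of
  \<open>shift_difference_tendsto_0\<close>: it is bounded and Lipschitz through \<open>R\<close>,
  and its defect, the integrated source, lies between 0 and \<open>a * \<psi> x\<close> for
  \<open>x \<ge> 0\<close>.\<close>

lemma T_shift_tendsto:
  assumes na: "non_arithmetic \<nu>" and a: "0 \<le> a"
  shows "((\<lambda>x. T (x - s) a - T x a) \<longlongrightarrow> 0) at_top"
proof -
  define D where "D x = R (x + a) - R x" for x
  have bm: "cv.bm D"
  proof -
    have "\<bar>D x\<bar> \<le> Cr * a" for x unfolding D_def using R_lipschitz[of "x + a" x] a by simp
    moreover have "D \<in> borel_measurable borel" unfolding D_def[abs_def] by measurable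
    ultimately show ?thesis by (auto simp: cv.bm_def)
  qed
  have lip: "\<bar>D x - D y\<bar> \<le> (2 * Cr) * \<bar>x - y\<bar>" for x y
    unfolding D_def using R_lipschitz[of "x + a" "y + a"] R_lipschitz[of x y] by simp
  have D_J: "D x = J x (x + a)" for x unfolding D_def using a by (simp add: R_diff)
  let ?e = "\<lambda>x. D x - cv.conv D x"
  have e: "0 \<le> ?e x \<and> ?e x \<le> a * \<psi> x" if x: "0 \<le> x" for x
  proof -
    have eq: "rt x = (\<integral>z. rt (x - z) \<partial>\<nu>) + (\<integral>z. max 0 (z - x) \<partial>\<nu>)" if "0 \<le> x" for x
      by (rule r_renewal_imp_rt[OF \<nu>.prob_space_axioms _ _ r_harmonic]) (use that in auto)
    have "J x (x + a) = (\<integral>z. J (x - z) (x + a - z) \<partial>\<nu>) + (\<integral>t. indicator {x..<x + a} t * \<psi> t \<partial>lborel)"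
      unfolding \<psi>_def by (rule renewal_increment(1)[OF \<nu>.prob_space_axioms _ _ eq x]) auto
    also have "(\<integral>z. J (x - z) (x + a - z) \<partial>\<nu>) = cv.conv D x"
      unfolding cv.conv_def D_J by (simp add: algebra_simps)
    finally have "?e x = (\<integral>t. indicator {x..<x + a} t * \<psi> t \<partial>lborel)" by (simp add: D_J)
    moreover have "(\<integral>t. indicator {x..<x + a} t * \<psi> t \<partial>lborel) \<le> (\<integral>t. \<psi> x * indicator {x..<x + a} t \<partial>lborel)"
    proof (rule integral_mono)
      have [measurable]: "\<psi> \<in> borel_measurable borel" unfolding \<psi>_def[abs_def] by measurable
      show "integrable lborel (\<lambda>t. indicator {x..<x + a} t * \<psi> t)"
        by (rule integrable_interval_bounded[where K = "\<psi> x"]) (auto intro: \<psi>_antimono)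
      show "integrable lborel (\<lambda>t. \<psi> x * indicator {x..<x + a} t)"
        by (intro integrable_mult_right integrable_indicator_Ico)
    qed (auto simp: indicator_def \<psi>_antimono)
    moreover have "(\<integral>t. \<psi> x * indicator {x..<x + a} t \<partial>lborel) = a * \<psi> x" using a by simp
    moreover have "0 \<le> (\<integral>t. indicator {x..<x + a} t * \<psi> t \<partial>lborel)" by simp
    ultimately show ?thesis by linarith
  qed
  have "(?e \<longlongrightarrow> 0) at_top"
  proof (rule tendsto_sandwich)
    show "\<forall>\<^sub>F x in at_top. 0 \<le> ?e x" "\<forall>\<^sub>F x in at_top. ?e x \<le> a * \<psi> x"
      using eventually_ge_at_top[of 0] by (eventually_elim, use e in blast)+
    show "((\<lambda>x. a * \<psi> x) \<longlongrightarrow> 0) at_top" using tendsto_mult_right_zero[OF \<psi>_tendsto] by simp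
  qed simp
  from cv.shift_difference_tendsto_0[OF na bm lip this]
  have "((\<lambda>x. D (x - s) - D x) \<longlongrightarrow> 0) at_top" .
  \<comment> \<open>\<open>D\<close> looks forward from \<open>x\<close> and \<open>T\<close>
    backward, hence the shift by \<open>a\<close>.\<close>
  then have "((\<lambda>x. D (x - a - s) - D (x - a)) \<longlongrightarrow> 0) at_top"
    by (rule filterlim_compose[OF _ filterlim_minus_const_at_top])
  then show ?thesis by (simp add: D_def T_def algebra_simps)
qed

lemma T_multiple_tendsto:
  assumes na: "non_arithmetic \<nu>" and a: "0 \<le> a"
  shows "((\<lambda>x. T x (real n * a) - real n * T x a) \<longlongrightarrow> 0) at_top"
proof (induction n)
  case 0
  then show ?case by (simp add: T_def)
next
  case (Suc n)
  have "((\<lambda>x. (T x (real n * a) - real n * T x a) + (T (x - real n * a) a - T x a)) \<longlongrightarrow> 0 + 0) at_top"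
    by (intro tendsto_add Suc T_shift_tendsto na a)
  then show ?case by (simp add: T_def algebra_simps)
qed

text \<open>Cauchy's functional equation in the limit: asymptotic additivity settles rational
  \<open>s\<close>, and the Lipschitz bound for \<open>R\<close> carries the result to real
  \<open>s\<close> with an error \<open>Cr / n\<close> in each of the two terms.\<close>

lemma T_linear_tendsto:
  assumes na: "non_arithmetic \<nu>" and s: "0 \<le> s"
  shows "((\<lambda>x. T x s - s * T x 1) \<longlongrightarrow> 0) at_top"
proof (rule tendstoI)
  fix \<epsilon> :: real assume \<epsilon>: "0 < \<epsilon>"
  obtain n where n: "real n > 4 * Cr / \<epsilon> + 1" using reals_Archimedean2 by blast
  have n0: "0 < real n" using n Cr_nonneg \<epsilon> by (smt (verit) divide_nonneg_pos)
  have Crn: "Cr / n < \<epsilon> / 4" using n n0 \<epsilon> by (simp add: field_simps)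
  define k where "k = nat \<lfloor>s * n\<rfloor>"
  have k: "real k = of_int \<lfloor>s * n\<rfloor>" using s by (simp add: k_def)
  have "real k \<le> s * n" "s * n < real k + 1" unfolding k by linarith+
  then have "\<bar>s * n - k\<bar> / n \<le> 1 / n" by (intro divide_right_mono) auto
  moreover have "s - k * (1 / n) = (s * n - k) / n" using n0 by (simp add: field_simps)
  ultimately have sk: "\<bar>s - k * (1 / n)\<bar> \<le> 1 / n" by simp
  let ?q = "k * (1 / n)"
  \<comment> \<open>Both instances of \<open>T_multiple_tendsto\<close> refer to
    \<open>T x (1 / n)\<close>, which cancels and leaves a relation between \<open>T x ?q\<close>
    and \<open>T x 1\<close>.\<close>
  have "((\<lambda>x. (T x (real k * (1 / n)) - real k * T x (1 / n)) - real k / n * (T x (real n * (1 / n)) - real n * T x (1 / n)))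
      \<longlongrightarrow> 0 - real k / n * 0) at_top"
    by (intro tendsto_diff tendsto_mult tendsto_const T_multiple_tendsto na) auto
  then have "((\<lambda>x. T x ?q - ?q * T x 1) \<longlongrightarrow> 0) at_top"
    using n0 by (simp add: algebra_simps)
  then have "\<forall>\<^sub>F x in at_top. dist (T x ?q - ?q * T x 1) 0 < \<epsilon> / 4"
    by (rule tendstoD) (use \<epsilon> in simp)
  then show "\<forall>\<^sub>F x in at_top. dist (T x s - s * T x 1) 0 < \<epsilon>"
  proof eventually_elim
    fix x assume d: "dist (T x ?q - ?q * T x 1) 0 < \<epsilon> / 4"
    have "\<bar>T x s - T x ?q\<bar> \<le> Cr * \<bar>s - ?q\<bar>"
      unfolding T_def using R_lipschitz[of "x - ?q" "x - s"] by simp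
    also have "\<dots> \<le> Cr * (1 / n)" using sk Cr_nonneg by (rule mult_left_mono)
    finally have 1: "\<bar>T x s - T x ?q\<bar> \<le> Cr / n" by simp
    have "\<bar>(s - ?q) * T x 1\<bar> \<le> (1 / n) * Cr"
      unfolding abs_mult using sk T_le[of x 1] by (intro mult_mono) auto
    then have 2: "\<bar>(s - ?q) * T x 1\<bar> \<le> Cr / n" by simp
    have tri: "\<bar>u + v - w\<bar> \<le> \<bar>u\<bar> + \<bar>v\<bar> + \<bar>w\<bar>" for u v w :: real by linarith
    have "T x s - s * T x 1 = (T x s - T x ?q) + (T x ?q - ?q * T x 1) - (s - ?q) * T x 1"
      by (simp add: algebra_simps)
    then have "\<bar>T x s - s * T x 1\<bar> \<le> \<bar>T x s - T x ?q\<bar> + \<bar>T x ?q - ?q * T x 1\<bar> + \<bar>(s - ?q) * T x 1\<bar>"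
      by (simp only: tri)
    also have "\<dots> < Cr / n + \<epsilon> / 4 + Cr / n"
      using d by (intro add_less_le_mono add_le_less_mono 1 2) (simp only: dist_real_def diff_zero)
    also have "\<dots> < \<epsilon>" using Crn \<epsilon> by linarith
    finally show "dist (T x s - s * T x 1) 0 < \<epsilon>" by (simp only: dist_real_def diff_zero)
  qed
qed

definition \<kappa> :: real where "\<kappa> = m2 / (2 * m1)"

lemma ramp_integral:
  fixes x y :: real
  assumes "0 < y" "0 \<le> x"
  shows "(\<integral>t. indicator {0..<x} t * max 0 (y - t) \<partial>lborel) = y * min x y - (min x y)\<^sup>2 / 2"
proof -
  have "has_bochner_integral lborel (\<lambda>t. (y - t) * indicator {0..min x y} t)
      ((y * min x y - (min x y)\<^sup>2 / 2) - (y * 0 - 0\<^sup>2 / 2))"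
    by (rule has_bochner_integral_FTC_Icc_real) (use assms in \<open>auto intro!: derivative_eq_intros\<close>)
  then have "(\<integral>t. (y - t) * indicator {0..min x y} t \<partial>lborel) = y * min x y - (min x y)\<^sup>2 / 2"
    by (simp add: has_bochner_integral_iff)
  moreover have "(\<integral>t. indicator {0..<x} t * max 0 (y - t) \<partial>lborel) = (\<integral>t. (y - t) * indicator {0..min x y} t \<partial>lborel)"
  proof (rule integral_cong_AE)
    show "AE t in lborel. indicator {0..<x} t * max 0 (y - t) = (y - t) * indicator {0..min x y} t"
      using AE_lborel_singleton[of x] by eventually_elim (auto simp: indicator_def max_def min_def)
  qed auto
  ultimately show ?thesis by simp
qed

text \<open>The ladder heights are positive, so in the renewal equation integrated over
  \<open>[0, x]\<close> the term \<open>J (0 - y) (x - y)\<close> is exactly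
  \<open>R (x - y)\<close>; with steps that can be negative a term \<open>R (0 - y)\<close> would
  remain. The source contributes the integral of \<open>y - t\<close> over
  \<open>0 \<le> t \<le> min x y\<close>, which tends to \<open>y^2 / 2\<close>.\<close>

lemma expected_T_ladder_tendsto: "((\<lambda>x. \<integral>y. T x y \<partial>\<eta>) \<longlongrightarrow> m2 / 2) at_top"
proof -
  let ?G = "\<lambda>x y. \<integral>t. indicator {0..<x} t * max 0 (y - t) \<partial>lborel"
  have eq: "rt x = (\<integral>z. rt (x - z) \<partial>\<eta>) + (\<integral>z. max 0 (z - x) \<partial>\<eta>)" if "0 \<le> x" for x
    by (rule r_renewal_imp_rt[OF \<eta>.prob_space_axioms _ _ r_harmonic_ladder]) (use that in auto)
  have iR: "integrable \<eta> (\<lambda>y. R (x - y))" for x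
    by (rule \<eta>.integrable_const_bound[where B = "R x"])
      (use \<eta>_pos in \<open>auto elim!: eventually_mono intro: R_mono simp: R_nonneg\<close>)
  have q: "(\<integral>y. T x y \<partial>\<eta>) = (\<integral>y. ?G x y \<partial>\<eta>)" if x: "0 \<le> x" for x
  proof -
    have "R x = (\<integral>z. J (0 - z) (x - z) \<partial>\<eta>) + (\<integral>y. ?G x y \<partial>\<eta>)"
      unfolding R_def
      using renewal_increment[OF \<eta>.prob_space_axioms _ _ eq order_refl] by simp
    also have "(\<integral>z. J (0 - z) (x - z) \<partial>\<eta>) = (\<integral>z. R (x - z) \<partial>\<eta>)"
    proof (rule integral_cong_AE)
      have J: "J (0 - z) (x - z) = R (x - z) - R (0 - z)" for z using x by (simp add: R_diff)
      show "(\<lambda>z. J (0 - z) (x - z)) \<in> borel_measurable \<eta>" unfolding J by measurable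
      show "AE z in \<eta>. J (0 - z) (x - z) = R (x - z)"
        unfolding J using \<eta>_pos by eventually_elim (simp add: R_nonpos)
    qed simp
    finally show ?thesis unfolding T_def using iR[of x] \<eta>.prob_space by simp
  qed
  have "((\<lambda>x. \<integral>y. ?G x y \<partial>\<eta>) \<longlongrightarrow> (\<integral>y. y\<^sup>2 / 2 \<partial>\<eta>)) at_top"
  proof (rule integral_dominated_convergence_at_top[where w = "\<lambda>y. y\<^sup>2 / 2"])
    show "AE y in \<eta>. ((\<lambda>x. ?G x y) \<longlongrightarrow> y\<^sup>2 / 2) at_top"
      using \<eta>_pos
    proof eventually_elim
      fix y :: real assume y: "0 < y"
      show "((\<lambda>x. ?G x y) \<longlongrightarrow> y\<^sup>2 / 2) at_top"
        by (rule tendsto_at_top_const[where N = y]) (use y in \<open>simp add: ramp_integral min_def power2_eq_square\<close>)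
    qed
    show "\<forall>\<^sub>F x in at_top. AE y in \<eta>. norm (?G x y) \<le> y\<^sup>2 / 2"
      using eventually_ge_at_top[of 0]
    proof eventually_elim
      fix x :: real assume x: "0 \<le> x"
      show "AE y in \<eta>. norm (?G x y) \<le> y\<^sup>2 / 2"
        using \<eta>_pos
      proof eventually_elim
        fix y :: real assume y: "0 < y"
        let ?m = "min x y"
        have "0 \<le> (y - ?m)\<^sup>2" by simp
        then have "y * ?m - ?m\<^sup>2 / 2 \<le> y\<^sup>2 / 2" by (simp add: power2_eq_square algebra_simps)
        moreover have "0 \<le> ?G x y" by simp
        ultimately show "norm (?G x y) \<le> y\<^sup>2 / 2" using ramp_integral[OF y x] by simp
      qed
    qed
    show "(\<lambda>y. ?G x y) \<in> borel_measurable \<eta>" for x by measurable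
    show "(\<lambda>y. y\<^sup>2 / 2) \<in> borel_measurable \<eta>" by measurable
  qed (use integrable_\<eta>_square in auto)
  then have "((\<lambda>x. \<integral>y. ?G x y \<partial>\<eta>) \<longlongrightarrow> m2 / 2) at_top" by (simp add: m2_def)
  then show ?thesis
    by (rule Lim_transform_eventually) (rule eventually_mono[OF eventually_ge_at_top[of 0]], simp add: q)
qed

text \<open>Linearity under the integral over \<open>\<eta>\<close> gives \<open>m1 * T x 1\<close>
  the same limit as the mean of \<open>T x y\<close>, namely \<open>m2 / 2\<close>. This fixes the
  slope and proves that it exists.\<close>

lemma T_tendsto:
  assumes na: "non_arithmetic \<nu>" and s: "0 \<le> s"
  shows "((\<lambda>x. T x s) \<longlongrightarrow> s * \<kappa>) at_top"
proof -
  have [measurable]: "(\<lambda>y. T x y) \<in> borel_measurable borel" for x unfolding T_def by measurable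
  have iT: "integrable \<eta> (\<lambda>y. T x y)" for x
    by (rule Bochner_Integration.integrable_bound[of \<eta> "\<lambda>y. Cr * \<bar>y\<bar>"])
      (use T_le Cr_nonneg in \<open>auto simp: abs_mult\<close>)
  have "((\<lambda>x. \<integral>y. T x y - y * T x 1 \<partial>\<eta>) \<longlongrightarrow> (\<integral>y. 0 \<partial>\<eta>)) at_top"
  proof (rule integral_dominated_convergence_at_top[where w = "\<lambda>y. 2 * Cr * \<bar>y\<bar>"])
    show "AE y in \<eta>. ((\<lambda>x. T x y - y * T x 1) \<longlongrightarrow> 0) at_top"
      using \<eta>_pos by eventually_elim (rule T_linear_tendsto[OF na], simp)
    show "\<forall>\<^sub>F x in at_top. AE y in \<eta>. norm (T x y - y * T x 1) \<le> 2 * Cr * \<bar>y\<bar>"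
    proof (intro always_eventually allI AE_I2)
      fix x y
      have "\<bar>y * T x 1\<bar> \<le> \<bar>y\<bar> * Cr" unfolding abs_mult using T_le[of x 1] by (intro mult_left_mono) auto
      then show "norm (T x y - y * T x 1) \<le> 2 * Cr * \<bar>y\<bar>" using T_le[of x y] by (simp add: mult.commute)
    qed
  qed auto
  moreover have "(\<integral>y. T x y - y * T x 1 \<partial>\<eta>) = (\<integral>y. T x y \<partial>\<eta>) - m1 * T x 1" for x
    using iT[of x] by (simp add: m1_def)
  ultimately have "((\<lambda>x. (\<integral>y. T x y \<partial>\<eta>) - m1 * T x 1) \<longlongrightarrow> 0) at_top" by simp
  from tendsto_diff[OF expected_T_ladder_tendsto this]
  have "((\<lambda>x. m1 * T x 1 / m1) \<longlongrightarrow> m2 / 2 / m1) at_top"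
    by (intro tendsto_divide tendsto_const) (use m1_pos in simp_all)
  then have T1: "((\<lambda>x. T x 1) \<longlongrightarrow> \<kappa>) at_top" using m1_pos by (simp add: \<kappa>_def)
  have "((\<lambda>x. (T x s - s * T x 1) + s * T x 1) \<longlongrightarrow> 0 + s * \<kappa>) at_top"
    by (intro tendsto_add tendsto_mult tendsto_const T1 T_linear_tendsto na s)
  then show ?thesis by simp
qed

text \<open>A Tauberian step: by \<open>r_shift\<close> values just before \<open>x\<close> are at
  most \<open>r x + a\<close> and values just after \<open>x\<close> at least
  \<open>r x - a\<close>. So \<open>r x\<close> is squeezed between the averages over the windows of
  length \<open>a\<close> on either side, up to an error \<open>a\<close>.\<close>

theorem r_tendsto:
  assumes na: "non_arithmetic \<nu>"
  shows "(r \<longlongrightarrow> \<kappa>) at_top"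
proof (rule tendstoI)
  fix \<epsilon> :: real assume \<epsilon>: "0 < \<epsilon>"
  define a where "a = \<epsilon> / 2"
  have a: "0 < a" using \<epsilon> by (simp add: a_def)
  have l: "((\<lambda>x. T x a / a) \<longlongrightarrow> a * \<kappa> / a) at_top"
    by (intro tendsto_divide tendsto_const T_tendsto na) (use a in auto)
  then have 1: "((\<lambda>x. T x a / a) \<longlongrightarrow> \<kappa>) at_top" using a by simp
  have "filterlim (\<lambda>x. x + a) at_top at_top"
    using filterlim_minus_const_at_top[of "- a"] by simp
  from filterlim_compose[OF 1 this] have 2: "((\<lambda>x. T (x + a) a / a) \<longlongrightarrow> \<kappa>) at_top" .
  have "\<forall>\<^sub>F x in at_top. dist (T x a / a) \<kappa> < a" "\<forall>\<^sub>F x in at_top. dist (T (x + a) a / a) \<kappa> < a"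
    using tendstoD[OF 1 a] tendstoD[OF 2 a] by auto
  then show "\<forall>\<^sub>F x in at_top. dist (r x) \<kappa> < \<epsilon>"
    using eventually_ge_at_top[of 0]
  proof eventually_elim
    fix x :: real assume d1: "dist (T x a / a) \<kappa> < a" and d2: "dist (T (x + a) a / a) \<kappa> < a" and x: "0 \<le> x"
    have "J (x - a) x \<le> (r x + a) * (x - (x - a))"
    proof (rule J_bounds(2)[where l = 0])
      show "rt t \<le> r x + a" if "t \<in> {x - a..<x}" for t
        using that r_shift[of t x] a r_nonneg[of x] by (auto simp: rt_def)
    qed (use a in auto)
    then have "T x a \<le> (r x + a) * a" unfolding T_def using a by (simp add: R_diff)
    then have u: "T x a / a \<le> r x + a" using a by (simp add: pos_divide_le_eq)
    have "(r x - a) * (x + a - x) \<le> J x (x + a)"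
    proof (rule J_bounds(1)[where u = Cr])
      show "r x - a \<le> rt t" if "t \<in> {x..<x + a}" for t
        using that r_shift[of x t] a x by (auto simp: rt_def)
    qed (use a rt_le in auto)
    then have "(r x - a) * a \<le> T (x + a) a" unfolding T_def using a by (simp add: R_diff)
    then have "r x - a \<le> T (x + a) a / a" using a by (simp add: pos_le_divide_eq)
    moreover have "T x a / a > \<kappa> - a" "T (x + a) a / a < \<kappa> + a"
      using d1 d2 by (simp_all add: dist_real_def abs_less_iff)
    ultimately have "r x - \<kappa> < 2 * a" "\<kappa> - r x < 2 * a" using u by linarith+
    then show "dist (r x) \<kappa> < \<epsilon>" by (simp add: dist_real_def a_def abs_less_iff)
  qed
qed

end

section \<open>Delay of the CUSUM test\<close>

context ladder_factor begin

text \<open>\<open>U\<close> stands for the occupation measure of the CUSUM statistic before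
  detection and \<open>\<xi>\<close> for its law at detection, described by Dynkin's identity for
  the reflected step.\<close>

definition cusum_pair :: "real \<Rightarrow> real measure \<Rightarrow> real measure \<Rightarrow> bool" where
  "cusum_pair h U \<xi> \<longleftrightarrow> finite_measure U \<and> sets U = sets borel \<and> sets \<xi> = sets borel \<and>
     (AE w in U. 0 \<le> w \<and> w \<le> h) \<and> (AE w in \<xi>. h < w) \<and>
     (\<forall>f :: real \<Rightarrow> ennreal. f \<in> borel_measurable borel \<longrightarrow>
       (\<integral>\<^sup>+w. (\<integral>\<^sup>+z. f (max 0 (w + z)) \<partial>\<nu>) \<partial>U) + f 0 = (\<integral>\<^sup>+w. f w \<partial>U) + (\<integral>\<^sup>+w. f w \<partial>\<xi>))"

text \<open>The mass of \<open>U\<close> is the mean delay. In the bound,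
  \<open>2 * c * \<gamma>\<close> is the effect of the resets on the mean overshoot, the extra
  \<open>\<gamma>\<close> is the distance of \<open>r h\<close> from \<open>\<kappa>\<close>, and
  \<open>\<delta> h\<close> comes from replacing \<open>B\<close> at detection by its
  asymptote.\<close>

lemma cusum_estimate:
  assumes pair: "cusum_pair h U \<xi>" and h: "0 \<le> h"
    and \<gamma>: "0 \<le> \<gamma>" and r_near: "\<And>x. h \<le> x \<Longrightarrow> \<bar>r x - \<kappa>\<bar> \<le> \<gamma>"
  shows "\<bar>measure U UNIV - (h + \<kappa> + mV / c) / I\<bar> \<le> (2 * c + 1) * \<gamma> / I + \<delta> h / m1"
proof -
  interpret U: finite_measure U using pair by (simp add: cusum_pair_def)
  have sets [simp, measurable_cong]: "sets U = sets borel" "sets \<xi> = sets borel"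
    and U_AE: "AE w in U. 0 \<le> w \<and> w \<le> h" and \<xi>_AE: "AE w in \<xi>. h < w"
    and dyn: "\<And>f :: real \<Rightarrow> ennreal. f \<in> borel_measurable borel \<Longrightarrow>
       (\<integral>\<^sup>+w. (\<integral>\<^sup>+z. f (max 0 (w + z)) \<partial>\<nu>) \<partial>U) + f 0 = (\<integral>\<^sup>+w. f w \<partial>U) + (\<integral>\<^sup>+w. f w \<partial>\<xi>)"
    using pair by (auto simp: cusum_pair_def)
  have [simp]: "space U = UNIV" "space \<xi> = UNIV"
    using sets_eq_imp_space_eq[OF sets(1)] sets_eq_imp_space_eq[OF sets(2)] by auto
  have [simp]: "borel_measurable U = borel_measurable borel" "borel_measurable \<xi> = borel_measurable borel"
    by (auto intro!: measurable_cong_sets)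
  define u where "u = measure U UNIV"
  have eU: "emeasure U UNIV = ennreal u" by (simp add: u_def U.emeasure_eq_measure)
  interpret \<xi>: prob_space \<xi>
  proof
    have "ennreal u + 1 = ennreal u + emeasure \<xi> (space \<xi>)"
      using dyn[of "\<lambda>_. 1"] \<nu>.emeasure_space_1 by (simp add: eU)
    then show "emeasure \<xi> (space \<xi>) = 1" by (simp add: ennreal_add_left_cancel)
  qed
  have bounded: "(\<integral>\<^sup>+w. ennreal (f w) \<partial>U) \<noteq> top" if "\<And>w. 0 \<le> w \<Longrightarrow> w \<le> h \<Longrightarrow> f w \<le> K" for f K
  proof -
    have "(\<integral>\<^sup>+w. ennreal (f w) \<partial>U) \<le> (\<integral>\<^sup>+w. ennreal K \<partial>U)"
      by (rule nn_integral_mono_AE) (use U_AE in eventually_elim, use that in \<open>auto intro!: ennreal_leI\<close>)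
    also have "\<dots> < top" by (simp add: eU ennreal_mult_less_top)
    finally show ?thesis by simp
  qed

  have Bmax: "B (max 0 x) = B x" for x by (cases "x \<le> 0") (auto simp: B_nonpos)
  have "ennreal u = (\<integral>\<^sup>+w. ennreal (B w) \<partial>\<xi>)"
  proof -
    have "(\<integral>\<^sup>+w. (\<integral>\<^sup>+z. ennreal (B (max 0 (w + z))) \<partial>\<nu>) \<partial>U) = (\<integral>\<^sup>+w. ennreal (B w) + 1 \<partial>U)"
      by (rule nn_integral_cong_AE) (use U_AE in eventually_elim, auto simp: Bmax B_step)
    also have "\<dots> = (\<integral>\<^sup>+w. ennreal (B w) \<partial>U) + ennreal u"
      by (subst nn_integral_add) (auto simp: eU)
    finally have "(\<integral>\<^sup>+w. ennreal (B w) \<partial>U) + ennreal u = (\<integral>\<^sup>+w. ennreal (B w) \<partial>U) + (\<integral>\<^sup>+w. ennreal (B w) \<partial>\<xi>)"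
      using dyn[of "\<lambda>x. ennreal (B x)"] by (simp add: B_nonpos)
    moreover have "(\<integral>\<^sup>+w. ennreal (B w) \<partial>U) \<noteq> top"
    proof (rule bounded)
      fix w assume w: "0 \<le> w" "w \<le> h"
      have "m1 * B w \<le> c * h + mV + \<delta> 0"
        unfolding B_eq using w c_ge_1 \<delta>_antimono[of 0 w] by (intro add_mono mult_left_mono) auto
      then show "B w \<le> (c * h + mV + \<delta> 0) / m1" using m1_pos by (simp add: field_simps)
    qed
    ultimately show ?thesis by (simp add: ennreal_add_left_cancel)
  qed
  then have eB: "(\<integral>\<^sup>+w. ennreal (B w) \<partial>\<xi>) = ennreal u" by simp
  have iB: "integrable \<xi> B"
    by (rule integrableI_nonneg) (use eB in auto)
  have u_B: "u = (\<integral>w. B w \<partial>\<xi>)"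
    using eB by (subst (asm) nn_integral_eq_integral[OF iB]) (auto simp: ennreal_inj integral_nonneg_AE u_def)
  \<comment> \<open>The mean of the statistic at detection is finite because \<open>B\<close>, whose
    mean is \<open>u\<close>, grows linearly.\<close>
  have iw: "integrable \<xi> (\<lambda>w. w)"
  proof (rule Bochner_Integration.integrable_bound)
    show "integrable \<xi> (\<lambda>w. (m1 * B w + \<bar>mV\<bar>) / c)" using iB by simp
    show "AE w in \<xi>. norm w \<le> norm ((m1 * B w + \<bar>mV\<bar>) / c)"
      using \<xi>_AE
    proof eventually_elim
      fix w assume w: "h < w"
      have "w * c \<le> m1 * B w + \<bar>mV\<bar>" using B_eq[of w] \<delta>_nonneg[of w] by (simp add: mult.commute)
      then have "w \<le> (m1 * B w + \<bar>mV\<bar>) / c" "0 \<le> (m1 * B w + \<bar>mV\<bar>) / c"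
        using c_ge_1 m1_pos by (simp_all add: pos_le_divide_eq)
      then show "norm w \<le> norm ((m1 * B w + \<bar>mV\<bar>) / c)"
        using w h unfolding real_norm_def by (simp only: abs_of_nonneg)
    qed
  qed simp
  have \<delta>_meas: "\<delta> \<in> borel_measurable borel" unfolding \<delta>_def[abs_def] by measurable
  define \<theta> where "\<theta> = (\<integral>w. \<delta> w \<partial>\<xi>)"
  have i\<delta>: "integrable \<xi> \<delta>"
    by (rule \<xi>.integrable_const_bound[where B = "\<delta> h"])
      (use \<xi>_AE \<delta>_meas in \<open>auto elim!: eventually_mono intro: \<delta>_antimono simp: \<delta>_nonneg\<close>)
  have \<theta>: "0 \<le> \<theta>" "\<theta> \<le> \<delta> h"
  proof -
    show "0 \<le> \<theta>" unfolding \<theta>_def by (intro integral_nonneg_AE) (simp add: \<delta>_nonneg)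
    have "\<theta> \<le> (\<integral>w. \<delta> h \<partial>\<xi>)"
      unfolding \<theta>_def by (rule integral_mono_AE) (use i\<delta> \<xi>_AE in \<open>auto elim!: eventually_mono intro: \<delta>_antimono\<close>)
    then show "\<theta> \<le> \<delta> h" by (simp add: \<xi>.prob_space[simplified])
  qed
  define E where "E = (\<integral>w. w \<partial>\<xi>) - h"
  have u_eq: "m1 * u = c * (h + E) + mV + \<theta>"
  proof -
    have "m1 * u = (\<integral>w. c * w + mV + \<delta> w \<partial>\<xi>)"
      unfolding u_B B_eq[symmetric] by simp
    also have "\<dots> = c * (h + E) + mV + \<theta>"
      using iw i\<delta> by (simp add: E_def \<theta>_def \<xi>.prob_space[simplified])
    finally show ?thesis .
  qed

  \<comment> \<open>\<open>?k w\<close> is the chance that the next step would fall below 0 and is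
    reset, so \<open>L\<close> is the expected number of resets.\<close>
  let ?k = "\<lambda>w. emeasure \<nu> {z. w + z < 0}"
  define L where "L = (\<integral>\<^sup>+w. ?k w \<partial>U)"
  have ind: "(\<integral>\<^sup>+z. indicator {..<0} (w + z) \<partial>\<nu>) = ?k w" for w
  proof -
    have "(\<integral>\<^sup>+z. indicator {..<0} (w + z) \<partial>\<nu>) = (\<integral>\<^sup>+z. indicator {z. w + z < 0} z \<partial>\<nu>)"
      by (rule nn_integral_cong) (auto simp: indicator_def)
    then show ?thesis by simp
  qed
  have L_meas: "?k \<in> borel_measurable borel"
    unfolding ind[symmetric] by measurable
  \<comment> \<open>The function \<open>x \<mapsto> A (max 0 x)\<close> is harmonic for the CUSUM
    chain except that each reset adds \<open>A 0\<close>. Its mean at detection is therefore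
    \<open>A 0 * (L + 1)\<close>; it is at most \<open>c\<close>, while
    \<open>A 0 \<ge> 1\<close>.\<close>
  have L: "L \<le> ennreal c"
  proof -
    let ?a = "\<lambda>x. ennreal (A (max 0 x))"
    have step: "(\<integral>\<^sup>+z. ?a (w + z) \<partial>\<nu>) = ennreal (A w) + ennreal (A 0) * ?k w"
      if "0 \<le> w" for w
    proof -
      have "(\<integral>\<^sup>+z. ?a (w + z) \<partial>\<nu>) = (\<integral>\<^sup>+z. ennreal (A (w + z)) + ennreal (A 0) * indicator {..<0} (w + z) \<partial>\<nu>)"
        by (rule nn_integral_cong) (auto simp: indicator_def A_neg)
      also have "\<dots> = ennreal (A w) + ennreal (A 0) * ?k w"
        by (subst nn_integral_add) (auto simp: A_harmonic that nn_integral_cmult ind)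
      finally show ?thesis .
    qed
    have "(\<integral>\<^sup>+w. (\<integral>\<^sup>+z. ?a (w + z) \<partial>\<nu>) \<partial>U) = (\<integral>\<^sup>+w. ennreal (A w) + ennreal (A 0) * ?k w \<partial>U)"
      by (rule nn_integral_cong_AE) (use U_AE in eventually_elim, auto simp: step)
    also have "\<dots> = (\<integral>\<^sup>+w. ennreal (A w) \<partial>U) + ennreal (A 0) * L"
      unfolding L_def using L_meas by (subst nn_integral_add) (auto simp: nn_integral_cmult)
    finally have "((\<integral>\<^sup>+w. ennreal (A w) \<partial>U) + ennreal (A 0) * L) + ennreal (A 0) = (\<integral>\<^sup>+w. ?a w \<partial>U) + (\<integral>\<^sup>+w. ?a w \<partial>\<xi>)"
      using dyn[of "\<lambda>x. ennreal (A (max 0 x))"] by simp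
    also have "(\<integral>\<^sup>+w. ?a w \<partial>U) = (\<integral>\<^sup>+w. ennreal (A w) \<partial>U)"
      by (rule nn_integral_cong_AE) (use U_AE in eventually_elim, auto)
    finally have "ennreal (A 0) * L + ennreal (A 0) = (\<integral>\<^sup>+w. ?a w \<partial>\<xi>)"
      using bounded[of A c] A_le_c by (simp add: ennreal_add_left_cancel add.assoc)
    also have "\<dots> \<le> (\<integral>\<^sup>+w. ennreal c \<partial>\<xi>)"
      by (rule nn_integral_mono) (auto intro!: ennreal_leI A_le_c)
    also have "\<dots> = ennreal c" by (simp add: \<xi>.emeasure_space_1[simplified])
    finally have "ennreal (A 0) * L + ennreal (A 0) \<le> ennreal c" .
    moreover have "1 * L \<le> ennreal (A 0) * L"
      by (rule mult_right_mono) (use A_ge_1[of 0] in \<open>auto simp: ennreal_ge_1\<close>)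
    ultimately show ?thesis by (metis add_increasing2 mult_1 order_trans zero_le)
  qed

  let ?X = "\<integral>\<^sup>+w. (\<integral>\<^sup>+z. ennreal (r (h - max 0 (w + z))) \<partial>\<nu>) \<partial>U"
  let ?K = "\<integral>\<^sup>+w. ennreal (r (h - w)) \<partial>U"
  \<comment> \<open>A reset moves the argument from \<open>h - x > h\<close> to \<open>h\<close>,
    and at both places \<open>r\<close> is within \<open>\<gamma>\<close> of
    \<open>\<kappa>\<close>.\<close>
  have r_jump: "r (h - max 0 x) \<le> r (h - x) + 2 * \<gamma> * indicator {..<0} x"
    "r (h - x) \<le> r (h - max 0 x) + 2 * \<gamma> * indicator {..<0} x" for x
    using r_near[of h] r_near[of "h - x"] by (auto simp: indicator_def abs_le_iff max_def)
  have K: "?K \<noteq> top" by (rule bounded[of _ Cr]) (auto intro: r_le)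
  have K_eq: "?K = (\<integral>\<^sup>+w. (\<integral>\<^sup>+z. ennreal (r (h - (w + z))) \<partial>\<nu>) \<partial>U)"
    by (rule nn_integral_cong_AE)
      (use U_AE in eventually_elim, auto simp: r_harmonic diff_diff_eq[symmetric])
  let ?P = "\<lambda>g w. \<integral>\<^sup>+z. ennreal (g (w + z)) \<partial>\<nu>"
  let ?Q = "\<lambda>g w. \<integral>\<^sup>+z. ennreal (g (w + z) + 2 * \<gamma> * indicator {..<0} (w + z)) \<partial>\<nu>"
  have add: "(\<integral>\<^sup>+w. ?Q g w \<partial>U) \<le>
      (\<integral>\<^sup>+w. ?P g w \<partial>U) + ennreal (2 * \<gamma> * c)"
    if [measurable]: "g \<in> borel_measurable borel" and g: "\<And>x. 0 \<le> g x" for g :: "real \<Rightarrow> real"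
  proof -
    have "?Q g w =
        ?P g w + ennreal (2 * \<gamma>) * ?k w" for w
    proof -
      have "?Q g w =
          (\<integral>\<^sup>+z. ennreal (g (w + z)) + ennreal (2 * \<gamma>) * indicator {..<0} (w + z) \<partial>\<nu>)"
        by (rule nn_integral_cong) (use g \<gamma> in \<open>auto simp: indicator_def\<close>)
      also have "\<dots> = ?P g w + ennreal (2 * \<gamma>) * ?k w"
        by (subst nn_integral_add) (auto simp: nn_integral_cmult ind)
      finally show ?thesis .
    qed
    then have "(\<integral>\<^sup>+w. ?Q g w \<partial>U) =
        (\<integral>\<^sup>+w. ?P g w + ennreal (2 * \<gamma>) * ?k w \<partial>U)"
      by simp
    also have "\<dots> = (\<integral>\<^sup>+w. ?P g w \<partial>U) + ennreal (2 * \<gamma>) * L"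
      unfolding L_def using L_meas by (subst nn_integral_add) (auto simp: nn_integral_cmult)
    also have "\<dots> \<le> (\<integral>\<^sup>+w. ?P g w \<partial>U) + ennreal (2 * \<gamma>) * ennreal c"
      by (intro add_left_mono mult_left_mono L) simp
    also have "ennreal (2 * \<gamma>) * ennreal c = ennreal (2 * \<gamma> * c)" using \<gamma> c_ge_1 by (simp add: ennreal_mult)
    finally show ?thesis .
  qed
  have XK: "?X \<le> ?K + ennreal (2 * \<gamma> * c)"
    unfolding K_eq
    by (rule order_trans[OF _ add[of "\<lambda>x. r (h - x)"]])
      (auto intro!: nn_integral_mono ennreal_leI r_jump)
  have KX: "?K \<le> ?X + ennreal (2 * \<gamma> * c)"
    unfolding K_eq
    by (rule order_trans[OF _ add[of "\<lambda>x. r (h - max 0 x)"]])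
      (auto intro!: nn_integral_mono ennreal_leI r_jump)
  \<comment> \<open>At detection \<open>h - w\<close> is negative, where \<open>r\<close> is the
    plain distance; so the exit term is exactly the mean excess \<open>E\<close>.\<close>
  have "(\<integral>\<^sup>+w. ennreal (r (h - w)) \<partial>\<xi>) = (\<integral>\<^sup>+w. ennreal (w - h) \<partial>\<xi>)"
    by (rule nn_integral_cong_AE) (use \<xi>_AE in \<open>auto elim!: eventually_mono simp: r_neg\<close>)
  also have "\<dots> = ennreal E"
    using iw \<xi>_AE by (subst nn_integral_eq_integral) (auto elim!: eventually_mono simp: E_def \<xi>.prob_space[simplified])
  finally have XE: "?X + ennreal (r h) = ?K + ennreal E"
    using dyn[of "\<lambda>w. ennreal (r (h - w))"] by simp
  have E0: "0 \<le> E"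
  proof -
    have "(\<integral>w. h \<partial>\<xi>) \<le> (\<integral>w. w \<partial>\<xi>)"
      by (rule integral_mono_AE) (use iw \<xi>_AE in \<open>auto elim!: eventually_mono\<close>)
    then show ?thesis by (simp add: E_def \<xi>.prob_space[simplified])
  qed
  have "\<bar>E - r h\<bar> \<le> 2 * \<gamma> * c"
  proof -
    obtain k where k: "?K = ennreal k" "0 \<le> k" using K by (cases "?K") auto
    have "?X \<noteq> top" using XK k \<gamma> c_ge_1 by (auto simp: top_unique)
    then obtain x where x: "?X = ennreal x" "0 \<le> x" by (cases "?X") auto
    have ec: "0 \<le> 2 * \<gamma> * c" using \<gamma> c_ge_1 by simp
    have "x + r h = k + E" using XE E0 k(2) x(2) unfolding k x
      by (simp add: ennreal_plus[symmetric] del: ennreal_plus)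
    moreover have "x \<le> k + 2 * \<gamma> * c" "k \<le> x + 2 * \<gamma> * c"
      using XK KX k(2) x(2) ec unfolding k x by (simp_all add: ennreal_plus[symmetric] ennreal_le_iff del: ennreal_plus)
    ultimately show ?thesis by linarith
  qed
  then have E: "\<bar>E - \<kappa>\<bar> \<le> (2 * c + 1) * \<gamma>" using r_near[of h] by (simp add: algebra_simps abs_le_iff)
  have u_eq': "u = (h + E + mV / c) / I + \<theta> / m1"
    using u_eq m1_pos I_pos c_ge_1 unfolding m1_eq by (simp add: field_simps)
  have "u - (h + \<kappa> + mV / c) / I = (E - \<kappa>) / I + \<theta> / m1"
    unfolding u_eq' by (simp add: add_divide_distrib diff_divide_distrib)
  also have "\<bar>\<dots>\<bar> \<le> \<bar>E - \<kappa>\<bar> / I + \<theta> / m1"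
    using I_pos m1_pos \<theta>(1) by (simp add: abs_triangle_ineq[THEN order_trans])
  also have "\<dots> \<le> (2 * c + 1) * \<gamma> / I + \<delta> h / m1"
    using E \<theta>(2) I_pos m1_pos by (intro add_mono divide_right_mono) auto
  finally show ?thesis unfolding u_def .
qed

theorem cusum_delay_expansion:
  assumes na: "non_arithmetic \<nu>" and pair: "\<And>h. 0 \<le> h \<Longrightarrow> cusum_pair h (U h) (\<xi> h)"
  shows "((\<lambda>h. measure (U h) UNIV - 1 / I * (h + m2 / m1 - E2 / (2 * I))) \<longlongrightarrow> 0) at_top"
proof -
  have const: "\<kappa> + mV / c = m2 / m1 - E2 / (2 * I)"
    unfolding \<kappa>_def m2_eq m1_eq using I_pos c_ge_1 by (simp add: field_simps)
  show ?thesis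
  proof (rule tendstoI)
    fix e :: real assume e: "0 < e"
    define \<gamma> where "\<gamma> = e * I / (2 * (2 * c + 1))"
    have c: "0 < 2 * c + 1" using c_ge_1 by simp
    have \<gamma>: "0 < \<gamma>" using e I_pos c by (simp add: \<gamma>_def)
    have \<gamma>e: "(2 * c + 1) * \<gamma> / I = e / 2" 
    proof -
      have "k * (e * I / (2 * k)) / I = e / 2" if "0 < k" for k using that I_pos by simp
      then show ?thesis using c unfolding \<gamma>_def by blast
    qed
    have "\<forall>\<^sub>F x in at_top. dist (r x) \<kappa> < \<gamma>" by (rule tendstoD[OF r_tendsto[OF na] \<gamma>])
    then obtain N where N: "\<And>x. N \<le> x \<Longrightarrow> dist (r x) \<kappa> < \<gamma>" by (auto simp: eventually_at_top_linorder)
    have "\<forall>\<^sub>F h in at_top. dist (\<delta> h) 0 < e / 2 * m1" by (rule tendstoD[OF \<delta>_tendsto]) (use e m1_pos in simp)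
    then show "\<forall>\<^sub>F h in at_top. dist (measure (U h) UNIV - 1 / I * (h + m2 / m1 - E2 / (2 * I))) 0 < e"
      using eventually_ge_at_top[of "max 0 N"]
    proof eventually_elim
      fix h assume d: "dist (\<delta> h) 0 < e / 2 * m1" and h: "max 0 N \<le> h"
      have "\<bar>measure (U h) UNIV - (h + \<kappa> + mV / c) / I\<bar> \<le> (2 * c + 1) * \<gamma> / I + \<delta> h / m1"
      proof (rule cusum_estimate[OF pair])
        show "\<bar>r x - \<kappa>\<bar> \<le> \<gamma>" if "h \<le> x" for x using N[of x] that h by (simp add: dist_real_def)
      qed (use h \<gamma> in auto)
      also have "\<dots> < e" using d m1_pos unfolding \<gamma>e by (simp add: \<delta>_nonneg pos_divide_less_eq field_simps)
      also have "(h + \<kappa> + mV / c) / I = 1 / I * (h + m2 / m1 - E2 / (2 * I))"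
        using const by (simp add: add.assoc)
      finally show "dist (measure (U h) UNIV - 1 / I * (h + m2 / m1 - E2 / (2 * I))) 0 < e" by simp
    qed
  qed
qed

end

section \<open>Random walks and stopping times\<close>

definition exit_time :: "(real \<Rightarrow> real \<Rightarrow> real) \<Rightarrow> real \<Rightarrow> real set \<Rightarrow> (nat \<Rightarrow> real) \<Rightarrow> enat" where
  "exit_time F w D z = (INF n\<in>{n. 1 \<le> n \<and> chain F w z n \<notin> D}. enat n)"

lemma less_exit_time_iff: "enat n < exit_time F w D z \<longleftrightarrow> (\<forall>k\<in>{1..n}. chain F w z k \<in> D)"
proof -
  have "enat n < exit_time F w D z \<longleftrightarrow> enat (Suc n) \<le> exit_time F w D z"
    by (simp add: Suc_ile_eq)
  also have "\<dots> \<longleftrightarrow> (\<forall>k\<in>{k. 1 \<le> k \<and> chain F w z k \<notin> D}. enat (Suc n) \<le> enat k)"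
    unfolding exit_time_def by (rule le_INF_iff)
  also have "\<dots> \<longleftrightarrow> (\<forall>k\<in>{1..n}. chain F w z k \<in> D)"
  proof -
    have "enat (Suc n) \<le> enat k \<longleftrightarrow> \<not> k \<le> n" for k by auto
    then show ?thesis by auto
  qed
  finally show ?thesis .
qed

text \<open>The tail sum formula, by which the mean exit time becomes the sum of the survival
  probabilities, that is, the mass of \<open>occ\<close>.\<close>

lemma ennreal_of_enat_eq_suminf: "ennreal_of_enat t = (\<Sum>n. if enat n < t then 1 else 0)"
proof (cases t)
  case (enat m)
  have "(\<Sum>n. if enat n < t then 1 else 0 :: ennreal) = (\<Sum>n<m. if enat n < t then 1 else 0)"
    by (rule suminf_finite) (auto simp: enat)
  also have "\<dots> = of_nat m" by (simp add: enat)
  finally show ?thesis by (simp add: enat)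
next
  case infinity
  have "of_nat m \<le> (\<Sum>n. 1 :: ennreal)" for m
    using sum_le_suminf[OF summableI, of "{..<m}" "\<lambda>_. 1 :: ennreal"] by simp
  then have "(\<Sum>n. 1 :: ennreal) = top"
    by (metis ennreal_SUP_of_nat_eq_top SUP_le_iff top.extremum_uniqueI)
  then show ?thesis using infinity by simp
qed

context driven_chain begin

abbreviation \<tau> :: "'a \<Rightarrow> enat" where
  "\<tau> \<omega> \<equiv> exit_time F w0 D (\<lambda>k. Z k \<omega>)"

lemma less_\<tau>_iff: "\<omega> \<in> space M \<Longrightarrow> enat n < \<tau> \<omega> \<longleftrightarrow> \<omega> \<in> alive n"
  by (simp add: less_exit_time_iff alive_def W_def)

lemma ennreal_\<tau>: "\<omega> \<in> space M \<Longrightarrow> ennreal_of_enat (\<tau> \<omega>) = (\<Sum>n. indicator (alive n) \<omega>)"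
  unfolding ennreal_of_enat_eq_suminf by (rule suminf_cong) (simp add: less_\<tau>_iff indicator_def)

lemma ennreal_\<tau>_measurable: "(\<lambda>\<omega>. ennreal_of_enat (\<tau> \<omega>)) \<in> borel_measurable M"
proof -
  have "(\<lambda>\<omega>. \<Sum>n. indicator (alive n) \<omega> :: ennreal) \<in> borel_measurable M" by measurable
  then show ?thesis by (simp add: ennreal_\<tau> cong: measurable_cong)
qed

lemma expectation_\<tau>: "(\<integral>\<^sup>+\<omega>. ennreal_of_enat (\<tau> \<omega>) \<partial>M) = emeasure occ UNIV"
proof -
  have "(\<integral>\<^sup>+\<omega>. ennreal_of_enat (\<tau> \<omega>) \<partial>M) = (\<integral>\<^sup>+\<omega>. (\<Sum>n. indicator (alive n) \<omega>) \<partial>M)"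
    by (rule nn_integral_cong) (simp add: ennreal_\<tau>)
  also have "\<dots> = (\<Sum>n. \<integral>\<^sup>+\<omega>. indicator (alive n) \<omega> \<partial>M)"
    by (rule nn_integral_suminf) measurable
  also have "\<dots> = emeasure occ UNIV"
    using nn_integral_occ[of "\<lambda>_. 1"] by simp
  finally show ?thesis .
qed

lemma AE_path_law:
  assumes [measurable]: "Measurable.pred borel P" "\<And>n. E n \<in> sets M"
    and P: "\<And>n \<omega>. \<omega> \<in> E n \<Longrightarrow> P (W (n + k) \<omega>)"
  shows "AE w in path_law k E. P w"
proof -
  have [simp, measurable_cong]: "sets (path_law k E) = sets borel" by (simp add: path_law_def)
  have "(\<integral>\<^sup>+w. indicator {w. \<not> P w} w \<partial>path_law k E) =
      (\<Sum>n. \<integral>\<^sup>+\<omega>. indicator (E n) \<omega> * indicator {w. \<not> P w} (W (n + k) \<omega>) \<partial>M)"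
    by (rule nn_integral_path_law) measurable
  also have "(\<lambda>n. \<integral>\<^sup>+\<omega>. indicator (E n) \<omega> * indicator {w. \<not> P w} (W (n + k) \<omega>) \<partial>M) = (\<lambda>n. \<integral>\<^sup>+\<omega>. 0 \<partial>M)"
    by (intro ext nn_integral_cong) (auto simp: indicator_def P)
  finally have "emeasure (path_law k E) {w\<in>space (path_law k E). \<not> P w} = 0"
    by (simp add: path_law_def)
  then show ?thesis by (subst AE_iff_measurable[OF _ refl]) auto
qed

lemma AE_occ:
  assumes "Measurable.pred borel P" "\<And>n \<omega>. \<omega> \<in> alive n \<Longrightarrow> P (W n \<omega>)"
  shows "AE w in occ. P w"
  unfolding occ_def using assms by (intro AE_path_law) auto

lemma AE_exit_law: "D \<in> sets borel \<Longrightarrow> AE w in exit_law. w \<notin> D"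
  unfolding exit_law_def by (intro AE_path_law) (auto simp: alive_Suc)

text \<open>At most one summand is nonzero, the one with \<open>Suc n = \<tau> \<omega>\<close>. If
  the chain never exits the sum is 0.\<close>

lemma suminf_exit:
  assumes \<omega>: "\<omega> \<in> space M"
  shows "(\<Sum>n. indicator (alive n - alive (Suc n)) \<omega> * f (W (Suc n) \<omega>)) =
    (case \<tau> \<omega> of enat n \<Rightarrow> f (W n \<omega>) | \<infinity> \<Rightarrow> (0 :: ennreal))"
proof (cases "\<tau> \<omega>")
  case (enat m)
  have "m \<noteq> 0"
  proof
    assume "m = 0"
    then have "\<not> enat 0 < \<tau> \<omega>" using enat by simp
    then show False using less_\<tau>_iff[OF \<omega>, of 0] \<omega> by (simp add: alive_0)
  qed
  then obtain k where k: "m = Suc k" by (cases m) auto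
  have "indicator (alive n - alive (Suc n)) \<omega> = (if n = k then 1 else 0 :: ennreal)" for n
    using less_\<tau>_iff[OF \<omega>, of n] less_\<tau>_iff[OF \<omega>, of "Suc n"] by (auto simp: enat k indicator_def)
  then have "(\<Sum>n. indicator (alive n - alive (Suc n)) \<omega> * f (W (Suc n) \<omega>)) = (\<Sum>n\<in>{k}. f (W (Suc n) \<omega>))"
    by (subst suminf_finite[of "{k}"]) auto
  then show ?thesis by (simp add: enat k)
next
  case infinity
  then have "\<omega> \<in> alive n" for n using less_\<tau>_iff[OF \<omega>, of n] by simp
  then show ?thesis by (simp add: infinity)
qed

end

section \<open>Random walks with positive drift\<close>

locale iid_walk = prob_space M for M :: "'a measure" +
  fixes Z :: "nat \<Rightarrow> 'a \<Rightarrow> real" and \<nu> :: "real measure"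
  assumes indep: "indep_vars (\<lambda>_. borel) Z {1..}"
    and distr_Z: "\<And>k. 1 \<le> k \<Longrightarrow> distr M borel (Z k) = \<nu>"
    and square_integrable: "integrable \<nu> (\<lambda>z. z\<^sup>2)"
    and drift_pos: "0 < (\<integral>z. z \<partial>\<nu>)"
begin

sublocale S: driven_chain M Z \<nu> "(+)" 0 "{..0}"
  by unfold_locales (use indep distr_Z in auto)

sublocale \<nu>: prob_space \<nu> by (rule S.prob_space_\<nu>)

lemma borel_measurable_\<nu>: "borel_measurable \<nu> = borel_measurable borel"
  by (intro measurable_cong_sets) auto

lemma integrable_\<nu>: "integrable \<nu> (\<lambda>z. z)"
  by (rule \<nu>.square_integrable_imp_integrable) (use square_integrable in \<open>simp_all add: borel_measurable_\<nu>\<close>)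

text \<open>Capping the increments from above bounds the overshoot, so that a linear function can
  stay nonnegative in \<open>Lyapunov\<close>.\<close>

lemma truncated_drift_pos: "\<exists>K. 0 < (\<integral>z. min z K \<partial>\<nu>)"
proof -
  have "((\<lambda>K. \<integral>z. min z K \<partial>\<nu>) \<longlongrightarrow> (\<integral>z. z \<partial>\<nu>)) at_top"
  proof (rule integral_dominated_convergence_at_top[where w = "\<lambda>z. \<bar>z\<bar>"])
    show "AE z in \<nu>. ((\<lambda>K. min z K) \<longlongrightarrow> z) at_top"
    proof (rule AE_I2)
      show "((\<lambda>K. min z K) \<longlongrightarrow> z) at_top" for z :: real
        by (rule tendsto_at_top_const[where N = z]) simp
    qed
    show "\<forall>\<^sub>F K in at_top. AE z in \<nu>. norm (min z K) \<le> \<bar>z\<bar>"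
      using eventually_ge_at_top[of 0] by eventually_elim auto
  qed (simp_all add: borel_measurable_\<nu> integrable_abs[OF integrable_\<nu>])
  then have "\<forall>\<^sub>F K in at_top. 0 < (\<integral>z. min z K \<partial>\<nu>)"
    using drift_pos by (rule order_tendstoD(1))
  then show ?thesis by (rule eventually_happens'[OF trivial_limit_at_top_linorder])
qed

text \<open>The function is the positive part of \<open>K + h - w\<close>. With increments capped at
  \<open>K\<close> the positive part costs nothing from \<open>w \<le> h\<close>, so the drift is
  the capped mean. Monotonicity is recorded for the CUSUM chain, whose reflection only raises the
  state and thus lowers \<open>g\<close>.\<close>

lemma Lyapunov:
  obtains g :: "real \<Rightarrow> ennreal" and d where "0 < d" "d \<noteq> top" "antimono g" "\<And>w. g w \<noteq> top" "g \<in> borel_measurable borel"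
    "\<And>w. w \<le> h \<Longrightarrow> (\<integral>\<^sup>+z. g (w + z) \<partial>\<nu>) + d \<le> g w"
proof -
  obtain K where K: "0 < (\<integral>z. min z K \<partial>\<nu>)" using truncated_drift_pos by blast
  define \<delta> where "\<delta> = (\<integral>z. min z K \<partial>\<nu>)"
  have i: "integrable \<nu> (\<lambda>z. min z K)"
    by (rule Bochner_Integration.integrable_bound[of \<nu> "\<lambda>z. \<bar>z\<bar> + \<bar>K\<bar>"])
      (simp_all add: borel_measurable_\<nu> integrable_abs[OF integrable_\<nu>])
  have "\<delta> \<le> (\<integral>z. K \<partial>\<nu>)" unfolding \<delta>_def by (rule integral_mono[OF i]) auto
  then have \<delta>K: "\<delta> \<le> K" by (simp add: \<nu>.prob_space[simplified])
  show thesis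
  proof (rule that[of "ennreal \<delta>" "\<lambda>w. ennreal (K + h - w)"])
    show "antimono (\<lambda>w. ennreal (K + h - w))" by (auto intro!: monotoneI ennreal_leI)
    fix w assume w: "w \<le> h"
    have "(\<integral>\<^sup>+z. ennreal (K + h - (w + z)) \<partial>\<nu>) \<le> (\<integral>\<^sup>+z. ennreal (h - w + (K - min z K)) \<partial>\<nu>)"
      using w by (intro nn_integral_mono ennreal_leI) auto
    also have "\<dots> = ennreal (\<integral>z. h - w + (K - min z K) \<partial>\<nu>)"
      by (rule nn_integral_eq_integral) (use i w in auto)
    also have "(\<integral>z. h - w + (K - min z K) \<partial>\<nu>) = h - w + (K - \<delta>)"
      using i by (simp add: \<delta>_def \<nu>.prob_space[simplified])
    finally have "(\<integral>\<^sup>+z. ennreal (K + h - (w + z)) \<partial>\<nu>) + ennreal \<delta> \<le> ennreal (h - w + (K - \<delta>)) + ennreal \<delta>"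
      by (rule add_right_mono)
    also have "\<dots> = ennreal (K + h - w)"
      using w \<delta>K K by (subst ennreal_plus[symmetric]) (auto simp: \<delta>_def algebra_simps)
    finally show "(\<integral>\<^sup>+z. ennreal (K + h - (w + z)) \<partial>\<nu>) + ennreal \<delta> \<le> ennreal (K + h - w)" .
  qed (use K in \<open>auto simp: \<delta>_def\<close>)
qed

lemma finite_occ_S: "finite_measure S.occ"
proof (rule Lyapunov[where h = 0])
  fix g :: "real \<Rightarrow> ennreal" and d
  assume g: "0 < d" "d \<noteq> top" "antimono g" "\<And>w. g w \<noteq> top" "g \<in> borel_measurable borel"
    "\<And>w. w \<le> 0 \<Longrightarrow> (\<integral>\<^sup>+z. g (w + z) \<partial>\<nu>) + d \<le> g w"
  have "d * emeasure S.occ UNIV \<le> g 0"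
    by (rule S.emeasure_occ_le_Lyapunov) (use g in auto)
  then have "d * emeasure S.occ UNIV \<noteq> top" using g(4)[of 0] by (auto simp: top_unique)
  then have "emeasure S.occ UNIV \<noteq> top" using g(1) by (auto simp: ennreal_mult_eq_top_iff)
  then show ?thesis by (intro finite_measureI) simp
qed

sublocale LF: ladder_factor \<nu> S.occ S.exit_law
proof -
  interpret V: finite_measure S.occ by (rule finite_occ_S)
  show "ladder_factor \<nu> S.occ S.exit_law"
  proof (unfold_locales, goal_cases)
    case 6
    show ?case
    proof (rule S.AE_occ)
      show "S.W n \<omega> \<le> 0" if "\<omega> \<in> S.alive n" for n \<omega>
        using that by (cases n) (auto simp: S.alive_Suc)
    qed measurable
  next
    case 7
    show ?case using S.AE_exit_law by (simp add: not_le)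
  next
    case (8 f)
    then show ?case by (rule S.dynkin)
  qed (use square_integrable drift_pos in auto)
qed

lemma random_walk_eq: "random_walk z n = chain (+) 0 z n"
  by (induction n) (auto simp: random_walk_def)

lemma ladder_epoch_eq: "ladder_epoch z = exit_time (+) 0 {..0} z"
  by (simp add: ladder_epoch_def exit_time_def random_walk_eq not_le)

lemma ladder_height_eq:
  "ladder_height (\<lambda>k. Z k \<omega>) = (case S.\<tau> \<omega> of enat n \<Rightarrow> S.W n \<omega> | \<infinity> \<Rightarrow> 0)"
  by (simp add: ladder_height_def ladder_epoch_eq random_walk_eq S.W_def split: enat.split)

lemma AE_ladder_epoch_finite: "AE \<omega> in M. ladder_epoch (\<lambda>k. Z k \<omega>) < \<infinity>"
proof -
  interpret V: finite_measure S.occ by (rule finite_occ_S)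
  have "(\<integral>\<^sup>+\<omega>. ennreal_of_enat (S.\<tau> \<omega>) \<partial>M) \<noteq> \<infinity>"
    unfolding S.expectation_\<tau> by simp
  then have "AE \<omega> in M. ennreal_of_enat (S.\<tau> \<omega>) \<noteq> \<infinity>"
    by (rule nn_integral_PInf_AE[OF S.ennreal_\<tau>_measurable])
  then show ?thesis
  proof eventually_elim
    fix \<omega> assume "ennreal_of_enat (S.\<tau> \<omega>) \<noteq> \<infinity>"
    then show "ladder_epoch (\<lambda>k. Z k \<omega>) < \<infinity>" unfolding ladder_epoch_eq by (cases "S.\<tau> \<omega>") auto
  qed
qed

lemma ladder_height_nonneg: "\<omega> \<in> space M \<Longrightarrow> 0 \<le> ladder_height (\<lambda>k. Z k \<omega>)"
proof (cases "S.\<tau> \<omega>")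
  case (enat n)
  assume \<omega>: "\<omega> \<in> space M"
  have "S.W n \<omega> > 0 \<or> n = 0"
    using S.less_\<tau>_iff[OF \<omega>, of n] S.less_\<tau>_iff[OF \<omega>, of "n - 1"] enat
    by (cases n) (auto simp: S.alive_Suc)
  then show ?thesis by (auto simp: ladder_height_eq enat)
qed (simp add: ladder_height_eq)

text \<open>The premise \<open>f 0 = 0\<close> makes paths that never exit, where
  \<open>ladder_height\<close> has the default value 0, contribute nothing on either side.\<close>

lemma nn_integral_ladder_height:
  assumes [measurable]: "f \<in> borel_measurable borel" and f0: "f 0 = (0 :: ennreal)"
  shows "(\<integral>\<^sup>+\<omega>. f (ladder_height (\<lambda>k. Z k \<omega>)) \<partial>M) = (\<integral>\<^sup>+y. f y \<partial>S.exit_law)"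
proof -
  have "(\<integral>\<^sup>+\<omega>. f (ladder_height (\<lambda>k. Z k \<omega>)) \<partial>M) =
      (\<integral>\<^sup>+\<omega>. (\<Sum>n. indicator (S.alive n - S.alive (Suc n)) \<omega> * f (S.W (Suc n) \<omega>)) \<partial>M)"
    by (rule nn_integral_cong) (auto simp: S.suminf_exit ladder_height_eq f0 split: enat.split)
  also have "\<dots> = (\<integral>\<^sup>+y. f y \<partial>S.exit_law)"
    by (subst nn_integral_suminf) (auto simp: S.nn_integral_exit_law)
  finally show ?thesis .
qed

lemma ladder_height_measurable [measurable]: "(\<lambda>\<omega>. ladder_height (\<lambda>k. Z k \<omega>)) \<in> borel_measurable M"
proof -
  have "(\<lambda>\<omega>. enn2real (\<Sum>n. indicator (S.alive n - S.alive (Suc n)) \<omega> * ennreal (S.W (Suc n) \<omega>))) \<in> borel_measurable M"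
    by measurable
  moreover have "enn2real (\<Sum>n. indicator (S.alive n - S.alive (Suc n)) \<omega> * ennreal (S.W (Suc n) \<omega>)) =
      ladder_height (\<lambda>k. Z k \<omega>)" if "\<omega> \<in> space M" for \<omega>
    using that ladder_height_nonneg[OF that]
    by (auto simp: S.suminf_exit ladder_height_eq split: enat.splits)
  ultimately show ?thesis by (simp cong: measurable_cong)
qed

lemma ladder_height_moments:
  "integrable M (\<lambda>\<omega>. (ladder_height (\<lambda>k. Z k \<omega>))\<^sup>2)"
  "(\<integral>\<omega>. (ladder_height (\<lambda>k. Z k \<omega>))\<^sup>2 \<partial>M) = LF.m2"
  "(\<integral>\<omega>. ladder_height (\<lambda>k. Z k \<omega>) \<partial>M) = LF.m1"
proof -
  have 2: "(\<integral>\<^sup>+\<omega>. ennreal ((ladder_height (\<lambda>k. Z k \<omega>))\<^sup>2) \<partial>M) = ennreal LF.m2"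
    unfolding LF.m2_def using LF.integrable_\<eta>_square
    by (subst nn_integral_ladder_height[of "\<lambda>y. ennreal (y\<^sup>2)"]) (auto simp: nn_integral_eq_integral)
  have 1: "(\<integral>\<^sup>+\<omega>. ennreal (ladder_height (\<lambda>k. Z k \<omega>)) \<partial>M) = ennreal LF.m1"
    unfolding LF.m1_def using LF.\<eta>_pos
    by (subst nn_integral_ladder_height[of ennreal]) (auto intro!: nn_integral_eq_integral elim!: eventually_mono)
  show "integrable M (\<lambda>\<omega>. (ladder_height (\<lambda>k. Z k \<omega>))\<^sup>2)"
    by (rule integrableI_nonneg) (use 2 in auto)
  show "(\<integral>\<omega>. (ladder_height (\<lambda>k. Z k \<omega>))\<^sup>2 \<partial>M) = LF.m2"
    using 2 LF.m2_nonneg by (subst integral_eq_nn_integral) auto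
  show "(\<integral>\<omega>. ladder_height (\<lambda>k. Z k \<omega>) \<partial>M) = LF.m1"
    using 1 LF.m1_pos ladder_height_nonneg by (subst integral_eq_nn_integral) auto
qed

section \<open>The CUSUM statistic as a driven chain\<close>

definition F :: "real \<Rightarrow> real \<Rightarrow> real" where "F w z = max 0 (w + z)"

lemma driven_chain_cusum: "driven_chain M Z \<nu> F {..h}"
  by unfold_locales (use indep distr_Z in \<open>auto simp: F_def\<close>)

lemma cusum_eq: "cusum z n = chain F 0 z n"
  by (induction n) (auto simp: F_def)

lemma detection_time_eq: "detection_time z h = exit_time F 0 {..h} z"
  by (simp add: detection_time_def exit_time_def cusum_eq not_le)

lemma detection_time_mono: "h \<le> h' \<Longrightarrow> detection_time z h \<le> detection_time z h'"
  unfolding detection_time_def by (rule INF_superset_mono) auto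

lemma detection_time_measurable:
  "(\<lambda>\<omega>. ennreal_of_enat (detection_time (\<lambda>k. Z k \<omega>) h)) \<in> borel_measurable M"
proof -
  interpret C: driven_chain M Z \<nu> F 0 "{..h}" by (rule driven_chain_cusum)
  show ?thesis unfolding detection_time_eq by (rule C.ennreal_\<tau>_measurable)
qed

definition mean_delay :: "real \<Rightarrow> ennreal" where
  "mean_delay h = (\<integral>\<^sup>+\<omega>. ennreal_of_enat (detection_time (\<lambda>k. Z k \<omega>) h) \<partial>M)"

lemma cusum_occupation:
  assumes h: "0 \<le> h"
  shows "\<exists>U \<xi>. LF.cusum_pair h U \<xi> \<and> mean_delay h = emeasure U UNIV"
proof -
  interpret C: driven_chain M Z \<nu> F 0 "{..h}" by (rule driven_chain_cusum)
  have fin: "finite_measure C.occ"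
  proof (rule Lyapunov[where h = h])
    fix g :: "real \<Rightarrow> ennreal" and d
    assume g: "0 < d" "d \<noteq> top" "antimono g" "\<And>w. g w \<noteq> top" "g \<in> borel_measurable borel"
      "\<And>w. w \<le> h \<Longrightarrow> (\<integral>\<^sup>+z. g (w + z) \<partial>\<nu>) + d \<le> g w"
    have "d * emeasure C.occ UNIV \<le> g 0"
    proof (rule C.emeasure_occ_le_Lyapunov)
      fix w assume "w \<in> {..h}"
      then have "(\<integral>\<^sup>+z. g (w + z) \<partial>\<nu>) + d \<le> g w" using g(6) by simp
      moreover have "(\<integral>\<^sup>+z. g (F w z) \<partial>\<nu>) \<le> (\<integral>\<^sup>+z. g (w + z) \<partial>\<nu>)"
        by (intro nn_integral_mono antimonoD[OF g(3)]) (simp add: F_def)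
      ultimately show "(\<integral>\<^sup>+z. g (F w z) \<partial>\<nu>) + d \<le> g w" by (meson add_right_mono order_trans)
    qed (use g h in auto)
    then have "d * emeasure C.occ UNIV \<noteq> top" using g(4)[of 0] by (auto simp: top_unique)
    then have "emeasure C.occ UNIV \<noteq> top" using g(1) by (auto simp: ennreal_mult_eq_top_iff)
    then show ?thesis by (intro finite_measureI) simp
  qed
  have W0: "0 \<le> C.W n \<omega>" for n \<omega> by (cases n) (auto simp: C.W_Suc F_def)
  have "LF.cusum_pair h C.occ C.exit_law"
    unfolding LF.cusum_pair_def
  proof (intro conjI allI impI)
    show "AE w in C.occ. 0 \<le> w \<and> w \<le> h"
    proof (rule C.AE_occ)
      show "0 \<le> C.W n \<omega> \<and> C.W n \<omega> \<le> h" if "\<omega> \<in> C.alive n" for n \<omega>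
        using that W0 h by (cases n) (auto simp: C.alive_Suc)
    qed measurable
    show "AE w in C.exit_law. h < w" using C.AE_exit_law by (simp add: not_le)
    fix f :: "real \<Rightarrow> ennreal" assume "f \<in> borel_measurable borel"
    then show "(\<integral>\<^sup>+w. (\<integral>\<^sup>+z. f (max 0 (w + z)) \<partial>\<nu>) \<partial>C.occ) + f 0 = (\<integral>\<^sup>+w. f w \<partial>C.occ) + (\<integral>\<^sup>+w. f w \<partial>C.exit_law)"
      using C.dynkin[of f] by (simp add: F_def)
  qed (use fin in auto)
  moreover have "mean_delay h = emeasure C.occ UNIV"
    unfolding mean_delay_def detection_time_eq by (rule C.expectation_\<tau>)
  ultimately show ?thesis by blast
qed

lemma expected_detection_time_finite:
  "mean_delay h < \<infinity>"
proof -
  \<comment> \<open>A negative level is dominated by level 0, to which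
    \<open>cusum_occupation\<close> applies.\<close>
  obtain U \<xi> where U: "LF.cusum_pair (max 0 h) U \<xi>"
    "mean_delay (max 0 h) = emeasure U UNIV"
    using cusum_occupation[of "max 0 h"] by auto
  interpret U: finite_measure U using U(1) by (simp add: LF.cusum_pair_def)
  have "mean_delay h \<le> emeasure U UNIV"
    unfolding U(2)[symmetric] mean_delay_def
    by (intro nn_integral_mono) (simp add: ennreal_of_enat_le_iff detection_time_mono)
  also have "\<dots> < \<infinity>" by (simp add: U.emeasure_eq_measure)
  finally show ?thesis .
qed

theorem expected_detection_time_expansion:
  assumes na: "non_arithmetic \<nu>"
  shows "((\<lambda>h. enn2real (mean_delay h) -
    1 / (\<integral>z. z \<partial>\<nu>) * (h + LF.m2 / LF.m1 - (\<integral>z. z\<^sup>2 \<partial>\<nu>) / (2 * (\<integral>z. z \<partial>\<nu>)))) \<longlongrightarrow> 0) at_top"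
proof -
  have "\<forall>h. \<exists>U \<xi>. 0 \<le> h \<longrightarrow> LF.cusum_pair h U \<xi> \<and> mean_delay h = emeasure U UNIV"
    using cusum_occupation by blast
  then obtain U \<xi> where U: "\<And>h. 0 \<le> h \<Longrightarrow> LF.cusum_pair h (U h) (\<xi> h)"
    "\<And>h. 0 \<le> h \<Longrightarrow> mean_delay h = emeasure (U h) UNIV"
    by metis
  have "\<forall>\<^sub>F h in at_top. measure (U h) UNIV - 1 / LF.I * (h + LF.m2 / LF.m1 - LF.E2 / (2 * LF.I)) =
      enn2real (mean_delay h) -
      1 / (\<integral>z. z \<partial>\<nu>) * (h + LF.m2 / LF.m1 - (\<integral>z. z\<^sup>2 \<partial>\<nu>) / (2 * (\<integral>z. z \<partial>\<nu>)))"
    using eventually_ge_at_top[of 0]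
    by eventually_elim (simp add: U(2) measure_def LF.I_def LF.E2_def)
  with LF.cusum_delay_expansion[OF na U(1)] show ?thesis
    by (rule Lim_transform_eventually)
qed

end

section \<open>The energy harvesting sensor\<close>

declare One_nat_def [simp del] \<comment> \<open>rewrites \<open>{1..}\<close>, the index set of the sequence space\<close>

abbreviation seq_space :: "(nat \<Rightarrow> real) measure" where
  "seq_space \<equiv> PiM {1..} (\<lambda>_. borel)"

text \<open>Outside the index set, at \<open>k = 0\<close>, all points of the product space have the
  constant value \<open>undefined\<close>. Without a condition on \<open>k\<close> the lemma also
  applies at random indices.\<close>

lemma component_measurable: "(\<lambda>x. x k) \<in> borel_measurable seq_space"
proof (cases "k \<in> {1..}")
  case False
  then have *: "x k = undefined" if "x \<in> space seq_space" for x :: "nat \<Rightarrow> real"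
    using that by (auto simp: space_PiM PiE_def extensional_def)
  have "(\<lambda>x. x k) \<in> borel_measurable seq_space \<longleftrightarrow> (\<lambda>x. undefined :: real) \<in> borel_measurable seq_space"
    by (rule measurable_cong) (rule *)
  then show ?thesis by simp
qed (rule measurable_component_singleton)

lemma detection_time_cong:
  assumes "\<And>k. 1 \<le> k \<Longrightarrow> z k = z' k" shows "detection_time z h = detection_time z' h"
proof -
  have "cusum z n = cusum z' n" for n using assms by (induction n) auto
  then show ?thesis by (simp add: detection_time_def)
qed

section \<open>Batteries and sensing slots\<close>

lemma battery_cong:
  assumes "\<And>k. 1 \<le> k \<Longrightarrow> \<eta> k = \<eta>' k" shows "battery Es b \<eta> n = battery Es b \<eta>' n"
proof (induction n rule: less_induct)
  case (less n)
  show ?case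
  proof (cases n)
    case (Suc m)
    then show ?thesis using less assms by (cases m) auto
  qed simp
qed

lemma sensing_slots_cong:
  "(\<And>k. 1 \<le> k \<Longrightarrow> \<eta> k = \<eta>' k) \<Longrightarrow> sensing_slots Es b \<eta> = sensing_slots Es b \<eta>'"
  unfolding sensing_slots_def using battery_cong[of \<eta> \<eta>'] by simp

lemma battery_measurable: "(\<lambda>\<eta>. battery Es b \<eta> n) \<in> borel_measurable seq_space"
proof (induction n rule: less_induct)
  case (less n)
  show ?case
  proof (cases n)
    case (Suc m)
    show ?thesis
    proof (cases m)
      case (Suc k)
      have [measurable]: "(\<lambda>\<eta>. battery Es b \<eta> m) \<in> borel_measurable seq_space"
        using less[of m] \<open>n = Suc m\<close> by simp
      note [measurable] = component_measurable
      have "(\<lambda>\<eta>. battery Es b \<eta> m + \<eta> m - (if battery Es b \<eta> m > Es then Es else 0)) \<in> borel_measurable seq_space"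
        by measurable
      then show ?thesis using Suc \<open>n = Suc m\<close> by simp
    qed (simp add: Suc)
  qed simp
qed

text \<open>After a last sensing slot the battery would never spend again; infinitely many harvests
  above \<open>\<epsilon>\<close> would then push it over \<open>Es\<close>.\<close>

lemma infinite_sensing_slots:
  assumes nonneg: "\<And>k. 1 \<le> k \<Longrightarrow> 0 \<le> \<eta> k" and \<epsilon>: "0 < \<epsilon>"
    and often: "\<And>K. \<exists>k\<ge>K. \<epsilon> < \<eta> k"
  shows "infinite (sensing_slots Es b \<eta>)"
proof
  assume "finite (sensing_slots Es b \<eta>)"
  then obtain K0 where K0: "\<forall>k\<in>sensing_slots Es b \<eta>. k < K0" unfolding finite_nat_set_iff_bounded ..
  have low: "battery Es b \<eta> k \<le> Es" if "Suc K0 \<le> k" for k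
  proof (rule ccontr)
    assume "\<not> battery Es b \<eta> k \<le> Es"
    then have "k \<in> sensing_slots Es b \<eta>" using that by (simp add: sensing_slots_def)
    then show False using K0 that by fastforce
  qed
  let ?B = "battery Es b \<eta>"
  have step: "?B (Suc k) = ?B k + \<eta> k" if "Suc K0 \<le> k" for k
    using that low[OF that] by (cases k) auto
  have mono: "?B k \<le> ?B (k + n)" if "Suc K0 \<le> k" for k n
  proof (induction n)
    case (Suc n)
    then show ?case using step[of "k + n"] nonneg[of "k + n"] that by simp
  qed simp
  have "\<exists>n\<ge>Suc K0. ?B (Suc K0) + real m * \<epsilon> \<le> ?B n" for m
  proof (induction m)
    case (Suc m)
    then obtain n where n: "Suc K0 \<le> n" "?B (Suc K0) + real m * \<epsilon> \<le> ?B n" by blast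
    obtain k where k: "n \<le> k" "\<epsilon> < \<eta> k" using often by blast
    have "?B n \<le> ?B k" using mono[OF n(1), of "k - n"] k(1) by simp
    then have "?B (Suc K0) + real (Suc m) * \<epsilon> \<le> ?B (Suc k)"
      using n k step[of k] by (simp add: algebra_simps)
    then show ?case using n(1) k(1) by (intro exI[of _ "Suc k"]) simp
  qed auto
  moreover obtain m where "real m > (Es - ?B (Suc K0)) / \<epsilon>" using reals_Archimedean2 by blast
  ultimately obtain n where "Suc K0 \<le> n" "?B (Suc K0) + real m * \<epsilon> \<le> ?B n" by blast
  moreover have "Es < ?B (Suc K0) + real m * \<epsilon>"
    using \<open>real m > (Es - ?B (Suc K0)) / \<epsilon>\<close> \<epsilon> by (simp add: field_simps)
  ultimately show False using low[of n] by simp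
qed

text \<open>The second Borel-Cantelli lemma for i.i.d. events: the probability that all harvests
  from \<open>K\<close> to \<open>K + n\<close> stay below the level is \<open>q ^ Suc n\<close>,
  with \<open>q < 1\<close> because the mean is positive.\<close>

lemma (in prob_space) AE_infinitely_often_large:
  fixes H :: "nat \<Rightarrow> 'a \<Rightarrow> real"
  assumes meas: "\<And>k. k \<ge> 1 \<Longrightarrow> H k \<in> borel_measurable M"
    and ident: "\<And>k. k \<ge> 1 \<Longrightarrow> distr M borel (H k) = distr M borel (H 1)"
    and indep: "indep_vars (\<lambda>_. borel) H {1..}"
    and mean: "0 < (\<integral>\<omega>. H 1 \<omega> \<partial>M)"
  obtains \<epsilon> :: real where "0 < \<epsilon>" "AE \<omega> in M. \<forall>K. \<exists>k\<ge>K. \<epsilon> < H k \<omega>"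
proof -
  have [measurable]: "H 1 \<in> borel_measurable M" by (rule meas) simp
  obtain \<epsilon> :: real where \<epsilon>: "0 < \<epsilon>" "0 < prob {\<omega>\<in>space M. \<epsilon> < H 1 \<omega>}"
    using integral_pos_imp_level[OF _ mean] by auto
  define q where "q = prob {\<omega>\<in>space M. H 1 \<omega> \<le> \<epsilon>}"
  have "prob {\<omega>\<in>space M. \<epsilon> < H 1 \<omega>} = 1 - q"
    unfolding q_def by (subst prob_compl[symmetric]) (auto intro!: arg_cong[where f = prob])
  then have q: "0 \<le> q" "q < 1" using \<epsilon>(2) by (auto simp: q_def)
  have Hk: "prob (H k -` {..\<epsilon>} \<inter> space M) = q" if "1 \<le> k" for k
  proof -
    have "prob (H k -` {..\<epsilon>} \<inter> space M) = measure (distr M borel (H k)) {..\<epsilon>}"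
      using meas[OF that] by (simp add: measure_distr)
    also have "\<dots> = measure (distr M borel (H 1)) {..\<epsilon>}" by (simp only: ident[OF that])
    also have "\<dots> = q" unfolding q_def
      by (subst measure_distr) (auto intro!: arg_cong[where f = prob])
    finally show ?thesis .
  qed
  have never: "AE \<omega> in M. \<exists>k\<ge>K. \<epsilon> < H k \<omega>" if K: "1 \<le> K" for K
  proof -
    note mK [measurable] = meas[OF order_trans[OF K]]
    define N where "N = {\<omega>\<in>space M. \<forall>k\<ge>K. H k \<omega> \<le> \<epsilon>}"
    have N_eq: "N = {\<omega>\<in>space M. \<forall>i. H (K + i) \<omega> \<le> \<epsilon>}"
      unfolding N_def by (auto simp: le_iff_add)
    have mKi [measurable]: "H (K + i) \<in> borel_measurable M" for i using meas[of "K + i"] K by simp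
    have [measurable]: "N \<in> sets M" unfolding N_eq by measurable
    have "prob N \<le> q ^ Suc n" for n
    proof -
      have "prob N \<le> prob (\<Inter>k\<in>{K..K + n}. H k -` {..\<epsilon>} \<inter> space M)"
      proof (rule finite_measure_mono)
        show "(\<Inter>k\<in>{K..K + n}. H k -` {..\<epsilon>} \<inter> space M) \<in> sets M"
          using K by (intro sets.finite_INT measurable_sets[OF meas]) auto
      qed (auto simp: N_def)
      also have "\<dots> = (\<Prod>k\<in>{K..K + n}. prob (H k -` {..\<epsilon>} \<inter> space M))"
        by (rule indep_varsD[OF indep]) (use K in auto)
      also have "\<dots> = (\<Prod>k\<in>{K..K + n}. q)" by (rule prod.cong) (use K Hk in auto)
      finally show ?thesis by simp
    qed
    moreover have "(\<lambda>n. q ^ Suc n) \<longlonglongrightarrow> 0" using q by (intro LIMSEQ_Suc LIMSEQ_power_zero) auto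
    ultimately have "prob N \<le> 0" by (intro LIMSEQ_le_const) auto
    then have "emeasure M N = 0" by (simp add: emeasure_eq_measure measure_le_0_iff)
    then show ?thesis by (intro AE_I[where N = N]) (auto simp: N_def not_less)
  qed
  then have "AE \<omega> in M. \<forall>K. \<exists>k\<ge>Suc K. \<epsilon> < H k \<omega>" unfolding AE_all_countable by simp
  then have "AE \<omega> in M. \<forall>K. \<exists>k\<ge>K. \<epsilon> < H k \<omega>"
    by eventually_elim (meson Suc_leD)
  then show thesis by (rule that[OF \<epsilon>(1)])
qed

text \<open>\<open>enumerate\<close> rewritten with \<open>LEAST\<close> over predicates of the
  battery level, a form in which measurability in the energy sequence follows by induction.\<close>

primrec slot :: "real \<Rightarrow> real \<Rightarrow> (nat \<Rightarrow> real) \<Rightarrow> nat \<Rightarrow> nat" where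
  "slot Es b \<eta> 0 = (LEAST s. s \<in> sensing_slots Es b \<eta>)"
| "slot Es b \<eta> (Suc n) = (LEAST s. s \<in> sensing_slots Es b \<eta> \<and> slot Es b \<eta> n < s)"

lemma slot_eq_enumerate:
  "infinite (sensing_slots Es b \<eta>) \<Longrightarrow> slot Es b \<eta> n = enumerate (sensing_slots Es b \<eta>) n"
  by (induction n) (simp_all add: enumerate_0 enumerate_Suc'')

lemma slot_measurable: "(\<lambda>\<eta>. slot Es b \<eta> n) \<in> measurable seq_space (count_space UNIV)"
proof (induction n)
  case 0
  note [measurable] = battery_measurable
  show ?case unfolding slot.simps sensing_slots_def by measurable
next
  case (Suc n)
  note [measurable] = battery_measurable Suc
  show ?case unfolding slot.simps sensing_slots_def mem_Collect_eq by measurable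
qed

text \<open>The samples are read at random indices; these have countably many values, so
  measurability can be checked index by index.\<close>

lemma observed_measurable:
  "(\<lambda>p. \<lambda>n\<in>{1..}. snd p (slot Es b (fst p) (n - 1))) \<in> measurable (seq_space \<Otimes>\<^sub>M seq_space) seq_space"
proof (rule measurable_restrict)
  fix n :: nat
  show "(\<lambda>p. snd p (slot Es b (fst p) (n - 1))) \<in> borel_measurable (seq_space \<Otimes>\<^sub>M seq_space)"
    by (rule measurable_compose_countable[of "\<lambda>i p. snd p i"])
      (auto intro: measurable_compose[OF measurable_snd component_measurable] measurable_compose[OF measurable_fst slot_measurable])
qed

section \<open>Sequences of i.i.d. samples\<close>

lemma (in prob_space) iid_sequence_law:
  assumes indep: "indep_vars (\<lambda>_. borel) X {1..}"
    and law: "\<And>k. k \<ge> 1 \<Longrightarrow> distr M borel (X k) = N"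
  shows "distr M seq_space (\<lambda>\<omega>. \<lambda>k\<in>{1..}. X k \<omega>) = PiM {1..} (\<lambda>_. N)"
proof -
  have rv: "random_variable borel (X k)" if "k \<in> {1..}" for k
    using indep that by (auto simp: indep_vars_def2)
  have "distr M seq_space (\<lambda>\<omega>. \<lambda>k\<in>{1..}. X k \<omega>) = PiM {1..} (\<lambda>k. distr M borel (X k))"
    using indep rv by (subst (asm) indep_vars_iff_distr_eq_PiM') auto
  also have "\<dots> = PiM {1..} (\<lambda>_. N)" by (rule PiM_cong) (auto simp: law)
  finally show ?thesis .
qed

lemma prob_space_density: "is_density f \<Longrightarrow> prob_space (density lborel (\<lambda>x. ennreal (f x)))"
  by (rule prob_spaceI) (auto simp: is_density_def emeasure_density)

lemma sets_iid_law [simp, measurable_cong]: "sets (iid_law f) = sets seq_space"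
  unfolding iid_law_def by (rule sets_PiM_cong) auto

lemma space_iid_law: "space (iid_law f) = space seq_space"
  by (rule sets_eq_imp_space_eq) simp

lemma prob_space_iid_law: "is_density f \<Longrightarrow> prob_space (iid_law f)"
  unfolding iid_law_def by (intro prob_space_PiM prob_space_density)

lemma distr_iid_law_component:
  assumes f: "is_density f" and k: "1 \<le> k"
  shows "distr (iid_law f) borel (\<lambda>x. x k) = density lborel (\<lambda>x. ennreal (f x))"
proof -
  let ?N = "density lborel (\<lambda>x. ennreal (f x))"
  have "distr (iid_law f) borel (\<lambda>x. x k) = distr (PiM {1..} (\<lambda>_. ?N)) ?N (\<lambda>x. x k)"
    unfolding iid_law_def by (rule distr_cong) auto
  also have "\<dots> = ?N" using k by (intro distr_PiM_component prob_space_density f) auto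
  finally show ?thesis .
qed

lemma llr_measurable:
  assumes "is_density f0" "is_density f1" shows "llr f0 f1 \<in> borel_measurable borel"
proof -
  have [measurable]: "f0 \<in> borel_measurable borel" "f1 \<in> borel_measurable borel"
    using assms by (auto simp: is_density_def)
  show ?thesis unfolding llr_def[abs_def] by measurable
qed

lemma distr_llr:
  assumes f: "is_density f0" "is_density f1" and k: "1 \<le> k"
  shows "distr (iid_law f1) borel (\<lambda>x. llr f0 f1 (x k)) = distr (density lborel (\<lambda>x. ennreal (f1 x))) borel (llr f0 f1)"
proof -
  note [measurable] = llr_measurable[OF f] component_measurable
  have "distr (density lborel (\<lambda>x. ennreal (f1 x))) borel (llr f0 f1) = distr (iid_law f1) borel (llr f0 f1 \<circ> (\<lambda>x. x k))"
    unfolding distr_iid_law_component[OF f(2) k, symmetric] by (rule distr_distr) measurable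
  then show ?thesis by (simp add: comp_def)
qed

lemma iid_law_indep:
  assumes f: "is_density f"
  shows "prob_space.indep_vars (iid_law f) (\<lambda>_. borel) (\<lambda>k x. x k) {1..}"
proof -
  interpret P: prob_space "iid_law f" by (rule prob_space_iid_law[OF f])
  let ?N = "density lborel (\<lambda>x. ennreal (f x))"
  note [measurable] = component_measurable
  have "distr (iid_law f) seq_space (\<lambda>x. \<lambda>i\<in>{1..}. x i) = distr (iid_law f) (iid_law f) (\<lambda>x. x)"
    by (rule distr_cong) (auto simp: space_iid_law space_PiM PiE_def extensional_restrict)
  also have "\<dots> = iid_law f" by simp
  also have "\<dots> = PiM {1..} (\<lambda>i. distr (iid_law f) borel (\<lambda>x. x i))"
    unfolding iid_law_def[of f, THEN eq_reflection] by (rule PiM_cong) (use distr_iid_law_component[OF f, unfolded iid_law_def] in auto)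
  finally show ?thesis
    by (subst P.indep_vars_iff_distr_eq_PiM') auto
qed

lemma iid_walk_llr:
  assumes f: "is_density f0" "is_density f1"
    and KL: "integrable lborel (\<lambda>x. ln (f1 x / f0 x) * f1 x)" "KL_info f0 f1 > 0"
    and var: "integrable (iid_law f1) (\<lambda>x. (llr f0 f1 (x 1) - KL_info f0 f1)\<^sup>2)"
  defines "\<nu> \<equiv> distr (iid_law f1) borel (\<lambda>x. llr f0 f1 (x 1))"
  shows "iid_walk (iid_law f1) (\<lambda>k x. llr f0 f1 (x k)) \<nu>" and "(\<integral>z. z \<partial>\<nu>) = KL_info f0 f1"
    and "(\<integral>z. z\<^sup>2 \<partial>\<nu>) = (\<integral>x. (llr f0 f1 (x 1))\<^sup>2 \<partial>iid_law f1)"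
proof -
  interpret P: prob_space "iid_law f1" by (rule prob_space_iid_law[OF f(2)])
  note [measurable] = llr_measurable[OF f] component_measurable
  have [measurable]: "f0 \<in> borel_measurable borel" "f1 \<in> borel_measurable borel" and nn: "\<And>x. 0 \<le> f1 x"
    using f by (auto simp: is_density_def)
  let ?N = "density lborel (\<lambda>x. ennreal (f1 x))"
  have \<nu>: "\<nu> = distr ?N borel (llr f0 f1)" unfolding \<nu>_def by (rule distr_llr[OF f]) simp
  have "(\<integral>z. z \<partial>\<nu>) = (\<integral>x. llr f0 f1 x \<partial>?N)" unfolding \<nu> by (simp add: integral_distr)
  also have "\<dots> = KL_info f0 f1"
    using nn by (subst integral_density) (auto simp: KL_info_def llr_def mult.commute)
  finally show mean: "(\<integral>z. z \<partial>\<nu>) = KL_info f0 f1" .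
  have "integrable ?N (llr f0 f1)"
    using KL(1) nn by (subst integrable_density) (auto simp: llr_def mult.commute)
  then have int: "integrable \<nu> (\<lambda>z. z)" unfolding \<nu> by (simp add: integrable_distr_eq)
  have "integrable \<nu> (\<lambda>z. (z - KL_info f0 f1)\<^sup>2)"
    using var unfolding \<nu>_def by (simp add: integrable_distr_eq)
  then have "integrable \<nu> (\<lambda>z. (z - KL_info f0 f1)\<^sup>2 + 2 * KL_info f0 f1 * z - (KL_info f0 f1)\<^sup>2)"
  proof -
    assume i: "integrable \<nu> (\<lambda>z. (z - KL_info f0 f1)\<^sup>2)"
    interpret \<nu>: prob_space \<nu> unfolding \<nu>_def by (rule P.prob_space_distr) measurable
    show ?thesis by (intro Bochner_Integration.integrable_diff Bochner_Integration.integrable_add i integrable_mult_right int) simp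
  qed
  then have sq: "integrable \<nu> (\<lambda>z. z\<^sup>2)"
    by (rule Bochner_Integration.integrable_cong[OF refl, THEN iffD1, rotated]) (simp add: power2_eq_square algebra_simps)
  show "(\<integral>z. z\<^sup>2 \<partial>\<nu>) = (\<integral>x. (llr f0 f1 (x 1))\<^sup>2 \<partial>iid_law f1)"
    unfolding \<nu>_def by (simp add: integral_distr)
  show "iid_walk (iid_law f1) (\<lambda>k x. llr f0 f1 (x k)) \<nu>"
  proof (unfold_locales)
    show "P.indep_vars (\<lambda>_. borel) (\<lambda>k x. llr f0 f1 (x k)) {1..}"
      by (rule P.indep_vars_compose2[OF iid_law_indep[OF f(2)]]) measurable
    show "distr (iid_law f1) borel (\<lambda>x. llr f0 f1 (x k)) = \<nu>" if "1 \<le> k" for k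
      unfolding \<nu> using that by (rule distr_llr[OF f])
    show "integrable \<nu> (\<lambda>z. z\<^sup>2)" by (rule sq)
    show "0 < (\<integral>z. z \<partial>\<nu>)" using mean KL(2) by simp
  qed
qed

text \<open>Once the energies are fixed, the sensing slots are a deterministic injection; an i.i.d.
  sequence read along an injection keeps its law.\<close>

lemma nn_integral_iid_law_reindex:
  assumes f: "is_density f" and \<phi>[measurable]: "\<phi> \<in> borel_measurable seq_space"
    and e: "inj_on e {1..}" "\<And>n. 1 \<le> n \<Longrightarrow> 1 \<le> e n"
  shows "(\<integral>\<^sup>+x. \<phi> (\<lambda>n\<in>{1..}. x (e n)) \<partial>iid_law f) = (\<integral>\<^sup>+x. \<phi> x \<partial>iid_law f)"
proof -
  let ?N = "density lborel (\<lambda>x. ennreal (f x))"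
  note [measurable] = component_measurable
  have m: "(\<lambda>x. \<lambda>n\<in>{1..}. x (e n)) \<in> measurable (iid_law f) (iid_law f)"
  proof -
    have "(\<lambda>x. \<lambda>n\<in>{1..}. x (e n)) \<in> measurable (iid_law f) seq_space"
      by (rule measurable_restrict) measurable
    then show ?thesis by (simp cong: measurable_cong_sets)
  qed
  have "distr (iid_law f) (iid_law f) (\<lambda>x. \<lambda>n\<in>{1..}. x (e n)) = iid_law f"
    unfolding iid_law_def
    by (rule distr_PiM_reindex) (use e prob_space_density[OF f] in auto)
  then have "(\<integral>\<^sup>+x. \<phi> x \<partial>iid_law f) = (\<integral>\<^sup>+x. \<phi> x \<partial>distr (iid_law f) (iid_law f) (\<lambda>x. \<lambda>n\<in>{1..}. x (e n)))"
    by simp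
  also have "\<dots> = (\<integral>\<^sup>+x. \<phi> (\<lambda>n\<in>{1..}. x (e n)) \<partial>iid_law f)"
    by (rule nn_integral_distr[OF m]) measurable
  finally show ?thesis by simp
qed

theorem theorem1:
  fixes f0 f1 :: "real \<Rightarrow> real"
    and M :: "'a measure" and X H :: "nat \<Rightarrow> 'a \<Rightarrow> real"
    and Es Hbar b :: real
  assumes dens: "is_density f0" "is_density f1"
    and ac: "absolutely_continuous (density lborel (\<lambda>x. ennreal (f0 x)))
                                   (density lborel (\<lambda>x. ennreal (f1 x)))"
    and nonarith: "non_arithmetic (distr (iid_law f1) borel (\<lambda>x. llr f0 f1 (x 1)))"
    and KL_finite: "integrable lborel (\<lambda>x. ln (f1 x / f0 x) * f1 x)"
    and KL_pos: "KL_info f0 f1 > 0"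
    and var_finite: "integrable (iid_law f1) (\<lambda>x. (llr f0 f1 (x 1) - KL_info f0 f1)\<^sup>2)"
    and prob: "prob_space M"
    and X_dist: "\<And>k. k \<ge> 1 \<Longrightarrow> distributed M lborel (X k) (\<lambda>x. ennreal (f1 x))"
    and X_indep: "prob_space.indep_vars M (\<lambda>_. borel) X {1..}"
    and H_meas: "\<And>k. k \<ge> 1 \<Longrightarrow> H k \<in> borel_measurable M"
    and H_nonneg: "\<And>k. k \<ge> 1 \<Longrightarrow> AE \<omega> in M. 0 \<le> H k \<omega>"
    and H_ident: "\<And>k. k \<ge> 1 \<Longrightarrow> distr M borel (H k) = distr M borel (H 1)"
    and H_ac: "absolutely_continuous lborel (distr M borel (H 1))"
    and H_indep: "prob_space.indep_vars M (\<lambda>_. borel) H {1..}"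
    and H_mean: "integrable M (H 1)" "Hbar = (\<integral>\<omega>. H 1 \<omega> \<partial>M)"
    and HX_indep: "prob_space.indep_var M
                     (PiM {1..} (\<lambda>_. borel)) (\<lambda>\<omega>. \<lambda>k\<in>{1..}. H k \<omega>)
                     (PiM {1..} (\<lambda>_. borel)) (\<lambda>\<omega>. \<lambda>k\<in>{1..}. X k \<omega>)"
    and energy: "Es > 0" "Hbar \<ge> Es" "b \<ge> 0"
  defines "\<tau> \<equiv> \<lambda>h \<omega>. detection_time (\<lambda>k. llr f0 f1 (X k \<omega>)) h"
    and "\<tau>obs \<equiv> \<lambda>h \<omega>. detection_time
           (\<lambda>n. llr f0 f1 (observed Es b (\<lambda>k. H k \<omega>) (\<lambda>k. X k \<omega>) n)) h"
  shows "(AE x in iid_law f1. ladder_epoch (\<lambda>k. llr f0 f1 (x k)) < \<infinity>)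
    \<and> integrable (iid_law f1) (\<lambda>x. (ladder_height (\<lambda>k. llr f0 f1 (x k)))\<^sup>2)
    \<and> (AE \<omega> in M. infinite (sensing_slots Es b (\<lambda>k. H k \<omega>)))
    \<and> (\<forall>h. (\<integral>\<^sup>+ \<omega>. ennreal_of_enat (\<tau> h \<omega>) \<partial>M) < \<infinity>)
    \<and> (\<lambda>h. enn2real (\<integral>\<^sup>+ \<omega>. ennreal_of_enat (\<tau> h \<omega>) \<partial>M) - delay_expansion f0 f1 h)
        \<in> o[at_top](\<lambda>_. 1)
    \<and> (\<forall>h. (\<integral>\<^sup>+ \<omega>. ennreal_of_enat (\<tau>obs h \<omega>) \<partial>M) < \<infinity>)
    \<and> (\<lambda>h. enn2real (\<integral>\<^sup>+ \<omega>. ennreal_of_enat (\<tau>obs h \<omega>) \<partial>M) - delay_expansion f0 f1 h)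
        \<in> o[at_top](\<lambda>_. 1)"
proof -
  interpret M: prob_space M by (rule prob)
  define \<nu> where "\<nu> = distr (iid_law f1) borel (\<lambda>x. llr f0 f1 (x 1))"
  note walk = iid_walk_llr[OF dens KL_finite KL_pos var_finite, folded \<nu>_def]
  interpret L: iid_walk "iid_law f1" "\<lambda>k x. llr f0 f1 (x k)" \<nu> by (rule walk(1))
  \<comment> \<open>The delay as a functional of the sample sequence. Its mean \<open>?E h\<close>
    under \<open>iid_law f1\<close> is the common value to which both delays are reduced.\<close>
  define \<phi> where "\<phi> h x = ennreal_of_enat (detection_time (\<lambda>k. llr f0 f1 (x k)) h)" for h and x :: "nat \<Rightarrow> real"
  have \<phi>_meas: "\<phi> h \<in> borel_measurable seq_space" for h
    using L.detection_time_measurable[of h] unfolding \<phi>_def[abs_def] by (simp cong: measurable_cong_sets)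
  have \<phi>_restrict: "\<phi> h (\<lambda>n\<in>{1..}. x n) = \<phi> h x" for h x
    unfolding \<phi>_def by (rule arg_cong[where f = ennreal_of_enat], rule detection_time_cong) simp

  let ?E = "\<lambda>h. \<integral>\<^sup>+x. \<phi> h x \<partial>iid_law f1"
  have fin: "?E h < \<infinity>" for h
    unfolding \<phi>_def by (rule L.expected_detection_time_finite[unfolded L.mean_delay_def])
  have "delay_expansion f0 f1 h =
      1 / (\<integral>z. z \<partial>\<nu>) * (h + L.LF.m2 / L.LF.m1 - (\<integral>z. z\<^sup>2 \<partial>\<nu>) / (2 * (\<integral>z. z \<partial>\<nu>)))" for h
    unfolding delay_expansion_def walk L.ladder_height_moments ..
  then have "((\<lambda>h. enn2real (?E h) - delay_expansion f0 f1 h) \<longlongrightarrow> 0) at_top"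
    using L.expected_detection_time_expansion nonarith by (simp add: \<phi>_def \<nu>_def L.mean_delay_def)
  then have lim: "(\<lambda>h. enn2real (?E h) - delay_expansion f0 f1 h) \<in> o[at_top](\<lambda>_. 1)"
    by (intro smalloI_tendsto) auto

  let ?Xs = "\<lambda>\<omega>. \<lambda>k\<in>{1..}. X k \<omega>" and ?Hs = "\<lambda>\<omega>. \<lambda>k\<in>{1..}. H k \<omega>"
  have "distr M borel (X k) = density lborel (\<lambda>x. ennreal (f1 x))" if "1 \<le> k" for k
  proof -
    have "distr M borel (X k) = distr M lborel (X k)" by (rule distr_cong) auto
    then show ?thesis using distributed_distr_eq_density[OF X_dist[OF that]] by simp
  qed
  then have X_law: "distr M seq_space ?Xs = iid_law f1"
    unfolding iid_law_def by (rule M.iid_sequence_law[OF X_indep])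
  have Xs: "?Xs \<in> measurable M seq_space" and Hs: "?Hs \<in> measurable M seq_space"
    using M.indep_var_rv1[OF HX_indep] M.indep_var_rv2[OF HX_indep] by auto
  have \<tau>: "(\<integral>\<^sup>+\<omega>. ennreal_of_enat (\<tau> h \<omega>) \<partial>M) = ?E h" for h
  proof -
    have "?E h = (\<integral>\<^sup>+\<omega>. \<phi> h (?Xs \<omega>) \<partial>M)"
      unfolding X_law[symmetric] by (rule nn_integral_distr[OF Xs]) (simp add: \<phi>_meas)
    then show ?thesis unfolding \<phi>_restrict by (simp add: \<phi>_def \<tau>_def)
  qed

  obtain \<epsilon> where \<epsilon>: "0 < \<epsilon>" "AE \<omega> in M. \<forall>K. \<exists>k\<ge>K. \<epsilon> < H k \<omega>"
    using M.AE_infinitely_often_large[OF H_meas H_ident H_indep] H_mean(2) energy by auto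
  have "AE \<omega> in M. \<forall>k. 1 \<le> k \<longrightarrow> 0 \<le> H k \<omega>"
    unfolding AE_all_countable using H_nonneg by (auto intro: AE_mp)
  with \<epsilon>(2) have slots: "AE \<omega> in M. infinite (sensing_slots Es b (\<lambda>k. H k \<omega>))"
    by eventually_elim (rule infinite_sensing_slots[OF _ \<epsilon>(1)], auto)

  have S: "sensing_slots Es b (?Hs \<omega>) = sensing_slots Es b (\<lambda>k. H k \<omega>)" for \<omega>
    by (rule sensing_slots_cong) simp
  have \<tau>obs: "(\<integral>\<^sup>+\<omega>. ennreal_of_enat (\<tau>obs h \<omega>) \<partial>M) = ?E h" for h
  proof -
    \<comment> \<open>The observed sequence as a measurable function of the pair of energies and
      samples, so that their independence can be applied.\<close>
    let ?obs = "\<lambda>p. \<lambda>n\<in>{1..}. snd p (slot Es b (fst p) (n - 1))"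
    have "(\<integral>\<^sup>+\<omega>. ennreal_of_enat (\<tau>obs h \<omega>) \<partial>M) = (\<integral>\<^sup>+\<omega>. \<phi> h (?obs (?Hs \<omega>, ?Xs \<omega>)) \<partial>M)"
    proof (rule nn_integral_cong_AE)
      show "AE \<omega> in M. ennreal_of_enat (\<tau>obs h \<omega>) = \<phi> h (?obs (?Hs \<omega>, ?Xs \<omega>))"
        using slots
      proof eventually_elim
        fix \<omega> assume inf: "infinite (sensing_slots Es b (\<lambda>k. H k \<omega>))"
        have "1 \<le> enumerate (sensing_slots Es b (\<lambda>k. H k \<omega>)) n" for n
          using enumerate_in_set[OF inf, of n] by (simp add: sensing_slots_def)
        then have "observed Es b (\<lambda>k. H k \<omega>) (\<lambda>k. X k \<omega>) n = ?obs (?Hs \<omega>, ?Xs \<omega>) n" if "1 \<le> n" for n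
          using that inf by (simp add: observed_def slot_eq_enumerate S)
        then have "\<tau>obs h \<omega> = detection_time (\<lambda>n. llr f0 f1 (?obs (?Hs \<omega>, ?Xs \<omega>) n)) h"
          unfolding \<tau>obs_def by (intro detection_time_cong) simp
        then show "ennreal_of_enat (\<tau>obs h \<omega>) = \<phi> h (?obs (?Hs \<omega>, ?Xs \<omega>))"
          by (simp only: \<phi>_def)
      qed
    qed
    \<comment> \<open>Independence freezes the energies, and with them the slots, while the samples
      keep their law.\<close>
    also have "\<dots> = (\<integral>\<^sup>+\<omega>. (\<integral>\<^sup>+x. \<phi> h (?obs (?Hs \<omega>, x)) \<partial>distr M seq_space ?Xs) \<partial>M)"
      by (rule M.nn_integral_indep_var[OF HX_indep, of "\<lambda>p. \<phi> h (?obs p)"])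
        (rule measurable_compose[OF observed_measurable \<phi>_meas])
    also have "\<dots> = (\<integral>\<^sup>+\<omega>. ?E h \<partial>M)"
      unfolding X_law
    proof (rule nn_integral_cong_AE)
      show "AE \<omega> in M. (\<integral>\<^sup>+x. \<phi> h (?obs (?Hs \<omega>, x)) \<partial>iid_law f1) = ?E h"
        using slots
      proof eventually_elim
        fix \<omega> assume inf: "infinite (sensing_slots Es b (\<lambda>k. H k \<omega>))"
        have e: "slot Es b (?Hs \<omega>) n = enumerate (sensing_slots Es b (\<lambda>k. H k \<omega>)) n" for n
          using inf S by (simp add: slot_eq_enumerate)
        have "inj_on (\<lambda>n. slot Es b (?Hs \<omega>) (n - 1)) {1..}"
          unfolding e using inf strict_mono_enumerate[OF inf]
          by (auto simp: inj_on_def strict_mono_eq)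
        moreover have "1 \<le> slot Es b (?Hs \<omega>) (n - 1)" for n
          unfolding e using enumerate_in_set[OF inf] by (auto simp: sensing_slots_def)
        ultimately show "(\<integral>\<^sup>+x. \<phi> h (?obs (?Hs \<omega>, x)) \<partial>iid_law f1) = ?E h"
          using nn_integral_iid_law_reindex[OF dens(2) \<phi>_meas, of "\<lambda>n. slot Es b (?Hs \<omega>) (n - 1)" h] by simp
      qed
    qed
    also have "\<dots> = ?E h" by (simp add: M.emeasure_space_1)
    finally show ?thesis .
  qed

  show ?thesis
    unfolding \<tau> \<tau>obs
    using L.AE_ladder_epoch_finite L.ladder_height_moments(1) slots fin lim by blast
qed

end
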